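(* Let $n=2m$ be an even positive integer and let $M_{n,0}$ be the set of elements $w\in S_n$ with $w=w^{-1}$ and no fixed points. For pairs $(i,j)$ and $(k,l)$ of distinct elements of $\{1,\dots,n\}$, let $(i',j')$ and $(k',l')$ denote their sorted versions, so that $i'<j'$ and $k'<l'$, and write $(i,j)<(k,l)$ if $(i',j')<(k',l')$ in lexicographic order. For $g\in S_n$ and $w\in M_{n,0}$, let $i_1(g,w)$ be the number of pairs of indices $i<j$ such that $w(i)=j$ and $g(i)>g(j)$, and let $$i_2(g,w)=i_1(g,w)+\#\{(i,j)<(k,l)\mid i<j,\ k<l,\ w(i)=j,\ w(k)=l,\ (g(i),g(j))>(g(k),g(l))\}.$$ Define a representation $\rho_2$ of $S_n$ on the space $\mathbf{C}[M_{n,0}]$ of complex-valued functions on $M_{n,0}$ by $$(\rho_2(g)f)(w)=(-1)^{i_2(g^{-1},w)}f(g^{-1}wg)\qquad(g\in S_n,\ w\in M_{n,0}).$$ Then $$\mathbf{C}[M_{n,0}]\cong\bigoplus_{\lambda\in\mathrm{TP}(n)}V_\lambda,$$ where $\mathrm{TP}(n)$ is the set of threshold partitions of $n$.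
   Context: For a partition $\lambda=(\lambda_1,\dots,\lambda_l)$ of $n$, let $X_\lambda$ be the set of ordered set partitions $(S_1,\dots,S_l)$ of $\{1,\dots,n\}$ with $|S_i|=\lambda_i$, with the natural action of $S_n$, and let $\mathbf{C}[X_\lambda]$ be the corresponding permutation representation. Let $\epsilon$ be the sign character of $S_n$ and $\lambda'$ the conjugate partition, $\lambda'_i=\#\{j\mid\lambda_j\ge i\}$. $V_\lambda$ denotes the unique irreducible complex representation of $S_n$ which occurs in both $\mathbf{C}[X_\lambda]$ and $\mathbf{C}[X_{\lambda'}]\otimes\epsilon$; as $\lambda$ runs over partitions of $n$, the $V_\lambda$ form a set of representatives of isomorphism classes of irreducible complex representations of $S_n$. For a partition $\lambda$, the Durfee rank is the largest index $r$ such that $\lambda_r\ge r$. For $i=1,\dots,r$ let $\alpha_i=\lambda_i-i$ and $\beta_i=\lambda'_i-i$. The partition $\lambda$ is called a threshold partition if $\beta_i=\alpha_i+1$ for all $i=1,\dots,r$. Products of permutations are composed as functions: $(gh)(i)=g(h(i))$. *)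

theory Defs
  imports
    Complex_Main
    "HOL-Library.Function_Algebras"
    "HOL-Algebra.Sym_Groups"
begin

section \<open>Complex representations of a group on spaces of functions\<close>

definition fscale :: "complex \<Rightarrow> ('x \<Rightarrow> complex) \<Rightarrow> ('x \<Rightarrow> complex)" where
  "fscale c f = (\<lambda>x. c * f x)"

global_interpretation cfun: vector_space fscale
  by unfold_locales (simp_all add: fscale_def fun_eq_iff algebra_simps)

text \<open>
  A representation is carried by a linear subspace of a space of functions \<open>'x \<Rightarrow> complex\<close>.
  The values of \<open>rep_act\<close> outside the group or outside the carrying space are irrelevant.
\<close>

record ('g, 'x) rep =
  rep_space :: "('x \<Rightarrow> complex) set"
  rep_act :: "'g \<Rightarrow> ('x \<Rightarrow> complex) \<Rightarrow> ('x \<Rightarrow> complex)"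

definition linear_map_on :: "('x \<Rightarrow> complex) set \<Rightarrow> (('x \<Rightarrow> complex) \<Rightarrow> ('y \<Rightarrow> complex)) \<Rightarrow> bool" where
  "linear_map_on V T \<longleftrightarrow>
     (\<forall>u\<in>V. \<forall>v\<in>V. T (u + v) = T u + T v) \<and>
     (\<forall>c. \<forall>v\<in>V. T (fscale c v) = fscale c (T v))"

definition is_rep :: "'g monoid \<Rightarrow> ('g, 'x) rep \<Rightarrow> bool" where
  "is_rep G R \<longleftrightarrow>
     group G \<and>
     cfun.subspace (rep_space R) \<and>
     (\<forall>g\<in>carrier G. linear_map_on (rep_space R) (rep_act R g) \<and>
                     rep_act R g ` rep_space R \<subseteq> rep_space R) \<and>
     (\<forall>v\<in>rep_space R. rep_act R \<one>\<^bsub>G\<^esub> v = v) \<and>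
     (\<forall>g\<in>carrier G. \<forall>h\<in>carrier G. \<forall>v\<in>rep_space R.
        rep_act R (g \<otimes>\<^bsub>G\<^esub> h) v = rep_act R g (rep_act R h v))"

definition invariant_subspace :: "'g monoid \<Rightarrow> ('g, 'x) rep \<Rightarrow> ('x \<Rightarrow> complex) set \<Rightarrow> bool" where
  "invariant_subspace G R W \<longleftrightarrow>
     cfun.subspace W \<and> W \<subseteq> rep_space R \<and> (\<forall>g\<in>carrier G. rep_act R g ` W \<subseteq> W)"

definition rep_isomorphic :: "'g monoid \<Rightarrow> ('g, 'x) rep \<Rightarrow> ('g, 'y) rep \<Rightarrow> bool" where
  "rep_isomorphic G R S \<longleftrightarrow>
     is_rep G R \<and> is_rep G S \<and>
     (\<exists>T. linear_map_on (rep_space R) T \<and> bij_betw T (rep_space R) (rep_space S) \<and>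
          (\<forall>g\<in>carrier G. \<forall>v\<in>rep_space R. T (rep_act R g v) = rep_act S g (T v)))"

definition irreducible_rep :: "'g monoid \<Rightarrow> ('g, 'x) rep \<Rightarrow> bool" where
  "irreducible_rep G R \<longleftrightarrow>
     is_rep G R \<and> rep_space R \<noteq> {0} \<and>
     (\<forall>W. invariant_subspace G R W \<longrightarrow> W = {0} \<or> W = rep_space R)"

definition occurs_in :: "'g monoid \<Rightarrow> ('g, 'x) rep \<Rightarrow> ('g, 'y) rep \<Rightarrow> bool" where
  "occurs_in G R S \<longleftrightarrow>
     (\<exists>W. invariant_subspace G S W \<and> rep_isomorphic G R (S\<lparr>rep_space := W\<rparr>))"

text \<open>The direct sum of the \<open>R i\<close> for \<open>i \<in> I\<close>, where the index set \<open>I\<close> is finite.\<close>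

definition direct_sum :: "'i set \<Rightarrow> ('i \<Rightarrow> ('g, 'x) rep) \<Rightarrow> ('g, 'i \<times> 'x) rep" where
  "direct_sum I R =
     \<lparr>rep_space = {f. (\<forall>i\<in>I. (\<lambda>x. f (i, x)) \<in> rep_space (R i)) \<and> (\<forall>i. i \<notin> I \<longrightarrow> (\<forall>x. f (i, x) = 0))},
      rep_act = (\<lambda>g f (i, x). if i \<in> I then rep_act (R i) g (\<lambda>y. f (i, y)) x else 0)\<rparr>"

text \<open>The complex-valued functions on the set \<open>X\<close>, extended by 0 to the whole type.\<close>

definition functions_on :: "'x set \<Rightarrow> ('x \<Rightarrow> complex) set" where
  "functions_on X = {f. \<forall>x. x \<notin> X \<longrightarrow> f x = 0}"

definition perm_rep :: "'g monoid \<Rightarrow> 'x set \<Rightarrow> ('g \<Rightarrow> 'x \<Rightarrow> 'x) \<Rightarrow> ('g, 'x) rep" where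
  "perm_rep G X act =
     \<lparr>rep_space = functions_on X,
      rep_act = (\<lambda>g f x. if x \<in> X then f (act (inv\<^bsub>G\<^esub> g) x) else 0)\<rparr>"

text \<open>
  The tensor product with the one-dimensional sign representation: \<open>V \<otimes> \<complex>\<close> is identified with
  \<open>V\<close>, so only the action changes, by the scalar \<open>sign g\<close>.
\<close>

definition sign_twist :: "(nat \<Rightarrow> nat, 'x) rep \<Rightarrow> (nat \<Rightarrow> nat, 'x) rep" where
  "sign_twist R = R\<lparr>rep_act := (\<lambda>g v. fscale (of_int (sign g)) (rep_act R g v))\<rparr>"


section \<open>Partitions\<close>

definition is_partition :: "nat \<Rightarrow> nat list \<Rightarrow> bool" where
  "is_partition n l \<longleftrightarrow> sorted_wrt (\<ge>) l \<and> 0 \<notin> set l \<and> sum_list l = n"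

text \<open>The parts are indexed from 1, and \<open>part l i = 0\<close> beyond the last one.\<close>

definition part :: "nat list \<Rightarrow> nat \<Rightarrow> nat" where
  "part l i = (if 1 \<le> i \<and> i \<le> length l then l ! (i - 1) else 0)"

definition conjugate :: "nat list \<Rightarrow> nat list" where
  "conjugate l = map (\<lambda>i. card {j \<in> {1..length l}. part l j \<ge> i}) [1..<Suc (part l 1)]"

definition durfee_rank :: "nat list \<Rightarrow> nat" where
  "durfee_rank l = Max {r \<in> {0..length l}. part l r \<ge> r}"

definition frob_alpha :: "nat list \<Rightarrow> nat \<Rightarrow> int" where
  "frob_alpha l i = int (part l i) - int i"

definition frob_beta :: "nat list \<Rightarrow> nat \<Rightarrow> int" where
  "frob_beta l i = int (part (conjugate l) i) - int i"

definition threshold_partition :: "nat list \<Rightarrow> bool" where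
  "threshold_partition l \<longleftrightarrow>
     (\<forall>i\<in>{1..durfee_rank l}. frob_beta l i = frob_alpha l i + 1)"

definition TP :: "nat \<Rightarrow> nat list set" where
  "TP n = {l. is_partition n l \<and> threshold_partition l}"


section \<open>The irreducible representations of the symmetric groups\<close>

definition ordered_set_partitions :: "nat list \<Rightarrow> nat set list set" where
  "ordered_set_partitions l =
     {S. length S = length l \<and>
         (\<forall>i<length l. card (S ! i) = l ! i) \<and>
         (\<forall>i<length l. \<forall>j<length l. i \<noteq> j \<longrightarrow> S ! i \<inter> S ! j = {}) \<and>
         \<Union> (set S) = {1..sum_list l}}"

definition young_perm_rep :: "nat list \<Rightarrow> (nat \<Rightarrow> nat, nat set list) rep" where
  "young_perm_rep l =
     perm_rep (sym_group (sum_list l)) (ordered_set_partitions l) (\<lambda>g. map (\<lambda>A. g ` A))"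

text \<open>
  \<open>V_irr l\<close> is determined only up to isomorphism. Every representation occurring in
  \<open>young_perm_rep l\<close> is isomorphic to one carried by functions on \<open>nat set list\<close>, so fixing this
  type restricts nothing.
\<close>

definition V_irr :: "nat list \<Rightarrow> (nat \<Rightarrow> nat, nat set list) rep" where
  "V_irr l =
     (SOME V. irreducible_rep (sym_group (sum_list l)) V \<and>
              occurs_in (sym_group (sum_list l)) V (young_perm_rep l) \<and>
              occurs_in (sym_group (sum_list l)) V (sign_twist (young_perm_rep (conjugate l))))"


section \<open>The representation on fixed-point-free involutions\<close>

definition fpf_involutions :: "nat \<Rightarrow> (nat \<Rightarrow> nat) set" where
  "fpf_involutions n =
     {w \<in> carrier (sym_group n). w = inv\<^bsub>sym_group n\<^esub> w \<and> (\<forall>i\<in>{1..n}. w i \<noteq> i)}"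

definition sort_pair :: "nat \<times> nat \<Rightarrow> nat \<times> nat" where
  "sort_pair p = (min (fst p) (snd p), max (fst p) (snd p))"

definition pair_less :: "nat \<times> nat \<Rightarrow> nat \<times> nat \<Rightarrow> bool" where
  "pair_less p q \<longleftrightarrow> (sort_pair p, sort_pair q) \<in> less_than <*lex*> less_than"

definition i1 :: "nat \<Rightarrow> (nat \<Rightarrow> nat) \<Rightarrow> (nat \<Rightarrow> nat) \<Rightarrow> nat" where
  "i1 n g w = card {(i, j). i \<in> {1..n} \<and> j \<in> {1..n} \<and> i < j \<and> w i = j \<and> g i > g j}"

definition i2 :: "nat \<Rightarrow> (nat \<Rightarrow> nat) \<Rightarrow> (nat \<Rightarrow> nat) \<Rightarrow> nat" where
  "i2 n g w = i1 n g w +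
     card {((i, j), (k, l)).
             i \<in> {1..n} \<and> j \<in> {1..n} \<and> k \<in> {1..n} \<and> l \<in> {1..n} \<and>
             pair_less (i, j) (k, l) \<and> i < j \<and> k < l \<and> w i = j \<and> w k = l \<and>
             pair_less (g k, g l) (g i, g j)}"

definition rho2 :: "nat \<Rightarrow> (nat \<Rightarrow> nat, nat \<Rightarrow> nat) rep" where
  "rho2 n =
     \<lparr>rep_space = functions_on (fpf_involutions n),
      rep_act = (\<lambda>g f w.
        if w \<in> fpf_involutions n
        then (- 1) ^ i2 n (inv\<^bsub>sym_group n\<^esub> g) w * f (inv\<^bsub>sym_group n\<^esub> g \<circ> w \<circ> g)
        else 0)\<rparr>"

end

theory Submission
  imports Defs
begin

text \<open>
  Write \<open>R\<close> for \<open>rho2 n\<close>, a signed permutation representation on perfect matchings. For a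
  colouring \<open>c\<close> of \<open>{1..n}\<close> with class sizes \<open>\<lambda>\<close>, a matching on which a vector fixed by the colour
  stabiliser is nonzero projects to a simple graph on the colours with degree sequence \<open>\<lambda>\<close>; a
  vector on which the stabiliser acts by the sign gives in the same way a graph without multiple
  edges in which loops are allowed.

  In a nonzero invariant subspace, choose a colouring with a nonzero fixed vector and with minimal
  sum of the colours. The raising operators kill this vector, and antisymmetrising it over the
  columns of a Young diagram, one cell at a time, never gives zero. So the subspace contains both a
  fixed vector of shape \<open>\<lambda>\<close> and an alternating vector of shape \<open>\<lambda>'\<close>. The Erdos-Gallai inequalities for
  the two resulting graphs bound \<open>\<Sum>i\<le>k. \<beta>\<^sub>i - \<alpha>\<^sub>i\<close> from below and from above by \<open>k\<close>, for every \<open>k\<close> up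
  to the Durfee rank; hence \<open>\<lambda>\<close> is a threshold partition.

  Conversely, for a threshold partition \<open>\<lambda>\<close> the simple graph with degree sequence \<open>\<lambda>\<close> exists and is
  unique, so the fixed vectors of shape \<open>\<lambda>\<close> in \<open>R\<close> form a line. Each such line generates an irreducible
  subspace; these subspaces are pairwise orthogonal, and by the first part they span \<open>R\<close>. Each is
  isomorphic to \<open>V_irr \<lambda>\<close>, because a 0-1 matrix with row sums \<open>\<lambda>\<close> and column sums \<open>\<lambda>'\<close> is unique.
\<close>

section \<open>Linear actions of the symmetric group\<close>

text \<open>Two exchanges at a single matching decide everything: reversing an edge multiplies the
  value there by -1, and so does exchanging two edges. A vector fixed by a colour stabiliser
  therefore vanishes at a matching with an edge inside a colour class or with two edges joining the
  same two classes. If the stabiliser acts by the sign, a reversal is consistent and only the double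
  edges are excluded, so loops remain. This is the source of the two bounds \<open>k\<close>: among
  the first \<open>k\<close> colours a simple graph has at most \<open>k * k - k\<close> half-edges
  and a graph with loops at most \<open>k * k + k\<close>, a loop having two; both are compared with
  a \<open>k\<close> by \<open>k\<close> square inside the diagram.

  Since \<open>V_irr\<close> is chosen by a description, that description has to be shown
  satisfiable, and to determine the representation up to isomorphism. Satisfiability comes from the
  subspaces of \<open>rho2\<close> themselves, so neither Specht modules nor characters enter.
  Complete reducibility is not invoked either: an explicit equivariant operator built from the orbit
  of a vector serves as the projection onto its span.\<close>

abbreviation swap :: "nat \<Rightarrow> nat \<Rightarrow> nat \<Rightarrow> nat"
  where "swap \<equiv> Transposition.transpose"

lemma swap_permutes: "x \<in> {1..n} \<Longrightarrow> y \<in> {1..n} \<Longrightarrow> swap x y permutes {1..n}"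
  by (rule permutes_swap_id)

lemma comp_swap_eq: "bij g \<Longrightarrow> g \<circ> swap x y = swap (g x) (g y) \<circ> g"
  by (auto simp: fun_eq_iff Transposition.transpose_def dest: bij_is_inj injD)

lemma fscale_apply: "fscale a f x = a * f x"
  by (simp add: fscale_def)

lemma sum_fun_apply: "(\<Sum>i\<in>A. f i) x = (\<Sum>i\<in>A. f i x)"
  by (induction A rule: infinite_finite_induct) auto

text \<open>In contrast to \<open>rep_act\<close>, the operators of this locale are linear on all functions.\<close>

locale perm_action =
  fixes n :: nat and act :: "(nat \<Rightarrow> nat) \<Rightarrow> ('x \<Rightarrow> complex) \<Rightarrow> ('x \<Rightarrow> complex)"
  assumes act_add: "act g (u + v) = act g u + act g v"
    and act_scale: "act g (fscale c v) = fscale c (act g v)"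
    and act_id: "act id v = v"
    and act_comp: "g permutes {1..n} \<Longrightarrow> h permutes {1..n} \<Longrightarrow> act (g \<circ> h) v = act g (act h v)"
begin

lemma act_zero [simp]: "act g 0 = 0"
  using act_scale[of g 0 0] by simp

lemma act_neg: "act g (- v) = - act g v"
  using act_add[of g v "- v"] by (simp add: eq_neg_iff_add_eq_0 add.commute)

lemma act_sum: "act g (\<Sum>i\<in>I. f i) = (\<Sum>i\<in>I. act g (f i))"
proof (induction I rule: infinite_finite_induct)
  case (insert x F)
  then show ?case
    by (simp only: sum.insert act_add not_False_eq_True)
qed (simp_all only: sum.infinite sum.empty act_zero not_False_eq_True)

lemma act_inv:
  assumes "g permutes {1..n}"
  shows "act (inv' g) (act g v) = v" "act g (act (inv' g) v) = v"
  using act_comp[of "inv' g" g v] act_comp[of g "inv' g" v] permutes_inv[OF assms]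
    permutes_inv_o[OF assms] assms by (auto simp: act_id)

lemma act_eq_0_iff: "g permutes {1..n} \<Longrightarrow> act g v = 0 \<longleftrightarrow> v = 0"
  by (metis act_inv(1) act_zero)

abbreviation swp :: "nat \<Rightarrow> nat \<Rightarrow> ('x \<Rightarrow> complex) \<Rightarrow> ('x \<Rightarrow> complex)"
  where "swp x y \<equiv> act (swap x y)"

lemma swp_swp [simp]: "x \<in> {1..n} \<Longrightarrow> y \<in> {1..n} \<Longrightarrow> swp x y (swp x y v) = v"
  by (metis act_comp act_id permutes_swap_id transpose_comp_involutory)

lemma act_swp:
  assumes "g permutes {1..n}" "x \<in> {1..n}" "y \<in> {1..n}"
  shows "act g (swp x y v) = swp (g x) (g y) (act g v)"
proof -
  have "g \<circ> swap x y = swap (g x) (g y) \<circ> g"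
    using assms(1) by (intro comp_swap_eq) (rule permutes_bij)
  moreover have "g x \<in> {1..n}" "g y \<in> {1..n}"
    using assms permutes_in_image by fastforce+
  ultimately show ?thesis
    using assms by (metis act_comp permutes_swap_id)
qed

lemma swp_swp_conj:
  assumes "a \<in> {1..n}" "b \<in> {1..n}" "x \<in> {1..n}" "y \<in> {1..n}"
  shows "swp a b (swp x y v) = swp (swap a b x) (swap a b y) (swp a b v)"
  by (rule act_swp) (use assms in \<open>auto intro: permutes_swap_id\<close>)

section \<open>Vectors fixed or negated by transpositions, and antisymmetrisation\<close>

definition sym_on :: "nat set \<Rightarrow> ('x \<Rightarrow> complex) \<Rightarrow> bool" where
  "sym_on A v \<longleftrightarrow> (\<forall>p\<in>A. \<forall>q\<in>A. swp p q v = v)"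

definition alt_on :: "nat set \<Rightarrow> ('x \<Rightarrow> complex) \<Rightarrow> bool" where
  "alt_on A v \<longleftrightarrow> (\<forall>p\<in>A. \<forall>q\<in>A. p \<noteq> q \<longrightarrow> swp p q v = - v)"

lemma sym_onD: "sym_on A v \<Longrightarrow> p \<in> A \<Longrightarrow> q \<in> A \<Longrightarrow> swp p q v = v"
  by (auto simp: sym_on_def)

lemma alt_onD: "alt_on A v \<Longrightarrow> p \<in> A \<Longrightarrow> q \<in> A \<Longrightarrow> p \<noteq> q \<Longrightarrow> swp p q v = - v"
  by (auto simp: alt_on_def)

definition antisym :: "nat set \<Rightarrow> ('x \<Rightarrow> complex) \<Rightarrow> ('x \<Rightarrow> complex)" where
  "antisym D v = (\<Sum>g | g permutes D. fscale (of_int (sign g)) (act g v))"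

lemma antisym_empty [simp]: "antisym {} v = v"
  by (simp add: antisym_def act_id)

lemma antisym_sum: "antisym D (\<Sum>i\<in>I. f i) = (\<Sum>i\<in>I. antisym D (f i))"
  unfolding antisym_def act_sum cfun.scale_sum_right by (rule sum.swap)

lemma antisym_scale: "antisym D (fscale c v) = fscale c (antisym D v)"
  unfolding antisym_def
  by (simp only: act_scale cfun.scale_sum_right cfun.scale_left_commute[of _ c])

lemma antisym_neg: "antisym D (- v) = - antisym D v"
  using antisym_scale[of D "-1" v] by simp

lemma antisym_add: "antisym D (u + v) = antisym D u + antisym D v"
  unfolding antisym_def by (simp add: act_add cfun.scale_right_distrib sum.distrib)

lemma antisym_in:
  assumes "cfun.subspace W" "\<And>g u. g permutes {1..n} \<Longrightarrow> u \<in> W \<Longrightarrow> act g u \<in> W"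
    and "v \<in> W" "D \<subseteq> {1..n}"
  shows "antisym D v \<in> W"
  unfolding antisym_def
  using assms by (intro cfun.subspace_sum cfun.subspace_scale) (auto intro: permutes_subset)

text \<open>Every permutation of \<open>insert y D\<close> is uniquely
  \<open>swap y b \<circ> q\<close> with \<open>q\<close> permuting \<open>D\<close> and
  \<open>b\<close> in \<open>insert y D\<close>; the choice \<open>b = y\<close> gives the positive
  term and every other \<open>b\<close> a negative one.\<close>

lemma antisym_insert:
  assumes "insert y D \<subseteq> {1..n}" "y \<notin> D"
  shows "antisym (insert y D) v = antisym D v - (\<Sum>z\<in>D. swp y z (antisym D v))"
proof -
  have fin: "finite D"
    using assms finite_subset by fastforce
  have *: "fscale (of_int (sign (swap y b \<circ> q))) (act (swap y b \<circ> q) v)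
      = fscale (of_int (sign (swap y b))) (swp y b (fscale (of_int (sign q)) (act q v)))"
    if "b \<in> insert y D" "q permutes D" for b q
  proof -
    have "q permutes {1..n}" "swap y b permutes {1..n}"
      using that assms by (auto intro: permutes_subset permutes_swap_id)
    moreover have "permutation q"
      using that fin permutation_permutes by blast
    ultimately show ?thesis
      by (simp add: sign_compose permutation_swap_id act_comp act_scale)
  qed
  have "antisym (insert y D) v
      = (\<Sum>b\<in>insert y D. \<Sum>q | q permutes D. fscale (of_int (sign (swap y b \<circ> q))) (act (swap y b \<circ> q) v))"
    unfolding antisym_def by (rule sum_over_permutations_insert[OF fin assms(2)])
  also have "\<dots> = (\<Sum>b\<in>insert y D. fscale (of_int (sign (swap y b))) (swp y b (antisym D v)))"
    unfolding antisym_def act_sum cfun.scale_sum_right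
    by (intro sum.cong refl) (simp add: *)
  also have "\<dots> = antisym D v + (\<Sum>b\<in>D. - swp y b (antisym D v))"
    using fin assms(2) by (simp add: act_id, intro sum.cong) (auto simp: sign_swap_id)
  finally show ?thesis
    by (simp add: sum_negf)
qed

lemma antisym_absorb:
  assumes "D \<subseteq> {1..n}" "g permutes D"
  shows "antisym D (act g v) = fscale (of_int (sign g)) (antisym D v)"
proof -
  have fin: "finite D"
    using assms finite_subset by fastforce
  have *: "fscale (of_int (sign g)) (fscale (of_int (sign (p \<circ> g))) (act (p \<circ> g) v))
     = fscale (of_int (sign p)) (act p (act g v))" if "p permutes D" for p
  proof -
    have "p permutes {1..n}" "g permutes {1..n}"
      using that assms by (auto intro: permutes_subset)
    moreover have "permutation p" "permutation g"
      using that assms(2) fin permutation_permutes by blast+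
    ultimately show ?thesis
      by (simp add: sign_compose act_comp mult.commute flip: of_int_mult)
  qed
  have "fscale (of_int (sign g)) (antisym D v)
      = (\<Sum>p | p permutes D. fscale (of_int (sign g)) (fscale (of_int (sign (p \<circ> g))) (act (p \<circ> g) v)))"
    unfolding antisym_def by (subst sum_permutations_compose_right[OF assms(2)])
      (simp add: cfun.scale_sum_right)
  also have "\<dots> = antisym D (act g v)"
    unfolding antisym_def by (intro sum.cong refl, rule *) simp
  finally show ?thesis ..
qed

lemma alt_on_antisym:
  assumes "D \<subseteq> {1..n}"
  shows "alt_on D (antisym D v)"
  unfolding alt_on_def
proof (intro ballI impI)
  fix p q assume pq: "p \<in> D" "q \<in> D" "p \<noteq> q"
  have fin: "finite D"
    using assms finite_subset by fastforce
  let ?t = "swap p q"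
  have t: "?t permutes D"
    using pq by (intro permutes_swap_id)
  have *: "fscale (of_int (sign (?t \<circ> g))) (act (?t \<circ> g) v)
     = - act ?t (fscale (of_int (sign g)) (act g v))" if "g permutes D" for g
  proof -
    have "?t permutes {1..n}" "g permutes {1..n}"
      using that assms t by (auto intro: permutes_subset)
    moreover have "permutation g"
      using that fin permutation_permutes by blast+
    ultimately show ?thesis
      using pq by (simp add: sign_compose permutation_swap_id act_comp act_scale sign_swap_id)
  qed
  have "antisym D v = (\<Sum>g | g permutes D. fscale (of_int (sign (?t \<circ> g))) (act (?t \<circ> g) v))"
    unfolding antisym_def by (subst setum_permutations_compose_left[OF t]) simp
  also have "\<dots> = - act ?t (antisym D v)"
    unfolding antisym_def act_sum sum_negf[symmetric] by (intro sum.cong refl) (simp add: *)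
  finally show "swp p q (antisym D v) = - antisym D v"
    by (metis minus_minus)
qed

text \<open>Absorbing the transposition produces a minus sign, although it leaves \<open>v\<close>
  unchanged.\<close>

lemma antisym_swp_eq_0:
  assumes "D \<subseteq> {1..n}" "p \<in> D" "q \<in> D" "p \<noteq> q" "swp p q v = v"
  shows "antisym D v = 0"
proof -
  have "antisym D v = - antisym D v"
    using antisym_absorb[of D "swap p q" v] assms by (simp add: permutes_swap_id sign_swap_id)
  then show ?thesis
    by (simp add: fun_eq_iff)
qed

lemma act_antisym:
  assumes "D \<subseteq> {1..n}" "h permutes {1..n}" "\<And>x. x \<in> D \<Longrightarrow> h x = x"
  shows "act h (antisym D v) = antisym D (act h v)"
proof -
  have "h \<circ> g = g \<circ> h" if "g permutes D" for g
  proof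
    fix x
    show "(h \<circ> g) x = (g \<circ> h) x"
    proof (cases "x \<in> D")
      case True
      then show ?thesis
        using that assms(3) permutes_in_image by fastforce
    next
      case False
      then have "h x \<notin> D"
        using assms(2,3) permutes_inj[OF assms(2)] by (metis injD)
      then show ?thesis
        using False that by (simp add: permutes_not_in)
    qed
  qed
  then have "act h (act g v) = act g (act h v)" if "g permutes D" for g
    using that assms permutes_subset[of g D "{1..n}"] by (metis act_comp)
  then show ?thesis
    unfolding antisym_def act_sum act_scale by (intro sum.cong refl) simp
qed

lemma swp_antisym:
  assumes "D \<subseteq> {1..n}" "x \<in> {1..n} - D" "y \<in> {1..n} - D"
  shows "swp x y (antisym D v) = antisym D (swp x y v)"
  by (rule act_antisym) (use assms in \<open>auto intro!: permutes_swap_id transpose_apply_other\<close>)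

text \<open>The sum of the transpositions \<open>(x z)\<close> over \<open>z \<in> D\<close>
  commutes with every permutation of \<open>D\<close>, because conjugation only permutes the points
  \<open>z\<close>. Jucys-Murphy elements work in the same way.\<close>

lemma sum_swp_antisym:
  assumes "D \<subseteq> {1..n}" "x \<in> {1..n} - D"
  shows "(\<Sum>z\<in>D. swp x z (antisym D v)) = antisym D (\<Sum>z\<in>D. swp x z v)"
proof -
  have "(\<Sum>z\<in>D. swp x z (act g v)) = act g (\<Sum>z\<in>D. swp x z v)" if "g permutes D" for g
  proof -
    have "act g (\<Sum>z\<in>D. swp x z v) = (\<Sum>z\<in>D. swp x (g z) (act g v))"
      unfolding act_sum
    proof (intro sum.cong refl)
      fix z assume "z \<in> D"
      moreover have "g x = x"
        using assms that by (auto simp: permutes_not_in)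
      ultimately show "act g (swp x z v) = swp x (g z) (act g v)"
        using act_swp[of g x z v] assms that permutes_subset[OF that assms(1)] by auto
    qed
    also have "\<dots> = (\<Sum>z\<in>D. swp x z (act g v))"
      using sum.permute[OF that, of "\<lambda>z. swp x z (act g v)"] by (simp add: o_def)
    finally show ?thesis ..
  qed
  then show ?thesis
    unfolding antisym_def act_sum
    by (subst sum.swap, intro sum.cong refl)
      (simp only: act_scale act_sum mem_Collect_eq flip: cfun.scale_sum_right)
qed

text \<open>
  If \<open>antisym (insert y D) v = 0\<close>, then \<open>u = antisym D v\<close> equals \<open>\<Sum>z\<in>D. (x z) u\<close> for every
  \<open>x \<in> A\<close>, and summing over \<open>A\<close> gives \<open>|A| u = - |D| u\<close>.
\<close>

lemma antisym_insert_nonzero: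
  assumes D: "D \<subseteq> {1..n}" and A: "A \<subseteq> {1..n}" "y \<in> A" "A \<inter> D = {}"
    and sym: "sym_on A v"
    and raise: "\<And>z. z \<in> D \<Longrightarrow> (\<Sum>x\<in>A. swp x z v) = - v"
    and nz: "antisym D v \<noteq> 0"
  shows "antisym (insert y D) v \<noteq> 0"
proof
  assume eq0: "antisym (insert y D) v = 0"
  define u where "u = antisym D v"
  have y: "y \<notin> D" "insert y D \<subseteq> {1..n}"
    using A D by auto
  have u: "u = (\<Sum>z\<in>D. swp y z u)"
    using antisym_insert[OF y(2,1), of v] eq0 by (simp add: u_def)
  \<comment> \<open>Conjugation by \<open>(x y)\<close> moves the relation at \<open>y\<close> to
    \<open>x\<close>; this transposition fixes \<open>u\<close>, since it fixes \<open>v\<close> and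
    avoids \<open>D\<close>.\<close>
  have ux: "u = (\<Sum>z\<in>D. swp x z u)" if x: "x \<in> A" for x
  proof -
    have x': "x \<in> {1..n} - D" "y \<in> {1..n} - D"
      using x A by auto
    have fix_u: "swp x y u = u"
      using sym x A(2) swp_antisym[OF D x', of v] by (simp add: u_def sym_onD)
    have "u = (\<Sum>z\<in>D. swp x y (swp y z u))"
      using fix_u u act_sum[of "swap x y" "\<lambda>z. swp y z u" D] by metis
    also have "\<dots> = (\<Sum>z\<in>D. swp x z u)"
    proof (intro sum.cong refl)
      fix z assume z: "z \<in> D"
      then have "swap x y z = z"
        using x' by (intro transpose_apply_other) auto
      then show "swp x y (swp y z u) = swp x z u"
        using swp_swp_conj[of x y y z u] x' z D by (auto simp: fix_u)
    qed
    finally show ?thesis .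
  qed
  have "fscale (of_nat (card A)) u = (\<Sum>x\<in>A. u)"
    by (simp only: cfun.sum_constant_scale)
  also have "\<dots> = (\<Sum>x\<in>A. \<Sum>z\<in>D. swp x z u)"
    using ux by (intro sum.cong) auto
  also have "\<dots> = (\<Sum>x\<in>A. antisym D (\<Sum>z\<in>D. swp x z v))"
    unfolding u_def using A D by (intro sum.cong refl sum_swp_antisym) auto
  also have "\<dots> = antisym D (\<Sum>z\<in>D. \<Sum>x\<in>A. swp x z v)"
    by (subst sum.swap) (simp add: antisym_sum)
  also have "\<dots> = antisym D (\<Sum>z\<in>D. - v)"
    using raise by simp
  also have "\<dots> = - fscale (of_nat (card D)) u"
    by (simp only: u_def cfun.sum_constant_scale cfun.scale_minus_right antisym_neg antisym_scale)
  finally have "fscale (of_nat (card A) + of_nat (card D)) u = 0"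
    by (simp add: cfun.scale_left_distrib)
  moreover have "(of_nat (card A) + of_nat (card D) :: complex) \<noteq> 0"
    using A finite_subset[OF A(1)] by (metis card_0_eq add_eq_0_iff_both_eq_0 empty_iff
      finite_atLeastAtMost of_nat_add of_nat_eq_0_iff)
  ultimately show False
    using nz by (simp add: u_def)
qed

end

section \<open>Conjugate partitions and colourings\<close>

text \<open>Row and column lengths of one diagram, stated as a Galois connection; the condition is
  symmetric, so each fact about rows is also one about columns. Index 0 is pinned to 0 so that a
  colouring of shape \<open>p\<close> never uses the colour 0.\<close>

definition conj_pair :: "(nat \<Rightarrow> nat) \<Rightarrow> (nat \<Rightarrow> nat) \<Rightarrow> bool" where
  "conj_pair p q \<longleftrightarrow> p 0 = 0 \<and> q 0 = 0 \<and> (\<forall>i\<ge>1. \<forall>j\<ge>1. j \<le> p i \<longleftrightarrow> i \<le> q j)"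

definition shape :: "nat \<Rightarrow> (nat \<Rightarrow> nat) \<Rightarrow> (nat \<Rightarrow> nat) \<Rightarrow> bool" where
  "shape n c p \<longleftrightarrow> (\<forall>i. card {x\<in>{1..n}. c x = i} = p i)"

definition diagram :: "(nat \<Rightarrow> nat) \<Rightarrow> (nat \<times> nat) set" where
  "diagram p = {(i, j). 1 \<le> i \<and> 1 \<le> j \<and> j \<le> p i}"

lemma conj_pairD: "conj_pair p q \<Longrightarrow> i \<ge> 1 \<Longrightarrow> j \<ge> 1 \<Longrightarrow> j \<le> p i \<longleftrightarrow> i \<le> q j"
  by (simp add: conj_pair_def)

lemma conj_pair_sym: "conj_pair p q \<Longrightarrow> conj_pair q p"
  by (auto simp: conj_pair_def)

lemma conj_pair_antimono:
  assumes "conj_pair p q" "1 \<le> i" "i \<le> k"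
  shows "p k \<le> p i"
proof (cases "p k = 0")
  case False
  then have "k \<le> q (p k)"
    using conj_pairD[OF assms(1), of k "p k"] assms by simp
  then show ?thesis
    using conj_pairD[OF assms(1), of i "p k"] assms False by simp
qed simp

lemma conj_pair_0: "conj_pair p q \<Longrightarrow> q 1 < i \<Longrightarrow> p i = 0"
  using conj_pairD[of p q i 1] by (cases "p i") auto

lemma card_fibres:
  assumes "finite X" "finite I" "f ` X \<subseteq> I"
  shows "card X = (\<Sum>i\<in>I. card {x\<in>X. f x = i})"
  using sum.group[OF assms, of "\<lambda>_. 1::nat"] by simp

lemma card_filter: "finite A \<Longrightarrow> card {x\<in>A. P x} = (\<Sum>x\<in>A. of_bool (P x))"
  using sum.inter_filter[of A "\<lambda>_. 1::nat" P] by (simp add: of_bool_def)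

text \<open>Both sides count the cells in the first \<open>k\<close> columns, once by columns and
  once by rows. \<open>N\<close> is any bound on the number of rows, so that one value can serve a
  partition and its conjugate.\<close>

lemma conj_pair_sum:
  assumes "conj_pair p q" "q 1 \<le> N"
  shows "(\<Sum>j=1..k. q j) = (\<Sum>i=1..N. min k (p i))"
proof -
  have q: "q j = (\<Sum>i=1..N. of_bool (j \<le> p i))" if "j \<in> {1..k}" for j
  proof -
    have "q j \<le> N"
      using conj_pair_antimono[OF conj_pair_sym[OF assms(1)], of 1 j] assms(2) that by simp
    then have "{i\<in>{1..N}. j \<le> p i} = {1..q j}"
      using conj_pairD[OF assms(1)] that by auto
    then have "q j = card {i\<in>{1..N}. j \<le> p i}"
      by simp
    then show ?thesis
      by (simp only: card_filter finite_atLeastAtMost)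
  qed
  have p: "(\<Sum>j=1..k. of_bool (j \<le> p i)) = min k (p i)" for i
  proof -
    have "{j\<in>{1..k}. j \<le> p i} = {1..min k (p i)}"
      by auto
    then show ?thesis
      using card_filter[of "{1..k}" "\<lambda>j. j \<le> p i"] by simp
  qed
  have "(\<Sum>j=1..k. q j) = (\<Sum>j=1..k. \<Sum>i=1..N. of_bool (j \<le> p i))"
    using q by (intro sum.cong) auto
  also have "\<dots> = (\<Sum>i=1..N. \<Sum>j=1..k. of_bool (j \<le> p i))"
    by (rule sum.swap)
  finally show ?thesis
    by (simp only: p)
qed

text \<open>For \<open>k\<close> up to the Durfee rank the first \<open>k\<close> rows all reach
  column \<open>k\<close>, and their cells there form the square \<open>k * k\<close>. The last
  premise is conditional so that \<open>k = 0\<close> is covered.\<close>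

lemma conj_pair_sum_square:
  assumes "conj_pair p q" "q 1 \<le> N" "k \<le> N" "k \<ge> 1 \<Longrightarrow> k \<le> p k"
  shows "(\<Sum>j=1..k. q j) = k * k + (\<Sum>i=Suc k..N. min k (p i))"
proof -
  have "min k (p i) = k" if "i \<in> {1..k}" for i
    using conj_pair_antimono[OF assms(1), of i k] assms(4) that by auto
  then have "(\<Sum>i=1..k. min k (p i)) = k * k"
    by simp
  moreover have "(\<Sum>i=1..N. min k (p i)) = (\<Sum>i=1..k. min k (p i)) + (\<Sum>i=Suc k..N. min k (p i))"
    using assms(3) sum.ub_add_nat[of 1 k "\<lambda>i. min k (p i)" "N - k"] by simp
  ultimately show ?thesis
    using conj_pair_sum[OF assms(1,2), of k] by simp
qed

lemma shape_colour:
  assumes "shape n c p" "x \<in> {1..n}" "p 0 = 0"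
  shows "c x \<ge> 1" "p (c x) > 0"
proof -
  have "x \<in> {y\<in>{1..n}. c y = c x}" "finite {y\<in>{1..n}. c y = c x}"
    using assms by simp_all
  then have "card {y\<in>{1..n}. c y = c x} > 0"
    unfolding card_gt_0_iff by blast
  then show "p (c x) > 0"
    using assms by (simp add: shape_def)
  then show "c x \<ge> 1"
    using assms(3) by (cases "c x") auto
qed

lemma shape_colour_le:
  assumes "shape n c p" "conj_pair p q" "x \<in> {1..n}"
  shows "1 \<le> c x" "c x \<le> q 1"
proof -
  have 0: "p 0 = 0"
    using assms(2) by (simp add: conj_pair_def)
  show "1 \<le> c x"
    by (rule shape_colour(1)[OF assms(1,3) 0])
  show "c x \<le> q 1"
    using shape_colour(2)[OF assms(1,3) 0] conj_pair_0[OF assms(2), of "c x"] by (intro leI) auto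
qed

lemma card_colour_le:
  assumes "shape n c p" "p 0 = 0"
  shows "card {x\<in>{1..n}. c x \<le> k} = (\<Sum>i=1..k. p i)"
proof -
  let ?X = "{x\<in>{1..n}. c x \<le> k}"
  have "card ?X = (\<Sum>i\<in>{1..k}. card {x\<in>?X. c x = i})"
    using shape_colour(1)[OF assms(1) _ assms(2)] by (intro card_fibres) auto
  also have "\<dots> = (\<Sum>i\<in>{1..k}. p i)"
  proof (intro sum.cong refl)
    fix i assume "i \<in> {1..k}"
    then have "{x\<in>?X. c x = i} = {x\<in>{1..n}. c x = i}"
      by auto
    then show "card {x\<in>?X. c x = i} = p i"
      using assms(1) by (simp add: shape_def)
  qed
  finally show ?thesis .
qed

lemma shape_sum:
  assumes "shape n c p" "conj_pair p q" "q 1 \<le> N"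
  shows "(\<Sum>i=1..N. p i) = n"
proof -
  have "{x\<in>{1..n}. c x \<le> N} = {1..n}"
    using order_trans[OF shape_colour_le(2)[OF assms(1,2)] assms(3)] by auto
  moreover have "p 0 = 0"
    using assms(2) by (simp add: conj_pair_def)
  ultimately show ?thesis
    using card_colour_le[OF assms(1), of N] by simp
qed

lemma diagram_bounds:
  assumes "conj_pair p q" "(i, j) \<in> diagram p"
  shows "i \<in> {1..q 1}" "j \<in> {1..p 1}"
proof -
  have ij: "1 \<le> i" "1 \<le> j" "j \<le> p i"
    using assms(2) by (auto simp: diagram_def)
  then show "i \<in> {1..q 1}"
    using conj_pairD[OF assms(1), of i 1] by simp
  show "j \<in> {1..p 1}"
    using conj_pair_antimono[OF assms(1), of 1 i] ij by simp
qed

lemma finite_diagram: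
  assumes "conj_pair p q"
  shows "finite (diagram p)"
proof (rule finite_subset)
  show "diagram p \<subseteq> {1..q 1} \<times> {1..p 1}"
    using diagram_bounds[OF assms] by fastforce
qed simp

lemma card_diagram:
  assumes "shape n c p" "conj_pair p q"
  shows "card (diagram p) = n"
proof -
  have *: "{ij\<in>diagram p. fst ij = i} = Pair i ` {1..p i}" if "i \<in> {1..q 1}" for i
    using that by (auto simp: diagram_def)
  have "card (diagram p) = (\<Sum>i\<in>{1..q 1}. card {ij\<in>diagram p. fst ij = i})"
    using diagram_bounds(1)[OF assms(2)]
    by (intro card_fibres finite_diagram[OF assms(2)] finite_atLeastAtMost) auto
  also have "\<dots> = (\<Sum>i\<in>{1..q 1}. p i)"
    by (intro sum.cong refl) (simp only: *, simp add: card_image inj_on_def)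
  finally show ?thesis
    using shape_sum[OF assms] by simp
qed

section \<open>Pairs of colourings with distinct joint colours, read as 0-1 matrices\<close>

lemma card_colour_min:
  assumes "shape n c p" "p 0 = 0" "shape n d r" "inj_on (\<lambda>x. (c x, d x)) {1..n}"
  shows "card {x\<in>{1..n}. c x \<le> k \<and> d x = j} \<le> min k (r j)"
proof -
  have "card {x\<in>{1..n}. c x \<le> k \<and> d x = j} \<le> card {x\<in>{1..n}. d x = j}"
    by (intro card_mono) auto
  moreover have "card {x\<in>{1..n}. c x \<le> k \<and> d x = j} \<le> card {1..k}"
  proof (rule card_inj_on_le)
    show "inj_on c {x\<in>{1..n}. c x \<le> k \<and> d x = j}"
    proof (rule inj_onI)
      fix x y assume "x \<in> {x\<in>{1..n}. c x \<le> k \<and> d x = j}" "y \<in> {x\<in>{1..n}. c x \<le> k \<and> d x = j}"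
        "c x = c y"
      then show "x = y"
        using inj_onD[OF assms(4), of x y] by simp
    qed
    show "c ` {x\<in>{1..n}. c x \<le> k \<and> d x = j} \<subseteq> {1..k}"
      using shape_colour(1)[OF assms(1) _ assms(2)] by (auto simp del: One_nat_def)
  qed simp
  ultimately show ?thesis
    using assms(3) by (simp add: shape_def)
qed

lemma card_colour_le_sum:
  assumes "shape n c p" "p 0 = 0" "shape n d r" "conj_pair r s" "s 1 \<le> N"
  shows "(\<Sum>i=1..k. p i) = (\<Sum>j=1..N. card {x\<in>{1..n}. c x \<le> k \<and> d x = j})"
proof -
  let ?X = "{x\<in>{1..n}. c x \<le> k}"
  have "card ?X = (\<Sum>j\<in>{1..N}. card {x\<in>?X. d x = j})"
    using shape_colour_le(1)[OF assms(3,4)] order_trans[OF shape_colour_le(2)[OF assms(3,4)] assms(5)]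
    by (intro card_fibres) (auto simp del: One_nat_def)
  then show ?thesis
    using card_colour_le[OF assms(1,2)] by (simp add: conj_assoc)
qed

text \<open>Each colour \<open>j\<close> of \<open>d\<close> occurs at most
  \<open>min k (r j)\<close> times among the first \<open>k\<close> colours of \<open>c\<close>, and
  summing over \<open>j\<close> gives a partial sum of the conjugate. This is the necessary half of
  the Gale-Ryser theorem.\<close>

lemma transversal_dominance:
  assumes "shape n c p" "p 0 = 0" "shape n d r" "conj_pair r s" "inj_on (\<lambda>x. (c x, d x)) {1..n}"
  shows "(\<Sum>i=1..k. p i) \<le> (\<Sum>i=1..k. s i)"
proof -
  have "(\<Sum>i=1..k. p i) \<le> (\<Sum>j=1..s 1. min k (r j))"
    unfolding card_colour_le_sum[OF assms(1-4) order_refl]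
    by (intro sum_mono card_colour_min[OF assms(1-3,5)])
  then show ?thesis
    using conj_pair_sum[OF assms(4) order_refl, of k] by simp
qed

text \<open>Extracts the extremal case of a termwise estimate: no slack in the total leaves none in
  any term. The rigidity of 0-1 matrices and of threshold graphs both rest on it.\<close>

lemma sum_eq_imp_eq:
  fixes f g :: "'a \<Rightarrow> nat"
  assumes "finite A" "\<And>i. i \<in> A \<Longrightarrow> f i \<le> g i" "sum g A \<le> sum f A" "i \<in> A"
  shows "f i = g i"
proof (rule ccontr)
  assume "f i \<noteq> g i"
  then have "sum f A < sum g A"
    using assms by (intro sum_strict_mono_ex1) (auto intro!: bexI[of _ i] le_neq_trans)
  then show False
    using assms(3) by simp
qed

text \<open>A 0-1 matrix with row sums \<open>p\<close> and column sums the conjugate \<open>q\<close> is unique.\<close>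

lemma transversal_bij_diagram:
  assumes "shape n c p" "shape n d q" "conj_pair p q" "inj_on (\<lambda>x. (c x, d x)) {1..n}"
  shows "bij_betw (\<lambda>x. (c x, d x)) {1..n} (diagram p)"
proof -
  have 0: "p 0 = 0" "q 0 = 0"
    using assms(3) by (auto simp: conj_pair_def)
  have inj': "inj_on (\<lambda>x. (d x, c x)) {1..n}"
    by (rule inj_onI, rule inj_onD[OF assms(4)]) auto
  have le: "d x \<le> p (c x)" if x: "x \<in> {1..n}" for x
  proof -
    let ?k = "p (c x)"
    \<comment> \<open>As \<open>q\<close> is conjugate to \<open>p\<close>, the dominance bound is
      attained, so each row holds the maximal number of points whose column is at most
      \<open>?k\<close>. In the row \<open>c x\<close>, of length \<open>?k\<close>, these are all
      the points.\<close>
    have *: "card {y\<in>{1..n}. d y \<le> ?k \<and> c y = i} = min ?k (p i)" if "i \<in> {1..q 1}" for i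
    proof (rule sum_eq_imp_eq[OF finite_atLeastAtMost _ _ that])
      show "(\<Sum>i\<in>{1..q 1}. min ?k (p i)) \<le> (\<Sum>i\<in>{1..q 1}. card {y\<in>{1..n}. d y \<le> ?k \<and> c y = i})"
        using card_colour_le_sum[OF assms(2) 0(2) assms(1,3) order_refl, of ?k]
        unfolding conj_pair_sum[OF assms(3) order_refl, of ?k] by (rule eq_refl)
    qed (rule card_colour_min[OF assms(2) 0(2) assms(1) inj'])
    have "card {y\<in>{1..n}. d y \<le> ?k \<and> c y = c x} = ?k"
      using *[of "c x"] shape_colour_le[OF assms(1,3) x] by (simp del: One_nat_def)
    also have "\<dots> = card {y\<in>{1..n}. c y = c x}"
      using assms(1) by (simp only: shape_def)
    finally have "card {y\<in>{1..n}. d y \<le> ?k \<and> c y = c x} = card {y\<in>{1..n}. c y = c x}" .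
    then have eq: "{y\<in>{1..n}. d y \<le> ?k \<and> c y = c x} = {y\<in>{1..n}. c y = c x}"
      by (intro card_subset_eq) auto
    have "x \<in> {y\<in>{1..n}. d y \<le> ?k \<and> c y = c x}"
      unfolding eq using x by simp
    then show ?thesis
      by simp
  qed
  have "(\<lambda>x. (c x, d x)) ` {1..n} = diagram p"
  proof (rule card_subset_eq[OF finite_diagram[OF assms(3)]])
    show "(\<lambda>x. (c x, d x)) ` {1..n} \<subseteq> diagram p"
    proof (rule image_subsetI)
      fix x assume x: "x \<in> {1..n}"
      show "(c x, d x) \<in> diagram p"
        using le[OF x] shape_colour(1)[OF assms(1) x 0(1)] shape_colour(1)[OF assms(2) x 0(2)]
        by (simp add: diagram_def)
    qed
    show "card ((\<lambda>x. (c x, d x)) ` {1..n}) = card (diagram p)"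
      unfolding card_image[OF assms(4)] card_diagram[OF assms(1,3)] by simp
  qed
  then show ?thesis
    using assms(4) by (simp add: bij_betw_def)
qed

section \<open>Permutations carrying one colouring to another\<close>

lemma relabelling_permutation:
  assumes "bij_betw f {1..n} S" "bij_betw g {1..n} S"
  obtains h where "h permutes {1..n}" "\<And>x. x \<in> {1..n} \<Longrightarrow> g (h x) = f x"
proof -
  define h where "h x = (if x \<in> {1..n} then inv_into {1..n} g (f x) else x)" for x
  have "bij_betw (inv_into {1..n} g \<circ> f) {1..n} {1..n}"
    using assms by (intro bij_betw_trans[OF assms(1)] bij_betw_inv_into)
  then have "bij_betw h {1..n} {1..n}"
    by (subst bij_betw_cong[where g = "inv_into {1..n} g \<circ> f"]) (auto simp: h_def)
  then have "h permutes {1..n}"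
    by (rule bij_imp_permutes) (auto simp: h_def)
  moreover have "g (h x) = f x" if "x \<in> {1..n}" for x
    using that assms bij_betw_inv_into_right[OF assms(2), of "f x"] bij_betwE[OF assms(1)]
    by (auto simp: h_def)
  ultimately show ?thesis
    using that by blast
qed

lemma same_shape_conjugate:
  assumes "shape n c p" "shape n c' p"
  obtains h where "h permutes {1..n}" "\<And>x. x \<in> {1..n} \<Longrightarrow> c' (h x) = c x"
proof -
  have "\<exists>b. bij_betw b {x\<in>{1..n}. c x = i} {x\<in>{1..n}. c' x = i}" for i
    using assms by (intro finite_same_card_bij) (auto simp: shape_def)
  then obtain b where b: "\<And>i. bij_betw (b i) {x\<in>{1..n}. c x = i} {x\<in>{1..n}. c' x = i}"
    by metis
  define h where "h x = (if x \<in> {1..n} then b (c x) x else x)" for x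
  have h: "h x \<in> {1..n} \<and> c' (h x) = c x" if "x \<in> {1..n}" for x
    using that bij_betwE[OF b[of "c x"]] by (auto simp: h_def)
  have "inj_on h {1..n}"
  proof (rule inj_onI)
    fix x y assume xy: "x \<in> {1..n}" "y \<in> {1..n}" "h x = h y"
    then have "c x = c y"
      using h by metis
    then show "x = y"
      using xy bij_betw_imp_inj_on[OF b[of "c x"]] by (auto simp: h_def inj_on_def)
  qed
  then have "bij_betw h {1..n} {1..n}"
    unfolding bij_betw_def using h endo_inj_surj[of "{1..n}" h] by blast
  then have "h permutes {1..n}"
    by (rule bij_imp_permutes) (auto simp: h_def)
  then show ?thesis
    using that h by blast
qed

lemma shape_comp:
  assumes "shape n c p" "g permutes {1..n}"
  shows "shape n (c \<circ> g) p"
  unfolding shape_def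
proof
  fix i
  have "bij_betw g {x\<in>{1..n}. (c \<circ> g) x = i} {x\<in>{1..n}. c x = i}"
    by (intro bij_betwI[where g = "inv' g"])
      (auto simp: permutes_inverses[OF assms(2)] permutes_in_image[OF assms(2)]
        permutes_in_image[OF permutes_inv[OF assms(2)]] simp del: atLeastAtMost_iff One_nat_def)
  then show "card {x\<in>{1..n}. (c \<circ> g) x = i} = p i"
    using assms(1) by (simp add: bij_betw_same_card shape_def)
qed

section \<open>Partitions as lists\<close>

lemma part_antimono:
  assumes "is_partition n l" "1 \<le> i" "i \<le> k"
  shows "part l k \<le> part l i"
proof (cases "k \<le> length l \<and> i < k")
  case True
  then have "l ! (i - 1) \<ge> l ! (k - 1)"
    using assms sorted_wrt_nth_less[of "(\<ge>)" l "i - 1" "k - 1"] by (auto simp: is_partition_def)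
  then show ?thesis
    using True assms by (auto simp: part_def)
qed (use assms in \<open>auto simp: part_def\<close>)

lemma initial_segment:
  fixes S :: "nat set"
  assumes "finite S" "\<And>i k. k \<in> S \<Longrightarrow> 1 \<le> i \<Longrightarrow> i \<le> k \<Longrightarrow> i \<in> S" "0 \<notin> S"
  shows "S = {1..card S}"
proof (cases "S = {}")
  case False
  have "x \<in> S \<longleftrightarrow> x \<in> {1..Max S}" for x
  proof
    show "x \<in> {1..Max S}" if "x \<in> S"
      using Max_ge[OF assms(1) that] assms(3) that by (cases x) auto
    show "x \<in> S" if "x \<in> {1..Max S}"
      using assms(2)[OF Max_in[OF assms(1) False], of x] that by simp
  qed
  then have "S = {1..Max S}"
    by blast
  then show ?thesis
    by (metis card_atLeastAtMost diff_Suc_1 One_nat_def)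
qed simp

lemma part_conjugate:
  assumes "is_partition n l" "j \<ge> 1"
  shows "part (conjugate l) j = card {i\<in>{1..length l}. j \<le> part l i}"
proof (cases "j \<le> part l 1")
  case False
  then have "{i\<in>{1..length l}. j \<le> part l i} = {}"
    using part_antimono[OF assms(1), of 1] by (auto dest: order_trans)
  then show ?thesis
    using False by (simp add: part_def conjugate_def)
next
  case True
  then show ?thesis
    unfolding part_def[of "conjugate l"] using assms(2) nth_upt[of 1 "j - 1" "Suc (part l 1)"]
    by (simp add: conjugate_def del: upt_Suc)
qed

lemma conj_pair_part:
  assumes "is_partition n l"
  shows "conj_pair (part l) (part (conjugate l))"
  unfolding conj_pair_def
proof (intro conjI allI impI)
  fix i j :: nat assume ij: "i \<ge> 1" "j \<ge> 1"
  let ?S = "{i\<in>{1..length l}. j \<le> part l i}"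
  have "?S = {1..card ?S}"
    using part_antimono[OF assms] by (intro initial_segment) (auto intro: order_trans)
  moreover have "j \<le> part l i \<longleftrightarrow> i \<in> ?S"
    using ij by (auto simp: part_def)
  ultimately show "j \<le> part l i \<longleftrightarrow> i \<le> part (conjugate l) j"
    using ij part_conjugate[OF assms, of j] by (metis (no_types, lifting) atLeastAtMost_iff)
qed (simp_all add: part_def)

lemma sum_part: "(\<Sum>i=1..length l. part l i) = sum_list l"
proof -
  have "(\<Sum>i=1..length l. part l i) = (\<Sum>i\<in>{0..<length l}. part l (Suc i))"
    by (rule sum.reindex_bij_witness[of _ Suc "\<lambda>i. i - 1"]) auto
  also have "\<dots> = sum_list l"
    by (simp add: part_def sum_list_sum_nth)
  finally show ?thesis .
qed

lemma part_inject:
  assumes "is_partition n l" "is_partition m l'" "\<And>i. i \<ge> 1 \<Longrightarrow> part l i = part l' i"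
  shows "l = l'"
proof -
  have pos: "part l i > 0 \<longleftrightarrow> i \<in> {1..length l}" if "is_partition n l" for n i l
  proof (cases "i \<in> {1..length l}")
    case True
    then have "l ! (i - 1) \<in> set l"
      by (intro nth_mem) auto
    then have "l ! (i - 1) \<noteq> 0"
      using that unfolding is_partition_def by metis
    then show ?thesis
      using True by (simp add: part_def)
  qed (auto simp: part_def)
  have "{1..length l} = {1..length l'}"
    using pos[OF assms(1)] pos[OF assms(2)] assms(3) by (metis atLeastAtMost_iff subsetI subset_antisym)
  then have len: "length l = length l'"
    by (metis card_atLeastAtMost diff_Suc_1)
  then show ?thesis
  proof (rule nth_equalityI)
    fix i assume "i < length l"
    then show "l ! i = l' ! i"
      using assms(3)[of "Suc i"] len by (simp add: part_def)
  qed
qed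

lemma sum_list_conjugate:
  assumes "is_partition n l"
  shows "sum_list (conjugate l) = n"
proof -
  let ?q = "part (conjugate l)"
  have c: "conj_pair (part l) ?q"
    by (rule conj_pair_part[OF assms])
  have "?q 1 = card {i\<in>{1..length l}. 1 \<le> part l i}"
    using part_conjugate[OF assms, of 1] by simp
  also have "\<dots> \<le> card {1..length l}"
    by (intro card_mono) auto
  finally have 1: "?q 1 \<le> length l"
    by simp
  have "sum_list (conjugate l) = (\<Sum>j=1..length (conjugate l). ?q j)"
    by (rule sum_part[symmetric])
  also have "\<dots> = (\<Sum>j=1..part l 1. ?q j)"
    by (simp add: conjugate_def)
  also have "\<dots> = (\<Sum>i=1..length l. min (part l 1) (part l i))"
    by (rule conj_pair_sum[OF c 1])
  also have "\<dots> = (\<Sum>i=1..length l. part l i)"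
    using conj_pair_antimono[OF c, of 1] by (intro sum.cong) auto
  also have "\<dots> = n"
    using assms unfolding sum_part is_partition_def by simp
  finally show ?thesis .
qed

lemma partition_of_sizes:
  assumes "finite {i. i \<ge> 1 \<and> s i > 0}" "\<And>i k. 1 \<le> i \<Longrightarrow> i \<le> k \<Longrightarrow> s k \<le> (s i :: nat)"
    and "(\<Sum>i | i \<ge> 1 \<and> s i > 0. s i) = n"
  obtains l where "is_partition n l" "\<And>i. i \<ge> 1 \<Longrightarrow> part l i = s i"
proof -
  define k where "k = card {i. i \<ge> 1 \<and> s i > 0}"
  have S: "{i. i \<ge> 1 \<and> s i > 0} = {1..k}"
    unfolding k_def using assms(1,2) by (intro initial_segment) (auto intro: order_less_le_trans)
  define l where "l = map s [1..<Suc k]"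
  have part: "part l i = s i" if "i \<ge> 1" for i
  proof (cases "i \<le> k")
    case False
    then show ?thesis
      using that S by (auto simp: part_def l_def)
  qed (use that in \<open>auto simp: part_def l_def nth_map_upt simp del: upt_Suc\<close>)
  have "is_partition n l"
    unfolding is_partition_def
  proof (intro conjI)
    show "sorted_wrt (\<ge>) l"
      by (auto simp: sorted_wrt_iff_nth_less l_def simp del: upt_Suc intro!: assms(2))
    have "s i > 0" if "i \<in> {1..k}" for i
      using S that by blast
    then show "0 \<notin> set l"
      by (fastforce simp: l_def simp del: upt_Suc)
    have "sum_list l = (\<Sum>i=1..length l. part l i)"
      by (rule sum_part[symmetric])
    also have "\<dots> = (\<Sum>i\<in>{1..k}. s i)"
      by (intro sum.cong) (simp_all add: part, simp add: l_def del: upt_Suc)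
    finally show "sum_list l = n"
      using assms(3) S by simp
  qed
  then show ?thesis
    using that part by blast
qed

text \<open>The diagonal condition is inherited by smaller indices, so the maximum becomes a test at
  the single index \<open>k\<close>. From here on \<open>k \<le> p k\<close> stands in for the
  Durfee rank.\<close>

lemma durfee_rank_iff:
  assumes "is_partition n l" "k \<ge> 1"
  shows "k \<le> durfee_rank l \<longleftrightarrow> k \<le> part l k"
proof
  let ?R = "{r \<in> {0..length l}. part l r \<ge> r}"
  have "0 \<in> ?R" "finite ?R"
    by auto
  then have max: "durfee_rank l \<in> ?R" "\<And>r. r \<in> ?R \<Longrightarrow> r \<le> durfee_rank l"
    unfolding durfee_rank_def using Max_in[of ?R] Max_ge[of ?R] by blast+
  show "k \<le> part l k" if "k \<le> durfee_rank l"
    using part_antimono[OF assms that] max(1) that by simp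
  show "k \<le> durfee_rank l" if "k \<le> part l k"
    using that assms(2) max(2)[of k] by (auto simp: part_def split: if_splits)
qed

lemma threshold_partition_iff:
  assumes "is_partition n l"
  shows "threshold_partition l
    \<longleftrightarrow> (\<forall>k\<ge>1. k \<le> part l k \<longrightarrow> part (conjugate l) k = Suc (part l k))"
proof -
  have "threshold_partition l
    \<longleftrightarrow> (\<forall>k\<ge>1. k \<le> durfee_rank l \<longrightarrow> part (conjugate l) k = Suc (part l k))"
    by (simp add: threshold_partition_def frob_alpha_def frob_beta_def Ball_def)
      (metis of_nat_Suc of_nat_eq_iff add.commute)
  then show ?thesis
    using durfee_rank_iff[OF assms] by blast
qed

lemma finite_TP: "finite (TP n)"
proof (rule finite_subset)
  have "length l \<le> sum_list l" if "0 \<notin> set l" for l :: "nat list"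
    using that by (induction l) auto
  then show "TP n \<subseteq> {l. set l \<subseteq> {0..n} \<and> length l \<le> n}"
    using member_le_sum_list by (fastforce simp: TP_def is_partition_def)
qed (rule finite_lists_length_le, simp)

section \<open>Threshold partitions and degree sequences\<close>

definition threshold_pair :: "(nat \<Rightarrow> nat) \<Rightarrow> (nat \<Rightarrow> nat) \<Rightarrow> bool" where
  "threshold_pair p q \<longleftrightarrow> conj_pair p q \<and> (\<forall>k\<ge>1. k \<le> p k \<longrightarrow> q k = Suc (p k))"

lemma TP_iff: "l \<in> TP n \<longleftrightarrow> is_partition n l \<and> threshold_pair (part l) (part (conjugate l))"
  using threshold_partition_iff conj_pair_part by (auto simp: TP_def threshold_pair_def)

lemma below_durfee:
  assumes "conj_pair p q" "k \<ge> 1 \<Longrightarrow> k \<le> p k" "1 \<le> i" "i \<le> k"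
  shows "i \<le> p i"
  using conj_pair_antimono[OF assms(1,3,4)] assms(2-4) by simp

lemma threshold_pair_sum:
  assumes "threshold_pair p q" "k \<ge> 1 \<Longrightarrow> k \<le> p k"
  shows "(\<Sum>i=1..k. q i) = (\<Sum>i=1..k. p i) + k"
proof -
  have c: "conj_pair p q"
    using assms(1) by (simp add: threshold_pair_def)
  have "q i = Suc (p i)" if "i \<in> {1..k}" for i
    using assms(1) below_durfee[OF c assms(2), of i] that by (auto simp: threshold_pair_def)
  then have "(\<Sum>i=1..k. q i) = (\<Sum>i=1..k. p i + 1)"
    by (intro sum.cong) auto
  then show ?thesis
    by (simp only: sum.distrib) simp
qed

lemma sum_Suc_diff:
  fixes f :: "nat \<Rightarrow> nat"
  assumes "k \<ge> 1"
  shows "(\<Sum>i=1..k. f i) = (\<Sum>i=1..k-1. f i) + f k"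
  using assms by (cases k) auto

text \<open>By \<open>conj_pair_sum_square\<close> the right-hand sides are
  \<open>(\<Sum>i=1..k. q i)\<close> and \<open>(\<Sum>i=1..k. p i) + k\<close>, so the two bounds
  close up to an equality for every \<open>k\<close> up to the Durfee rank. Subtracting the equality
  at \<open>k - 1\<close> isolates the index \<open>k\<close>.\<close>

lemma erdos_gallai_threshold:
  assumes c: "conj_pair p q" and N: "p 1 \<le> N" "q 1 \<le> N"
    and simple: "\<And>k. k \<ge> 1 \<Longrightarrow> k \<le> p k \<Longrightarrow>
      (\<Sum>i=1..k. p i) + k \<le> k * k + (\<Sum>i=Suc k..N. min k (p i))"
    and loops: "\<And>k. k \<ge> 1 \<Longrightarrow> k \<le> p k \<Longrightarrow>
      (\<Sum>i=1..k. q i) \<le> k * k + k + (\<Sum>i=Suc k..N. min k (q i))"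
  shows "threshold_pair p q"
proof -
  have eq: "(\<Sum>i=1..k. q i) = (\<Sum>i=1..k. p i) + k" if k: "k \<ge> 1 \<Longrightarrow> k \<le> p k" for k
  proof (cases "k \<ge> 1")
    case True
    have kq: "k \<le> q k"
      using conj_pairD[OF c True True] k[OF True] by simp
    have kN: "k \<le> N"
      using conj_pair_antimono[OF c order_refl True] k[OF True] N by simp
    show ?thesis
      using conj_pair_sum_square[OF c N(2) kN k]
        conj_pair_sum_square[OF conj_pair_sym[OF c] N(1) kN] kq
        simple[OF True k[OF True]] loops[OF True k[OF True]] by simp
  qed (use k in auto)
  show ?thesis
    unfolding threshold_pair_def
  proof (intro conjI allI impI)
    fix k assume k: "1 \<le> k" "k \<le> p k"
    have "k - 1 \<le> p (k - 1)" if "k - 1 \<ge> 1"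
      using below_durfee[OF c k(2) that] by simp
    then show "q k = Suc (p k)"
      using eq[OF k(2)] eq[of "k - 1"] sum_Suc_diff[OF k(1), of p] sum_Suc_diff[OF k(1), of q] k(1)
      by simp
  qed (rule c)
qed

lemma diagram_inject:
  assumes "conj_pair p q" "conj_pair p' q'" "diagram p = diagram p'"
  shows "p = p'"
proof
  fix i
  have *: "r i = card {j. (i, j) \<in> diagram r}" if "conj_pair r s" for r s
  proof (cases "i = 0")
    case False
    then have "{j. (i, j) \<in> diagram r} = {1..r i}"
      by (auto simp: diagram_def)
    then show ?thesis
      by simp
  qed (use that in \<open>simp add: diagram_def conj_pair_def\<close>)
  show "p i = p' i"
    using *[OF assms(1)] *[OF assms(2)] assms(3) by simp
qed

text \<open>
  Two threshold partitions comparable in the dominance order agree in their first rows and columns up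
  to the smaller Durfee rank; the one of smaller rank is then contained in the other.
\<close>

lemma threshold_dominance_eq:
  assumes t: "threshold_pair p q" "threshold_pair p' q'"
    and card: "card (diagram p) = card (diagram p')"
    and dom: "\<And>k. (\<Sum>i=1..k. p i) \<le> (\<Sum>i=1..k. p' i)"
      "\<And>k. (\<Sum>i=1..k. q' i) \<le> (\<Sum>i=1..k. q i)"
  shows "p = p'"
proof -
  have c: "conj_pair p q" "conj_pair p' q'"
    using t by (auto simp: threshold_pair_def)
  define R where "R = {k. k \<ge> 1 \<and> k \<le> p k \<and> k \<le> p' k}"
  \<comment> \<open>The threshold condition turns the second dominance inequality into the reverse
    of the first: both column sums exceed the row sums by the same \<open>k\<close>.\<close>
  have eq_sum: "(\<Sum>i=1..k. p i) = (\<Sum>i=1..k. p' i)" if "k = 0 \<or> k \<in> R" for k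
    using that dom[of k] threshold_pair_sum[OF t(1), of k] threshold_pair_sum[OF t(2), of k]
    by (auto simp: R_def)
  have R_down: "i \<in> R" if "k \<in> R" "1 \<le> i" "i \<le> k" for i k
    using that below_durfee[OF c(1), of k i] below_durfee[OF c(2), of k i] by (simp add: R_def)
  have eq: "p k = p' k" "q k = q' k" if k: "k \<in> R" for k
  proof -
    have k1: "k \<ge> 1"
      using k by (simp add: R_def)
    have "k - 1 = 0 \<or> k - 1 \<in> R"
      using R_down[OF k, of "k - 1"] k1 by linarith
    then show "p k = p' k"
      using eq_sum[of k] eq_sum[of "k - 1"] k sum_Suc_diff[OF k1, of p] sum_Suc_diff[OF k1, of p']
      by simp
    then show "q k = q' k"
      using k t by (auto simp: R_def threshold_pair_def)
  qed
  have "R \<subseteq> {1..p 1}"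
    using order_trans[OF _ conj_pair_antimono[OF c(1), of 1]] by (auto simp: R_def)
  then have fin: "finite R"
    by (rule finite_subset) simp
  define r where "r = card R"
  have R: "R = {1..r}"
    unfolding r_def
  proof (rule initial_segment[OF fin])
    show "i \<in> R" if "k \<in> R" "1 \<le> i" "i \<le> k" for i k
      using that by (rule R_down)
  qed (simp add: R_def)
  have sub: "diagram u \<subseteq> diagram v"
    if cu: "conj_pair u s" and cv: "conj_pair v t" and lt: "u (Suc r) < Suc r"
      and eq: "\<And>k. k \<in> {1..r} \<Longrightarrow> u k = v k" "\<And>k. k \<in> {1..r} \<Longrightarrow> s k = t k" for u v s t
  proof
    fix z assume "z \<in> diagram u"
    then obtain i j where z: "z = (i, j)" and ij: "1 \<le> i" "1 \<le> j" "j \<le> u i"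
      by (auto simp: diagram_def)
    \<comment> \<open>Row \<open>Suc r\<close> of \<open>u\<close> is too short to contain a cell
      with both coordinates above \<open>r\<close>, so each cell lies in one of the rows or columns
      already known to agree.\<close>
    have "i \<le> r \<or> j \<le> r"
      using conj_pair_antimono[OF cu, of "Suc r" i] ij lt by linarith
    then have "j \<le> v i"
    proof
      assume "j \<le> r"
      then have "i \<le> t j"
        using conj_pairD[OF cu ij(1,2)] ij eq(2)[of j] by simp
      then show ?thesis
        using conj_pairD[OF cv ij(1,2)] by simp
    qed (use ij eq(1)[of i] in simp)
    then show "z \<in> diagram v"
      using ij z by (simp add: diagram_def)
  qed
  have "Suc r \<notin> R"
    by (simp add: R)
  then have "p (Suc r) < Suc r \<or> p' (Suc r) < Suc r"
    by (auto simp: R_def)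
  then have "diagram p \<subseteq> diagram p' \<or> diagram p' \<subseteq> diagram p"
    using sub[OF c] sub[OF c(2,1)] eq R by auto
  then have "diagram p = diagram p'"
    using card card_subset_eq[OF finite_diagram[OF c(2)], of "diagram p"]
      card_subset_eq[OF finite_diagram[OF c(1)], of "diagram p'"] by auto
  then show ?thesis
    using diagram_inject[OF c] by simp
qed

section \<open>Erdos-Gallai inequalities for the graph of a coloured matching\<close>

lemma involution_split:
  assumes w: "w permutes {1..n}" "\<And>x. w (w x) = x"
    and c: "shape n c p" "conj_pair p q" "q 1 \<le> N"
  shows "(\<Sum>i=1..k. p i) = card {x\<in>{1..n}. c x \<le> k \<and> c (w x) \<le> k}
    + (\<Sum>j=Suc k..N. card {y\<in>{1..n}. c y = j \<and> c (w y) \<le> k})"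
proof -
  let ?Y = "{y\<in>{1..n}. c y > k \<and> c (w y) \<le> k}"
  have win: "w x \<in> {1..n} \<longleftrightarrow> x \<in> {1..n}" for x
    by (rule permutes_in_image[OF w(1)])
  have "(\<Sum>i=1..k. p i) = card {x\<in>{1..n}. c x \<le> k}"
    using c(2) by (intro card_colour_le[OF c(1), symmetric]) (simp add: conj_pair_def)
  also have "{x\<in>{1..n}. c x \<le> k} = {x\<in>{1..n}. c x \<le> k \<and> c (w x) \<le> k}
      \<union> {x\<in>{1..n}. c x \<le> k \<and> c (w x) > k}"
    by auto
  also have "card \<dots> = card {x\<in>{1..n}. c x \<le> k \<and> c (w x) \<le> k}
      + card {x\<in>{1..n}. c x \<le> k \<and> c (w x) > k}"
    by (rule card_Un_disjoint) auto
  \<comment> \<open>\<open>w\<close> carries the half-edges leaving the first \<open>k\<close>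
    colours to the opposite half-edges, which can be sorted by their own colour
    \<open>j > k\<close>.\<close>
  also have "card {x\<in>{1..n}. c x \<le> k \<and> c (w x) > k} = card ?Y"
    by (rule bij_betw_same_card[of w], rule bij_betwI[where g = w])
      (use win in \<open>auto simp: w(2) simp del: atLeastAtMost_iff\<close>)
  also have "card ?Y = (\<Sum>j\<in>{Suc k..N}. card {y\<in>?Y. c y = j})"
    using order_trans[OF shape_colour_le(2)[OF c(1,2)] c(3)] by (intro card_fibres) auto
  also have "\<dots> = (\<Sum>j=Suc k..N. card {y\<in>{1..n}. c y = j \<and> c (w y) \<le> k})"
    by (intro sum.cong refl arg_cong[where f = card]) auto
  finally show ?thesis .
qed

lemma card_row_min:
  assumes "shape n c p" "p 0 = 0" and w: "w permutes {1..n}"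
    and inj: "\<And>x y. x \<in> {1..n} \<Longrightarrow> y \<in> {1..n} \<Longrightarrow> c x = j \<Longrightarrow> c y = j \<Longrightarrow> c (w x) = c (w y)
      \<Longrightarrow> c (w x) \<le> k \<Longrightarrow> x = y"
  shows "card {y\<in>{1..n}. c y = j \<and> c (w y) \<le> k} \<le> min k (p j)"
proof -
  have "card {y\<in>{1..n}. c y = j \<and> c (w y) \<le> k} \<le> card {y\<in>{1..n}. c y = j}"
    by (intro card_mono) auto
  moreover have "card {y\<in>{1..n}. c y = j \<and> c (w y) \<le> k} \<le> card {1..k}"
  proof (rule card_inj_on_le)
    show "inj_on (\<lambda>y. c (w y)) {y\<in>{1..n}. c y = j \<and> c (w y) \<le> k}"
      using inj by (intro inj_onI) simp
    show "(\<lambda>y. c (w y)) ` {y\<in>{1..n}. c y = j \<and> c (w y) \<le> k} \<subseteq> {1..k}"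
    proof (rule image_subsetI)
      fix y assume "y \<in> {y\<in>{1..n}. c y = j \<and> c (w y) \<le> k}"
      then show "c (w y) \<in> {1..k}"
        using shape_colour(1)[OF assms(1) _ assms(2), of "w y"] permutes_in_image[OF w, of y] by simp
    qed
  qed simp
  ultimately show ?thesis
    using assms(1) by (simp add: shape_def)
qed

text \<open>The matching \<open>w\<close> projects to a simple graph on the colours.\<close>

definition simple_matching :: "nat \<Rightarrow> (nat \<Rightarrow> nat) \<Rightarrow> (nat \<Rightarrow> nat) \<Rightarrow> bool" where
  "simple_matching n c w \<longleftrightarrow>
     inj_on (\<lambda>x. (c x, c (w x))) {1..n} \<and> (\<forall>x\<in>{1..n}. c (w x) \<noteq> c x)"

lemma card_off_diagonal: "card {(i, j). i \<in> {1..k} \<and> j \<in> {1..k} \<and> i \<noteq> j} + k = k * k"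
proof -
  have "{(i, j). i \<in> {1..k} \<and> j \<in> {1..k} \<and> i \<noteq> j} \<union> (\<lambda>i. (i, i)) ` {1..k} = {1..k} \<times> {1..k}"
    by auto
  moreover have "card ({(i, j). i \<in> {1..k} \<and> j \<in> {1..k} \<and> i \<noteq> j} \<union> (\<lambda>i. (i, i)) ` {1..k})
     = card {(i, j). i \<in> {1..k} \<and> j \<in> {1..k} \<and> i \<noteq> j} + card ((\<lambda>i. (i, i)) ` {1..k})"
    by (rule card_Un_disjoint) (auto intro: finite_subset[of _ "{1..k} \<times> {1..k}"])
  ultimately show ?thesis
    by (simp add: card_image inj_on_def)
qed

text \<open>The half-edges inside the first \<open>k\<close> colours inject into the off-diagonal
  cells of a \<open>k\<close> by \<open>k\<close> square.\<close>

lemma simple_matching_clique: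
  assumes "simple_matching n c w" "w permutes {1..n}" "shape n c p" "p 0 = 0"
  shows "card {x\<in>{1..n}. c x \<le> k \<and> c (w x) \<le> k} + k \<le> k * k"
proof -
  let ?X = "{x\<in>{1..n}. c x \<le> k \<and> c (w x) \<le> k}"
  have "card ?X \<le> card {(i, j). i \<in> {1..k} \<and> j \<in> {1..k} \<and> i \<noteq> j}"
  proof (rule card_inj_on_le)
    show "inj_on (\<lambda>x. (c x, c (w x))) ?X"
      using assms(1) by (auto simp: simple_matching_def elim: inj_on_subset)
    show "(\<lambda>x. (c x, c (w x))) ` ?X \<subseteq> {(i, j). i \<in> {1..k} \<and> j \<in> {1..k} \<and> i \<noteq> j}"
    proof (rule image_subsetI)
      fix x assume x: "x \<in> ?X"
      then have "x \<in> {1..n}" "w x \<in> {1..n}"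
        using permutes_in_image[OF assms(2)] by auto
      then show "(c x, c (w x)) \<in> {(i, j). i \<in> {1..k} \<and> j \<in> {1..k} \<and> i \<noteq> j}"
        using x assms(1) shape_colour(1)[OF assms(3) _ assms(4), of x]
          shape_colour(1)[OF assms(3) _ assms(4), of "w x"]
        by (auto simp: simple_matching_def dest!: bspec[of _ _ x])
    qed
    show "finite {(i, j). i \<in> {1..k} \<and> j \<in> {1..k} \<and> i \<noteq> j}"
      by (rule finite_subset[of _ "{1..k} \<times> {1..k}"]) auto
  qed
  then show ?thesis
    using card_off_diagonal[of k] by linarith
qed

lemma simple_matching_row:
  assumes "simple_matching n c w" "w permutes {1..n}" "shape n c p" "p 0 = 0"
  shows "card {y\<in>{1..n}. c y = j \<and> c (w y) \<le> k} \<le> min k (p j)"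
proof (rule card_row_min[OF assms(3,4,2)])
  fix x y assume "x \<in> {1..n}" "y \<in> {1..n}" "c x = j" "c y = j" "c (w x) = c (w y)"
  then show "x = y"
    using assms(1) inj_onD[of "\<lambda>x. (c x, c (w x))" "{1..n}" x y] by (simp add: simple_matching_def)
qed

lemma simple_matching_erdos_gallai:
  assumes w: "w permutes {1..n}" "\<And>x. w (w x) = x"
    and c: "shape n c p" "conj_pair p q" "q 1 \<le> N" and s: "simple_matching n c w"
  shows "(\<Sum>i=1..k. p i) + k \<le> k * k + (\<Sum>j=Suc k..N. min k (p j))"
proof -
  have 0: "p 0 = 0"
    using c(2) by (simp add: conj_pair_def)
  have "(\<Sum>j=Suc k..N. card {y\<in>{1..n}. c y = j \<and> c (w y) \<le> k}) \<le> (\<Sum>j=Suc k..N. min k (p j))"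
    by (rule sum_mono) (rule simple_matching_row[OF s w(1) c(1) 0])
  then show ?thesis
    using involution_split[OF w c, of k] simple_matching_clique[OF s w(1) c(1) 0, of k] by linarith
qed

definition loop_matching :: "nat \<Rightarrow> (nat \<Rightarrow> nat) \<Rightarrow> (nat \<Rightarrow> nat) \<Rightarrow> bool" where
  "loop_matching n c w \<longleftrightarrow> (\<forall>x\<in>{1..n}. \<forall>y\<in>{1..n}. c x = c y \<and> c (w x) = c (w y) \<longrightarrow> y = x \<or> y = w x)"

text \<open>A colour pair is taken by at most one half-edge off the diagonal and by at most two on
  it, the two halves of a loop.\<close>

lemma loop_matching_clique:
  assumes "loop_matching n c w" "w permutes {1..n}" "shape n c p" "p 0 = 0"
  shows "card {x\<in>{1..n}. c x \<le> k \<and> c (w x) \<le> k} \<le> k * k + k"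
proof -
  let ?X = "{x\<in>{1..n}. c x \<le> k \<and> c (w x) \<le> k}"
  have card_le: "card {x\<in>?X. (c x, c (w x)) = ij} \<le> 1 + of_bool (fst ij = snd ij)" for ij
  proof (cases "{x\<in>?X. (c x, c (w x)) = ij} = {}")
    case False
    then obtain x where x: "x \<in> ?X" "(c x, c (w x)) = ij"
      by blast
    have sub: "y = x \<or> y = w x" if "y \<in> {x\<in>?X. (c x, c (w x)) = ij}" for y
      using assms(1)[unfolded loop_matching_def, rule_format, of x y] x that by auto
    show ?thesis
    proof (cases "fst ij = snd ij")
      case True
      have "card {x\<in>?X. (c x, c (w x)) = ij} \<le> card {x, w x}"
        using sub by (intro card_mono) auto
      also have "\<dots> \<le> 2"
        by (simp add: card_insert_if)
      finally show ?thesis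
        using True by simp
    next
      case False
      have "y = x" if "y \<in> {x\<in>?X. (c x, c (w x)) = ij}" for y
        using sub[OF that] that x(2) False by auto
      then have "card {x\<in>?X. (c x, c (w x)) = ij} \<le> card {x}"
        by (intro card_mono) auto
      then show ?thesis
        by simp
    qed
  next
    case True
    show ?thesis
      unfolding True by simp
  qed
  have "card ?X = (\<Sum>ij\<in>{1..k} \<times> {1..k}. card {x\<in>?X. (c x, c (w x)) = ij})"
  proof (rule card_fibres)
    show "(\<lambda>x. (c x, c (w x))) ` ?X \<subseteq> {1..k} \<times> {1..k}"
    proof (rule image_subsetI)
      fix x assume x: "x \<in> ?X"
      then have "x \<in> {1..n}" "w x \<in> {1..n}"
        using permutes_in_image[OF assms(2)] by auto
      then show "(c x, c (w x)) \<in> {1..k} \<times> {1..k}"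
        using x shape_colour(1)[OF assms(3) _ assms(4)] by (auto simp del: One_nat_def)
    qed
  qed auto
  also have "\<dots> \<le> (\<Sum>ij\<in>{1..k} \<times> {1..k}. 1 + of_bool (fst ij = snd ij))"
    by (intro sum_mono card_le)
  also have "\<dots> = k * k + card {ij\<in>{1..k} \<times> {1..k}. fst ij = snd ij}"
    by (simp only: sum.distrib card_filter finite_cartesian_product finite_atLeastAtMost) simp
  also have "{ij\<in>{1..k} \<times> {1..k}. fst ij = snd ij} = (\<lambda>i. (i, i)) ` {1..k}"
    by auto
  also have "card \<dots> = k"
    by (simp add: card_image inj_on_def)
  finally show ?thesis .
qed

lemma loop_matching_erdos_gallai:
  assumes w: "w permutes {1..n}" "\<And>x. w (w x) = x"
    and c: "shape n c p" "conj_pair p q" "q 1 \<le> N" and s: "loop_matching n c w"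
  shows "(\<Sum>i=1..k. p i) \<le> k * k + k + (\<Sum>j=Suc k..N. min k (p j))"
proof -
  have 0: "p 0 = 0"
    using c(2) by (simp add: conj_pair_def)
  have row: "card {y\<in>{1..n}. c y = j \<and> c (w y) \<le> k} \<le> min k (p j)" if "j \<in> {Suc k..N}" for j
  proof (rule card_row_min[OF c(1) 0 w(1)])
    fix x y assume xy: "x \<in> {1..n}" "y \<in> {1..n}" "c x = j" "c y = j" "c (w x) = c (w y)" "c (w x) \<le> k"
    then have "y = x \<or> y = w x"
      using s unfolding loop_matching_def by metis
    \<comment> \<open>The alternative \<open>y = w x\<close> would give
      \<open>j = c y = c (w x) \<le> k\<close>, contrary to \<open>Suc k \<le> j\<close>.\<close>
    then show "x = y"
      using xy that by auto
  qed
  have "(\<Sum>j=Suc k..N. card {y\<in>{1..n}. c y = j \<and> c (w y) \<le> k}) \<le> (\<Sum>j=Suc k..N. min k (p j))"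
    by (intro sum_mono row)
  then show ?thesis
    using involution_split[OF w c, of k] loop_matching_clique[OF s w(1) c(1) 0, of k] by linarith
qed

lemma matchings_imp_threshold:
  assumes "w permutes {1..n}" "\<And>x. w (w x) = x" "simple_matching n c w" "shape n c p"
    and "w' permutes {1..n}" "\<And>x. w' (w' x) = x" "loop_matching n d w'" "shape n d q"
    and cq: "conj_pair p q"
  shows "threshold_pair p q"
  \<comment> \<open>\<open>p 1 + q 1\<close> bounds the number of rows of both diagrams, so the two
    inequalities are available with the same range of summation.\<close>
  by (rule erdos_gallai_threshold[OF cq, of "p 1 + q 1"])
    (use simple_matching_erdos_gallai[OF assms(1,2,4) cq _ assms(3)]
      loop_matching_erdos_gallai[OF assms(5,6,8) conj_pair_sym[OF cq] _ assms(7)] in auto)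

text \<open>The half-edges of the unique simple graph with a threshold partition as degree sequence.\<close>

definition half_edges :: "(nat \<Rightarrow> nat) \<Rightarrow> (nat \<times> nat) set" where
  "half_edges p = {(i, j). i \<ge> 1 \<and> j \<ge> 1 \<and> i \<noteq> j \<and> min i j \<le> p (max i j)}"

text \<open>For \<open>i\<close> within the Durfee rank the neighbours are the \<open>i - 1\<close>
  smaller colours and the colours from \<open>Suc i\<close> to \<open>q i\<close>; omitting
  \<open>i\<close> itself is compensated by \<open>q i = Suc (p i)\<close>. For larger
  \<open>i\<close> no neighbour is larger, and the smaller ones are \<open>1..p i\<close>.\<close>

lemma card_half_edges_row:
  assumes t: "threshold_pair p q" and i: "i \<ge> 1"
  shows "card {j. (i, j) \<in> half_edges p} = p i"
proof -
  have c: "conj_pair p q"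
    using t by (simp add: threshold_pair_def)
  show ?thesis
  proof (cases "i \<le> p i")
    case True
    then have qi: "q i = Suc (p i)"
      using t i by (simp add: threshold_pair_def)
    have "{j. (i, j) \<in> half_edges p} = {1..<i} \<union> {Suc i..q i}"
    proof (rule Set.set_eqI, rule iffI)
      fix j assume "j \<in> {j. (i, j) \<in> half_edges p}"
      then have j: "j \<ge> 1" "i \<noteq> j" "min i j \<le> p (max i j)"
        by (auto simp: half_edges_def)
      then show "j \<in> {1..<i} \<union> {Suc i..q i}"
        using conj_pairD[OF c j(1) i] by (cases "j < i") (auto simp: max_def min_def)
    next
      fix j assume "j \<in> {1..<i} \<union> {Suc i..q i}"
      then show "j \<in> {j. (i, j) \<in> half_edges p}"
      proof
        assume j: "j \<in> {Suc i..q i}"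
        then have "i \<le> p j"
          using conj_pairD[OF c _ i, of j] by simp
        then show ?thesis
          using j i by (simp add: half_edges_def max_def min_def)
      qed (use True in \<open>auto simp: half_edges_def max_def min_def\<close>)
    qed
    then have "card {j. (i, j) \<in> half_edges p} = card {1..<i} + card {Suc i..q i}"
      by (simp only:) (rule card_Un_disjoint, auto)
    then show ?thesis
      using qi True i by simp
  next
    case False
    have "{j. (i, j) \<in> half_edges p} = {1..p i}"
    proof (rule Set.set_eqI, rule iffI)
      fix j assume "j \<in> {j. (i, j) \<in> half_edges p}"
      then have j: "j \<ge> 1" "i \<noteq> j" "min i j \<le> p (max i j)"
        by (auto simp: half_edges_def)
      have "j < i"
        using conj_pair_antimono[OF c i, of j] j False by (auto simp: max_def min_def split: if_splits)
      then show "j \<in> {1..p i}"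
        using j by (simp add: max_def min_def)
    qed (use False i in \<open>auto simp: half_edges_def max_def min_def\<close>)
    then show ?thesis
      by simp
  qed
qed

lemma half_edges_bound:
  assumes "conj_pair p q" "(i, j) \<in> half_edges p"
  shows "i \<in> {1..max (p 1) (q 1)}"
proof -
  have ij: "1 \<le> i" "1 \<le> j" "min i j \<le> p (max i j)"
    using assms(2) by (auto simp: half_edges_def)
  then have "p (max i j) > 0"
    by auto
  then have "max i j \<le> q 1"
    using conj_pair_0[OF assms(1), of "max i j"] by (cases "q 1 < max i j") auto
  then show ?thesis
    using ij by auto
qed

lemma half_edges_sym: "(i, j) \<in> half_edges p \<longleftrightarrow> (j, i) \<in> half_edges p"
  by (auto simp: half_edges_def max.commute min.commute)

lemma card_half_edges:
  assumes t: "threshold_pair p q" and s: "shape n c p"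
  shows "finite (half_edges p)" "card (half_edges p) = n"
proof -
  have c: "conj_pair p q"
    using t by (simp add: threshold_pair_def)
  let ?M = "max (p 1) (q 1)"
  have bound: "i \<in> {1..?M}" "j \<in> {1..?M}" if "(i, j) \<in> half_edges p" for i j
    using that half_edges_bound[OF c] half_edges_sym by blast+
  show fin: "finite (half_edges p)"
    by (rule finite_subset[of _ "{1..?M} \<times> {1..?M}"]) (use bound in fast)+
  have "card (half_edges p) = (\<Sum>i\<in>{1..?M}. card {ij\<in>half_edges p. fst ij = i})"
    using bound by (intro card_fibres[OF fin]) (auto simp del: atLeastAtMost_iff)
  also have "\<dots> = (\<Sum>i\<in>{1..?M}. p i)"
  proof (intro sum.cong refl)
    fix i assume i: "i \<in> {1..?M}"
    have "{ij\<in>half_edges p. fst ij = i} = Pair i ` {j. (i, j) \<in> half_edges p}"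
      by auto
    then show "card {ij\<in>half_edges p. fst ij = i} = p i"
      using card_half_edges_row[OF t, of i] i by (simp add: card_image inj_on_def)
  qed
  also have "\<dots> = n"
    by (rule shape_sum[OF s c]) simp
  finally show "card (half_edges p) = n" .
qed

text \<open>For a threshold partition the Erdos-Gallai inequality is attained at every
  \<open>k\<close> up to the Durfee rank, so each colour above \<open>k\<close> sends the maximal
  number of half-edges to the first \<open>k\<close> colours. This forces all colour pairs into
  \<open>half_edges p\<close>, and equal cardinality does the rest.\<close>

lemma simple_matching_half_edges:
  assumes w: "w permutes {1..n}" "\<And>x. w (w x) = x" and s: "simple_matching n c w"
    and t: "threshold_pair p q" and c: "shape n c p"
  shows "bij_betw (\<lambda>x. (c x, c (w x))) {1..n} (half_edges p)"
proof -
  have cq: "conj_pair p q"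
    using t by (simp add: threshold_pair_def)
  have 0: "p 0 = 0"
    using cq by (simp add: conj_pair_def)
  define N where "N = p 1 + q 1"
  have N: "q 1 \<le> N"
    by (simp add: N_def)
  have win: "w x \<in> {1..n}" if "x \<in> {1..n}" for x
    using that permutes_in_image[OF w(1)] by simp
  have row_eq: "card {y\<in>{1..n}. c y = j \<and> c (w y) \<le> k} = min k (p j)"
    if k: "k \<ge> 1" "k \<le> p k" and j: "j \<in> {Suc k..N}" for j k
  proof (rule sum_eq_imp_eq[OF finite_atLeastAtMost _ _ j])
    have kN: "k \<le> N"
      using conj_pair_antimono[OF cq order_refl k(1)] k(2) by (simp add: N_def)
    show "(\<Sum>j\<in>{Suc k..N}. min k (p j)) \<le> (\<Sum>j\<in>{Suc k..N}. card {y\<in>{1..n}. c y = j \<and> c (w y) \<le> k})"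
      using involution_split[OF w c cq N, of k] simple_matching_clique[OF s w(1) c 0, of k]
        conj_pair_sum_square[OF cq N kN] k threshold_pair_sum[OF t, of k] by linarith
  qed (rule simple_matching_row[OF s w(1) c 0])
  have key: "i \<le> p j" if x: "x \<in> {1..n}" "c x = i" "c (w x) = j" "i < j" for x i j
  proof (cases "j \<le> p j")
    case False
    \<comment> \<open>The degree \<open>k\<close> of colour \<open>j\<close> lies within the Durfee
      rank. The attained bound says that all \<open>k\<close> half-edges at \<open>j\<close> end in
      the first \<open>k\<close> colours, so \<open>i \<le> k\<close>.\<close>
    define k where "k = p j"
    have k1: "k \<ge> 1"
      using shape_colour(2)[OF c win[OF x(1)] 0] x(3) by (simp add: k_def)
    have kj: "k < j"
      using False by (simp add: k_def)
    have "k \<le> p k"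
      using conj_pair_antimono[OF cq k1, of j] kj by (simp add: k_def)
    moreover have "j \<le> N"
      using shape_colour_le(2)[OF c cq win[OF x(1)]] x(3) N by simp
    ultimately have "card {y\<in>{1..n}. c y = j \<and> c (w y) \<le> k} = card {y\<in>{1..n}. c y = j}"
      using row_eq[OF k1, of j] kj c by (simp add: k_def shape_def)
    then have eq: "{y\<in>{1..n}. c y = j \<and> c (w y) \<le> k} = {y\<in>{1..n}. c y = j}"
      by (intro card_subset_eq) auto
    have "w x \<in> {y\<in>{1..n}. c y = j \<and> c (w y) \<le> k}"
      unfolding eq using win[OF x(1)] x(3) by simp
    then show ?thesis
      using x(2) by (simp add: w(2) k_def)
  qed (use x in simp)
  have "(c x, c (w x)) \<in> half_edges p" if x: "x \<in> {1..n}" for x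
  proof -
    have "c x \<ge> 1" "c (w x) \<ge> 1" "c (w x) \<noteq> c x"
      using shape_colour(1)[OF c x 0] shape_colour(1)[OF c win[OF x] 0] s x
      by (auto simp: simple_matching_def)
    then show ?thesis
      using key[OF x refl refl] key[OF win[OF x] refl refl]
      by (auto simp: half_edges_def w(2) max_def min_def)
  qed
  then have "(\<lambda>x. (c x, c (w x))) ` {1..n} \<subseteq> half_edges p"
    by blast
  moreover have inj: "inj_on (\<lambda>x. (c x, c (w x))) {1..n}"
    using s by (simp add: simple_matching_def)
  moreover have "card ((\<lambda>x. (c x, c (w x))) ` {1..n}) = card (half_edges p)"
    unfolding card_image[OF inj] card_half_edges(2)[OF t c] by simp
  ultimately show ?thesis
    unfolding bij_betw_def using card_subset_eq[OF card_half_edges(1)[OF t c]] by blast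
qed

text \<open>The points are identified with the half-edges: the colour is the first component, and
  the matching reverses a half-edge.\<close>

lemma simple_matching_exists:
  assumes t: "threshold_pair p q" and s: "shape n c' p"
  obtains c w where "shape n c p" "w permutes {1..n}" "\<And>x. w (w x) = x" "simple_matching n c w"
proof -
  have "card {1..n} = card (half_edges p)"
    using card_half_edges[OF t s] by simp
  then obtain h where h: "bij_betw h {1..n} (half_edges p)"
    using finite_same_card_bij[OF finite_atLeastAtMost card_half_edges(1)[OF t s]] by blast
  define g where "g = inv_into {1..n} h"
  have g: "bij_betw g (half_edges p) {1..n}"
    unfolding g_def by (rule bij_betw_inv_into[OF h])
  have gh: "g (h x) = x" if "x \<in> {1..n}" for x
    unfolding g_def using bij_betw_inv_into_left[OF h that] .
  have hg: "h (g e) = e" if "e \<in> half_edges p" for e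
    unfolding g_def using bij_betw_inv_into_right[OF h that] .
  have h_in: "h x \<in> half_edges p" if "x \<in> {1..n}" for x
    using h that bij_betwE by blast
  have swap_in: "prod.swap e \<in> half_edges p" if "e \<in> half_edges p" for e
    using that half_edges_sym[of "fst e" "snd e"] by (cases e) simp
  define w where "w x = (if x \<in> {1..n} then g (prod.swap (h x)) else x)" for x
  have w_in: "w x \<in> {1..n}" if "x \<in> {1..n}" for x
    using bij_betwE[OF g] swap_in[OF h_in[OF that]] that by (auto simp: w_def)
  have hw: "h (w x) = prod.swap (h x)" if "x \<in> {1..n}" for x
    using hg[OF swap_in[OF h_in[OF that]]] that by (simp add: w_def)
  have ww: "w (w x) = x" for x
  proof (cases "x \<in> {1..n}")
    case True
    then have "w (w x) = g (prod.swap (h (w x)))"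
      using w_in[OF True] by (simp only: w_def[of "w x"] if_True)
    then show ?thesis
      using hw[OF True] gh[OF True] by simp
  next
    case False
    then show ?thesis
      by (simp add: w_def del: atLeastAtMost_iff)
  qed
  have "bij_betw w {1..n} {1..n}"
    by (rule bij_betwI[where g = w]) (use w_in ww in auto)
  then have w: "w permutes {1..n}"
    by (rule bij_imp_permutes) (auto simp: w_def)
  define c where "c x = fst (h x)" for x
  have cw: "(c x, c (w x)) = h x" if "x \<in> {1..n}" for x
    using hw[OF that] by (simp add: c_def prod_eq_iff)
  have "shape n c p"
    unfolding shape_def
  proof
    fix i
    have "bij_betw h {x\<in>{1..n}. c x = i} {e\<in>half_edges p. fst e = i}"
      by (rule bij_betwI[where g = g])
        (use bij_betwE[OF g] gh hg h_in in \<open>auto simp: c_def simp del: atLeastAtMost_iff\<close>)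
    then have "card {x\<in>{1..n}. c x = i} = card {e\<in>half_edges p. fst e = i}"
      by (rule bij_betw_same_card)
    also have "{e\<in>half_edges p. fst e = i} = Pair i ` {j. (i, j) \<in> half_edges p}"
      by auto
    also have "card \<dots> = p i"
    proof (cases "i = 0")
      case True
      then show ?thesis
        using t by (simp add: threshold_pair_def conj_pair_def half_edges_def)
    next
      case False
      then show ?thesis
        using card_half_edges_row[OF t, of i] by (simp add: card_image inj_on_def)
    qed
    finally show "card {x\<in>{1..n}. c x = i} = p i" .
  qed
  moreover have "simple_matching n c w"
    unfolding simple_matching_def
  proof
    show "inj_on (\<lambda>x. (c x, c (w x))) {1..n}"
      using bij_betw_imp_inj_on[OF h] by (subst inj_on_cong[of _ _ h]) (simp_all add: cw)
    show "\<forall>x\<in>{1..n}. c (w x) \<noteq> c x"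
    proof
      fix x assume x: "x \<in> {1..n}"
      then show "c (w x) \<noteq> c x"
        using h_in[OF x] unfolding cw[OF x, symmetric] by (simp add: half_edges_def)
    qed
  qed
  ultimately show ?thesis
    using that w ww by blast
qed

section \<open>Highest weight vectors\<close>

context perm_action
begin

definition sym_vec :: "(nat \<Rightarrow> nat) \<Rightarrow> ('x \<Rightarrow> complex) \<Rightarrow> bool" where
  "sym_vec c v \<longleftrightarrow> (\<forall>x\<in>{1..n}. \<forall>y\<in>{1..n}. c x = c y \<longrightarrow> swp x y v = v)"

definition alt_vec :: "(nat \<Rightarrow> nat) \<Rightarrow> ('x \<Rightarrow> complex) \<Rightarrow> bool" where
  "alt_vec c v \<longleftrightarrow> (\<forall>x\<in>{1..n}. \<forall>y\<in>{1..n}. x \<noteq> y \<longrightarrow> c x = c y \<longrightarrow> swp x y v = - v)"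

lemma sym_vecD: "sym_vec c v \<Longrightarrow> x \<in> {1..n} \<Longrightarrow> y \<in> {1..n} \<Longrightarrow> c x = c y \<Longrightarrow> swp x y v = v"
  by (simp add: sym_vec_def)

lemma alt_vecD:
  "alt_vec c v \<Longrightarrow> x \<in> {1..n} \<Longrightarrow> y \<in> {1..n} \<Longrightarrow> x \<noteq> y \<Longrightarrow> c x = c y \<Longrightarrow> swp x y v = - v"
  by (simp add: alt_vec_def)

definition invariant :: "('x \<Rightarrow> complex) set \<Rightarrow> bool" where
  "invariant W \<longleftrightarrow> cfun.subspace W \<and> (\<forall>g u. g permutes {1..n} \<longrightarrow> u \<in> W \<longrightarrow> act g u \<in> W)"

lemma invariantD:
  assumes "invariant W"
  shows "cfun.subspace W" "g permutes {1..n} \<Longrightarrow> u \<in> W \<Longrightarrow> act g u \<in> W"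
  using assms by (auto simp: invariant_def)

lemma invariant_swp: "invariant W \<Longrightarrow> x \<in> {1..n} \<Longrightarrow> y \<in> {1..n} \<Longrightarrow> u \<in> W \<Longrightarrow> swp x y u \<in> W"
  by (rule invariantD(2)[OF _ swap_permutes])

text \<open>
  A filling assigns to \<open>x\<close> the cell in row \<open>c x\<close> and column \<open>d x\<close> of a Young diagram. The vectors
  satisfying \<open>column_state c d j\<close> have been antisymmetrised over the columns before \<open>j\<close>; with
  respect to the remaining columns they are still killed by the raising operators.
\<close>

definition filling :: "(nat \<Rightarrow> nat) \<Rightarrow> (nat \<Rightarrow> nat) \<Rightarrow> bool" where
  "filling c d \<longleftrightarrow> inj_on (\<lambda>x. (c x, d x)) {1..n} \<and>
     (\<forall>x\<in>{1..n}. d x \<ge> 1 \<and> (\<forall>i j. 1 \<le> i \<longrightarrow> i \<le> c x \<longrightarrow> 1 \<le> j \<longrightarrow> j \<le> d x \<longrightarrow> (\<exists>y\<in>{1..n}. c y = i \<and> d y = j)))"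

definition column_state :: "(nat \<Rightarrow> nat) \<Rightarrow> (nat \<Rightarrow> nat) \<Rightarrow> nat \<Rightarrow> ('x \<Rightarrow> complex) \<Rightarrow> bool" where
  "column_state c d j u \<longleftrightarrow> u \<noteq> 0 \<and>
     (\<forall>i. sym_on {x\<in>{1..n}. c x = i \<and> d x \<ge> j} u) \<and>
     (\<forall>y\<in>{1..n}. d y \<ge> j \<longrightarrow> (\<forall>i. 1 \<le> i \<longrightarrow> i < c y \<longrightarrow>
        (\<Sum>x | x \<in> {1..n} \<and> c x = i \<and> d x \<ge> j. swp x y u) = - u)) \<and>
     (\<forall>x\<in>{1..n}. \<forall>y\<in>{1..n}. x \<noteq> y \<longrightarrow> d x = d y \<longrightarrow> d x < j \<longrightarrow> swp x y u = - u)"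

lemma column_state_raise:
  "column_state c d j u \<Longrightarrow> y \<in> {1..n} \<Longrightarrow> j \<le> d y \<Longrightarrow> 1 \<le> i \<Longrightarrow> i < c y
    \<Longrightarrow> (\<Sum>x | x \<in> {1..n} \<and> c x = i \<and> d x \<ge> j. swp x y u) = - u"
  by (simp add: column_state_def)

lemma filling_injD:
  "filling c d \<Longrightarrow> x \<in> {1..n} \<Longrightarrow> y \<in> {1..n} \<Longrightarrow> c x = c y \<Longrightarrow> d x = d y \<Longrightarrow> x = y"
  by (auto simp: filling_def dest: inj_onD)

lemma filling_cell:
  assumes "filling c d" "x \<in> {1..n}" "1 \<le> i" "i \<le> c x" "1 \<le> j" "j \<le> d x"
  obtains y where "y \<in> {1..n}" "c y = i" "d y = j"
  using assms unfolding filling_def by metis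

text \<open>The cells of column \<open>j\<close> enter from the largest row number down to 1. When
  the cell \<open>y\<close> enters, \<open>antisym_insert_nonzero\<close> applies to the rest of its
  row from column \<open>j\<close> on: the cells already present lie in rows with larger number, so
  raising them to the row of \<open>y\<close> gives \<open>- u\<close>.\<close>

lemma column_antisym_nonzero:
  assumes f: "filling c d" and c1: "\<And>x. x \<in> {1..n} \<Longrightarrow> c x \<ge> 1" and u: "column_state c d j u"
  shows "antisym {x\<in>{1..n}. d x = j} u \<noteq> 0"
proof -
  \<comment> \<open>\<open>K\<close> exceeds every row number, so \<open>D 0\<close> is empty,
    \<open>D K\<close> is the whole column, and each step adds at most one cell.\<close>
  define K where "K = Suc (Max (insert 0 (c ` {1..n})))"
  define D where "D m = {x\<in>{1..n}. d x = j \<and> K \<le> c x + m}" for m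
  have K: "c x < K" if "x \<in> {1..n}" for x
    using that unfolding K_def less_Suc_eq_le by (intro Max_ge) auto
  have "antisym (D m) u \<noteq> 0" for m
  proof (induction m)
    case 0
    have "D 0 = {}"
      using K by (fastforce simp: D_def simp del: atLeastAtMost_iff One_nat_def)
    then show ?case
      using u unfolding column_state_def by (metis antisym_empty)
  next
    case (Suc m)
    show ?case
    proof (cases "\<exists>y\<in>{1..n}. d y = j \<and> c y + Suc m = K")
      case True
      then obtain y where y: "y \<in> {1..n}" "d y = j" "c y + Suc m = K"
        by blast
      have "D (Suc m) = insert y (D m)"
      proof (rule equalityI; rule subsetI)
        fix x assume x: "x \<in> D (Suc m)"
        show "x \<in> insert y (D m)"
        proof (cases "c x = c y")
          case True
          then show ?thesis
            using filling_injD[OF f, of x y] x y by (simp add: D_def)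
        qed (use x y in \<open>simp add: D_def\<close>)
      qed (use y in \<open>auto simp: D_def\<close>)
      moreover have "antisym (insert y (D m)) u \<noteq> 0"
      proof (rule antisym_insert_nonzero[where A = "{x\<in>{1..n}. c x = c y \<and> d x \<ge> j}"])
        show "sym_on {x\<in>{1..n}. c x = c y \<and> d x \<ge> j} u"
          using u by (simp add: column_state_def)
        show "antisym (D m) u \<noteq> 0"
          by (rule Suc.IH)
        fix z assume z: "z \<in> D m"
        have "z \<in> {1..n}" "d z \<ge> j" "1 \<le> c y" "c y < c z"
          using z y c1[OF y(1)] by (auto simp: D_def)
        then show "(\<Sum>x\<in>{x\<in>{1..n}. c x = c y \<and> d x \<ge> j}. swp x z u) = - u"
          by (rule column_state_raise[OF u])
      qed (use y in \<open>auto simp: D_def\<close>)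
      ultimately show ?thesis
        by (simp only: not_False_eq_True)
    next
      case False
      have "D (Suc m) = D m"
      proof (rule equalityI; rule subsetI)
        fix x assume x: "x \<in> D (Suc m)"
        then have "c x + Suc m \<noteq> K"
          using False by (auto simp: D_def)
        then show "x \<in> D m"
          using x by (simp add: D_def)
      qed (auto simp: D_def)
      then show ?thesis
        using Suc.IH by (simp only: not_False_eq_True)
    qed
  qed
  moreover have "D K = {x\<in>{1..n}. d x = j}"
    by (auto simp: D_def)
  ultimately show ?thesis
    by metis
qed

text \<open>Transpositions off column \<open>j\<close> commute with the antisymmetriser. The only
  new point is the raising relation, whose sum loses the row's cell \<open>yi\<close> in column
  \<open>j\<close>; that term is symmetric in two cells of the column, hence antisymmetrises to
  zero.\<close>

lemma column_step:
  assumes f: "filling c d" and c1: "\<And>x. x \<in> {1..n} \<Longrightarrow> c x \<ge> 1" and j: "j \<ge> 1"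
    and u: "column_state c d j u"
  shows "column_state c d (Suc j) (antisym {x\<in>{1..n}. d x = j} u)"
proof -
  define C where "C = {x\<in>{1..n}. d x = j}"
  have C: "C \<subseteq> {1..n}"
    by (auto simp: C_def)
  have sym: "swp x y u = u"
    if "x \<in> {1..n}" "y \<in> {1..n}" "c x = c y" "d x \<ge> j" "d y \<ge> j" for x y
    using u that by (auto simp: column_state_def sym_on_def)
  have raise: "(\<Sum>x | x \<in> {1..n} \<and> c x = i \<and> d x \<ge> j. swp x y u) = - u"
    if "y \<in> {1..n}" "d y \<ge> j" "1 \<le> i" "i < c y" for y i
    using that by (rule column_state_raise[OF u])
  have alt: "swp x y u = - u" if "x \<in> {1..n}" "y \<in> {1..n}" "x \<noteq> y" "d x = d y" "d x < j" for x y
    using u that by (simp add: column_state_def)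
  have out: "swp x y (antisym C u) = antisym C (swp x y u)"
    if "x \<in> {1..n}" "y \<in> {1..n}" "d x \<noteq> j" "d y \<noteq> j" for x y
    using that by (intro swp_antisym[OF C]) (auto simp: C_def)
  have "column_state c d (Suc j) (antisym C u)"
    unfolding column_state_def
  proof (intro conjI allI ballI impI)
    show "antisym C u \<noteq> 0"
      unfolding C_def by (rule column_antisym_nonzero[OF f c1 u])
    show "sym_on {x\<in>{1..n}. c x = i \<and> d x \<ge> Suc j} (antisym C u)" for i
      unfolding sym_on_def
    proof (intro ballI)
      fix x y assume "x \<in> {x\<in>{1..n}. c x = i \<and> d x \<ge> Suc j}" "y \<in> {x\<in>{1..n}. c x = i \<and> d x \<ge> Suc j}"
      then show "swp x y (antisym C u) = antisym C u"
        using out[of x y] sym[of x y] by simp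
    qed
  next
    fix x y assume xy: "x \<in> {1..n}" "y \<in> {1..n}" "x \<noteq> y" "d x = d y" "d x < Suc j"
    show "swp x y (antisym C u) = - antisym C u"
    proof (cases "d x = j")
      case True
      then show ?thesis
        using xy by (intro alt_onD[OF alt_on_antisym[OF C]]) (auto simp: C_def)
    next
      case False
      then show ?thesis
        using xy out[of x y] alt[of x y] by (simp add: antisym_neg)
    qed
  next
    fix y i assume y: "y \<in> {1..n}" "Suc j \<le> d y" and i: "1 \<le> i" "i < c y"
    obtain yi where yi: "yi \<in> {1..n}" "c yi = i" "d yi = j"
      using filling_cell[OF f y(1) i(1) _ j] y i by auto
    obtain yk where yk: "yk \<in> {1..n}" "c yk = c y" "d yk = j"
      using filling_cell[OF f y(1) _ order_refl j] y c1[OF y(1)] by auto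
    have swap_out: "swp x y (antisym C u) = antisym C (swp x y u)"
      if "x \<in> {x. x \<in> {1..n} \<and> c x = i \<and> Suc j \<le> d x}" for x
      using that y by (intro out) auto
    \<comment> \<open>\<open>u\<close> is fixed by \<open>(y yk)\<close>, as \<open>y\<close> and
      \<open>yk\<close> share a row; conjugation by \<open>(yi y)\<close> turns this into invariance
      under \<open>(yi yk)\<close>.\<close>
    have "swp yi yk (swp yi y u) = swp yi y u"
    proof -
      have ne: "y \<noteq> yi" "y \<noteq> yk" "yi \<noteq> yk"
        using y yi yk i by auto
      have "swp yi y u = swp yi y (swp y yk u)"
        using sym[of y yk] y yk by simp
      also have "\<dots> = swp (swap yi y y) (swap yi y yk) (swp yi y u)"
        using y yi yk by (intro swp_swp_conj) auto
      also have "\<dots> = swp yi yk (swp yi y u)"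
        using ne by simp
      finally show ?thesis ..
    qed
    moreover have "yi \<noteq> yk"
      using yi yk i by auto
    ultimately have zero: "antisym C (swp yi y u) = 0"
      using yi yk by (intro antisym_swp_eq_0[OF C, of yi yk]) (auto simp: C_def)
    have split: "{x. x \<in> {1..n} \<and> c x = i \<and> j \<le> d x}
        = insert yi {x. x \<in> {1..n} \<and> c x = i \<and> Suc j \<le> d x}"
    proof (rule equalityI; rule subsetI)
      fix x assume x: "x \<in> {x. x \<in> {1..n} \<and> c x = i \<and> j \<le> d x}"
      show "x \<in> insert yi {x. x \<in> {1..n} \<and> c x = i \<and> Suc j \<le> d x}"
        using filling_injD[OF f, of x yi] x yi by (cases "d x = j") auto
    qed (use yi in auto)
    have "- antisym C u = antisym C (\<Sum>x | x \<in> {1..n} \<and> c x = i \<and> j \<le> d x. swp x y u)"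
      using raise[OF y(1) _ i] y by (simp add: antisym_neg)
    also have "\<dots> = antisym C (swp yi y u)
        + (\<Sum>x | x \<in> {1..n} \<and> c x = i \<and> Suc j \<le> d x. antisym C (swp x y u))"
      unfolding split using yi by (subst sum.insert) (auto simp: antisym_add antisym_sum)
    also have "\<dots> = (\<Sum>x | x \<in> {1..n} \<and> c x = i \<and> Suc j \<le> d x. swp x y (antisym C u))"
      unfolding zero add_0_left by (intro sum.cong refl swap_out[symmetric])
    finally show "(\<Sum>x | x \<in> {1..n} \<and> c x = i \<and> Suc j \<le> d x. swp x y (antisym C u)) = - antisym C u"
      by (rule HOL.sym)
  qed
  then show ?thesis
    by (simp only: C_def)
qed

lemma highest_weight_alt:
  assumes W: "invariant W" and f: "filling c d" and c1: "\<And>x. x \<in> {1..n} \<Longrightarrow> c x \<ge> 1"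
    and v: "v \<in> W" "v \<noteq> 0" "sym_vec c v"
    and raise: "\<And>y i. y \<in> {1..n} \<Longrightarrow> 1 \<le> i \<Longrightarrow> i < c y \<Longrightarrow> (\<Sum>x | x \<in> {1..n} \<and> c x = i. swp x y v) = - v"
  obtains u where "u \<in> W" "u \<noteq> 0" "alt_vec d u"
proof -
  have d1: "d x \<ge> 1" if "x \<in> {1..n}" for x
    using f that by (auto simp: filling_def)
  have "\<exists>u\<in>W. column_state c d (Suc j) u" for j
  proof (induction j)
    case 0
    have row: "{x. x \<in> {1..n} \<and> c x = i \<and> Suc 0 \<le> d x} = {x. x \<in> {1..n} \<and> c x = i}" for i
      using d1 by auto
    have "column_state c d (Suc 0) v"
      unfolding column_state_def row
    proof (intro conjI allI ballI impI)
      show "sym_on {x \<in> {1..n}. c x = i} v" for i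
        using v(3) by (auto simp: sym_on_def sym_vec_def)
      show "swp x y v = - v" if "x \<in> {1..n}" "d x < Suc 0" for x y
        using d1[OF that(1)] that(2) by simp
    qed (use v raise in auto)
    then show ?case
      using v(1) by blast
  next
    case (Suc j)
    then obtain u where u: "u \<in> W" "column_state c d (Suc j) u"
      by blast
    have "antisym {x\<in>{1..n}. d x = Suc j} u \<in> W"
      using invariantD[OF W] u(1) by (intro antisym_in) auto
    then show ?case
      using column_step[OF f c1 _ u(2)] by auto
  qed
  \<comment> \<open>Past the last column all columns have been antisymmetrised, and the third clause
    of \<open>column_state\<close> becomes \<open>alt_vec d u\<close>.\<close>
  then obtain u where u: "u \<in> W" "column_state c d (Suc (Max (insert 0 (d ` {1..n})))) u"
    by blast
  have "d x < Suc (Max (insert 0 (d ` {1..n})))" if "x \<in> {1..n}" for x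
    using that unfolding less_Suc_eq_le by (intro Max_ge) auto
  then have "alt_vec d u" "u \<noteq> 0"
    using u(2) by (auto simp: column_state_def alt_vec_def simp del: atLeastAtMost_iff)
  then show ?thesis
    using that u(1) by blast
qed

text \<open>
  Moving \<open>y\<close> to the row \<open>i\<close> sends \<open>v\<close> to \<open>v + \<Sum>x. (x y) v\<close>, \<open>x\<close> running over the row \<open>i\<close>.
\<close>

lemma sym_vec_raise:
  assumes v: "sym_vec c v" and y: "y \<in> {1..n}" "c y \<noteq> i"
  shows "sym_vec (c(y := i)) (v + (\<Sum>x | x \<in> {1..n} \<and> c x = i. swp x y v))"
proof -
  define S where "S = {x. x \<in> {1..n} \<and> c x = i}"
  have S: "S \<subseteq> {1..n}" "finite S" "y \<notin> S"
    using y by (auto simp: S_def)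
  define v' where "v' = v + (\<Sum>x\<in>S. swp x y v)"
  have fix_class: "swp p q v' = v'" if pq: "p \<in> {1..n}" "q \<in> {1..n}" "c p = c q" "p \<noteq> y" "q \<noteq> y" for p q
  proof -
    have "swap p q y = y"
      using pq by auto
    then have "swp p q (swp x y v) = swp (swap p q x) y v" if "x \<in> S" for x
      using swp_swp_conj[of p q x y v] pq that S y sym_vecD[OF v pq(1,2,3)] by auto
    then have "swp p q (\<Sum>x\<in>S. swp x y v) = (\<Sum>x\<in>S. swp (swap p q x) y v)"
      by (simp add: act_sum)
    also have "\<dots> = (\<Sum>x\<in>S. swp x y v)"
    proof (rule sum.reindex_bij_betw[of "swap p q" S S "\<lambda>x. swp x y v"])
      show "bij_betw (swap p q) S S"
        by (rule bij_betwI[where g = "swap p q"])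
          (use pq in \<open>auto simp: S_def Transposition.transpose_def\<close>)
    qed
    finally show ?thesis
      unfolding v'_def act_add using sym_vecD[OF v pq(1,2,3)] by simp
  qed
  have fix_y: "swp p y v' = v'" if p: "p \<in> S" for p
  proof -
    have p': "p \<in> {1..n}" "c p = i" "p \<noteq> y"
      using p S by (auto simp: S_def)
    have rest: "swp p y (swp x y v) = swp x y v" if x: "x \<in> S - {p}" for x
    proof -
      have x': "x \<in> {1..n}" "c x = i" "x \<noteq> y" "x \<noteq> p"
        using x S by (auto simp: S_def)
      have "swp x y v = swp x y (swp p x v)"
        using sym_vecD[OF v p'(1) x'(1)] p' x' by simp
      also have "\<dots> = swp (swap x y p) (swap x y x) (swp x y v)"
        using p' x' y by (intro swp_swp_conj) auto
      also have "\<dots> = swp p y (swp x y v)"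
        using p' x' by simp
      finally show ?thesis ..
    qed
    have sum: "(\<Sum>x\<in>S. swp x y v) = swp p y v + (\<Sum>x\<in>S - {p}. swp x y v)"
      by (rule sum.remove[OF S(2) p])
    \<comment> \<open>\<open>(p y)\<close> interchanges the terms \<open>v\<close> and
      \<open>swp p y v\<close> and, by \<open>rest\<close>, fixes all the others.\<close>
    have "swp p y v' = swp p y v + (v + (\<Sum>x\<in>S - {p}. swp x y v))"
      unfolding v'_def sum act_add act_sum using p' y rest by simp
    then show ?thesis
      unfolding v'_def sum by (simp add: add.left_commute)
  qed
  have "sym_vec (c(y := i)) v'"
    unfolding sym_vec_def
  proof (intro ballI impI)
    fix p q assume pq: "p \<in> {1..n}" "q \<in> {1..n}" "(c(y := i)) p = (c(y := i)) q"
    consider "p = q" | "p \<noteq> y" "q \<noteq> y" | "p = y" "q \<in> S" | "q = y" "p \<in> S"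
      using pq by (auto simp: S_def split: if_splits)
    then show "swp p q v' = v'"
    proof cases
      case 2
      then show ?thesis
        using fix_class[of p q] pq by auto
    next
      case 3
      then show ?thesis
        using fix_y[of q] by (simp add: transpose_commute)
    qed (auto simp: fix_y act_id)
  qed
  then show ?thesis
    by (simp only: v'_def S_def)
qed

text \<open>
  Among the colourings with a nonzero invariant vector in \<open>W\<close>, take one minimising the sum of all
  colours: the raising operators then vanish on it, and the class sizes decrease.
\<close>

lemma exists_type:
  assumes W: "invariant W" and nz: "w \<in> W" "w \<noteq> 0"
  obtains l c d u z where "is_partition n l" "shape n c (part l)" "shape n d (part (conjugate l))"
    "u \<in> W" "u \<noteq> 0" "sym_vec c u" "z \<in> W" "z \<noteq> 0" "alt_vec d z"
proof -
  define P where "P c \<longleftrightarrow> (\<forall>x\<in>{1..n}. c x \<ge> 1) \<and> (\<exists>v\<in>W. v \<noteq> 0 \<and> sym_vec c v)" for c :: "nat \<Rightarrow> nat"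
  \<comment> \<open>All classes of \<open>id\<close> are singletons, so every vector is invariant
    and the minimum is over a nonempty family.\<close>
  have "P id"
    using nz by (auto simp: P_def sym_vec_def act_id)
  then obtain c where Pc: "P c" and min: "\<And>c'. P c' \<Longrightarrow> sum c {1..n} \<le> sum c' {1..n}"
    using ex_has_least_nat[of P id "\<lambda>c. sum c {1..n}"] by blast
  then obtain v where v: "v \<in> W" "v \<noteq> 0" "sym_vec c v" and c1: "\<And>x. x \<in> {1..n} \<Longrightarrow> c x \<ge> 1"
    by (auto simp: P_def)
  have raise: "(\<Sum>x | x \<in> {1..n} \<and> c x = i. swp x y v) = - v"
    if y: "y \<in> {1..n}" "1 \<le> i" "i < c y" for y i
  proof (rule ccontr)
    define v' where "v' = v + (\<Sum>x | x \<in> {1..n} \<and> c x = i. swp x y v)"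
    assume "(\<Sum>x | x \<in> {1..n} \<and> c x = i. swp x y v) \<noteq> - v"
    then have "v' \<noteq> 0"
      unfolding v'_def add_eq_0_iff .
    moreover have "v' \<in> W"
      unfolding v'_def using W v(1) y(1)
      by (intro cfun.subspace_add cfun.subspace_sum invariantD(1) invariant_swp) auto
    moreover have "sym_vec (c(y := i)) v'"
      unfolding v'_def using y by (intro sym_vec_raise v(3)) auto
    ultimately have "P (c(y := i))"
      using c1 y by (auto simp: P_def)
    then have "sum c {1..n} \<le> sum (c(y := i)) {1..n}"
      by (rule min)
    moreover have "sum (c(y := i)) {1..n} < sum c {1..n}"
      using y by (intro sum_strict_mono_ex1) (auto intro!: bexI[of _ y])
    ultimately show False
      by simp
  qed
  define s where "s i = card {x\<in>{1..n}. c x = i}" for i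
  have s_mono1: "s k \<le> s i" if ik: "1 \<le> i" "i < k" for i k
  proof -
    \<comment> \<open>Exchanging the names of the colours \<open>i\<close> and \<open>k\<close>
      preserves the invariance of \<open>v\<close>, so minimality compares
      \<open>i * s i + k * s k\<close> with \<open>k * s i + i * s k\<close>.\<close>
    define c' where "c' x = swap i k (c x)" for x
    have "P c'"
      unfolding P_def
    proof (intro conjI ballI bexI)
      fix x assume "x \<in> {1..n}"
      then show "1 \<le> c' x"
        using c1[of x] ik by (auto simp: c'_def Transposition.transpose_def)
    next
      show "sym_vec c' v"
        using v(3) injD[OF inj_transpose[of i k]] unfolding sym_vec_def c'_def by blast
    qed (use v in auto)
    then have le: "sum c {1..n} \<le> sum c' {1..n}"
      by (rule min)
    define I where "I = {x\<in>{1..n}. c x = i}"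
    define K where "K = {x\<in>{1..n}. c x = k}"
    define R where "R = {x\<in>{1..n}. c x \<noteq> i \<and> c x \<noteq> k}"
    have dis: "{1..n} = (I \<union> K) \<union> R" "I \<inter> K = {}" "(I \<union> K) \<inter> R = {}" "finite I" "finite K" "finite R"
      using ik by (auto simp: I_def K_def R_def)
    have total: "sum h {1..n} = sum h I + sum h K + sum h R" for h :: "nat \<Rightarrow> nat"
      unfolding dis(1) using dis(2-6) by (simp add: sum.union_disjoint)
    have "sum c I = (\<Sum>x\<in>I. i)" "sum c K = (\<Sum>x\<in>K. k)" "sum c' I = (\<Sum>x\<in>I. k)" "sum c' K = (\<Sum>x\<in>K. i)"
      "sum c' R = sum c R"
      by (auto intro!: sum.cong simp: I_def K_def R_def c'_def)
    then have "s i * i + s k * k \<le> s i * k + s k * i"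
      using le total[of c] total[of c'] unfolding s_def I_def[symmetric] K_def[symmetric] by simp
    then have "int (s k) * (int k - int i) \<le> int (s i) * (int k - int i)"
      by (simp add: algebra_simps flip: of_nat_mult of_nat_add)
    then show ?thesis
      using ik by simp
  qed
  have s_mono: "s k \<le> s i" if "1 \<le> i" "i \<le> k" for i k
    using s_mono1[of i k] that by (cases "i = k") auto
  have s_supp: "{i. i \<ge> 1 \<and> s i > 0} = c ` {1..n}"
    using c1 by (auto simp: s_def card_gt_0_iff simp del: atLeastAtMost_iff)
  have "card {1..n} = (\<Sum>i\<in>c ` {1..n}. card {x\<in>{1..n}. c x = i})"
    by (rule card_fibres) auto
  then have "(\<Sum>i | i \<ge> 1 \<and> s i > 0. s i) = n"
    unfolding s_supp by (simp add: s_def)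
  then obtain l where l: "is_partition n l" "\<And>i. i \<ge> 1 \<Longrightarrow> part l i = s i"
    using partition_of_sizes[of s n] s_mono s_supp by auto
  have shape_c: "shape n c (part l)"
    unfolding shape_def
  proof
    fix i
    show "card {x\<in>{1..n}. c x = i} = part l i"
    proof (cases "i = 0")
      case True
      have "{x\<in>{1..n}. c x = 0} = {}"
        using c1 by force
      then show ?thesis
        using True by (simp add: part_def del: Collect_empty_eq)
    qed (use l(2)[of i] in \<open>simp add: s_def\<close>)
  qed
  \<comment> \<open>Any numbering of the points of each row serves as the column index; since the
    row lengths decrease, the cells fill a Young diagram.\<close>
  have "\<exists>b. bij_betw b {x\<in>{1..n}. c x = i} {1..s i}" for i
    by (intro finite_same_card_bij) (auto simp: s_def)
  then obtain b where b: "\<And>i. bij_betw (b i) {x\<in>{1..n}. c x = i} {1..s i}"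
    by metis
  define d where "d x = b (c x) x" for x
  have d_in: "d x \<in> {1..s (c x)}" if "x \<in> {1..n}" for x
    using bij_betwE[OF b[of "c x"]] that by (auto simp: d_def)
  have inj: "inj_on (\<lambda>x. (c x, d x)) {1..n}"
  proof (rule inj_onI)
    fix x y assume xy: "x \<in> {1..n}" "y \<in> {1..n}" "(c x, d x) = (c y, d y)"
    then have cy: "c y = c x" and bx: "b (c x) x = b (c x) y"
      unfolding d_def by (metis prod.inject)+
    show "x = y"
      by (rule inj_onD[OF bij_betw_imp_inj_on[OF b[of "c x"]] bx]) (use xy(1,2) cy in simp_all)
  qed
  have cell: "\<exists>y\<in>{1..n}. c y = i \<and> d y = j" if j: "1 \<le> j" "j \<le> s i" for i j
  proof -
    have "j \<in> b i ` {x\<in>{1..n}. c x = i}"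
      using b[of i] j by (simp add: bij_betw_def)
    then show ?thesis
      by (auto simp: d_def)
  qed
  have "filling c d"
    unfolding filling_def
  proof (intro conjI ballI allI impI inj)
    fix x assume x: "x \<in> {1..n}"
    show "d x \<ge> 1"
      using d_in[OF x] by simp
    fix i j assume "1 \<le> i" "i \<le> c x" "1 \<le> j" "j \<le> d x"
    then show "\<exists>y\<in>{1..n}. c y = i \<and> d y = j"
      using d_in[OF x] s_mono[of i "c x"] by (intro cell) auto
  qed
  then obtain z where z: "z \<in> W" "z \<noteq> 0" "alt_vec d z"
    using highest_weight_alt[OF W _ c1 v raise] by blast
  have shape_d: "shape n d (part (conjugate l))"
    unfolding shape_def
  proof
    fix j
    show "card {x\<in>{1..n}. d x = j} = part (conjugate l) j"
    proof (cases "j = 0")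
      case True
      have "{x\<in>{1..n}. d x = 0} = {}"
        using d_in by force
      then show ?thesis
        using True by (simp add: part_def del: Collect_empty_eq)
    next
      case False
      have "c ` {x\<in>{1..n}. d x = j} = {i\<in>{1..length l}. j \<le> part l i}"
      proof (rule equalityI; rule subsetI)
        fix i assume "i \<in> c ` {x\<in>{1..n}. d x = j}"
        then obtain x where x: "x \<in> {1..n}" "d x = j" "c x = i"
          by auto
        then have "1 \<le> i" "j \<le> part l i"
          using d_in[OF x(1)] c1[OF x(1)] l(2)[of i] by auto
        then show "i \<in> {i\<in>{1..length l}. j \<le> part l i}"
          using False by (auto simp: part_def split: if_splits)
      next
        fix i assume i: "i \<in> {i\<in>{1..length l}. j \<le> part l i}"
        then have "j \<le> s i"
          using l(2)[of i] by simp
        then show "i \<in> c ` {x\<in>{1..n}. d x = j}"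
          using cell[of j i] False by auto
      qed
      moreover have "inj_on c {x\<in>{1..n}. d x = j}"
        by (rule inj_onI, rule inj_onD[OF inj]) auto
      ultimately have "card {x\<in>{1..n}. d x = j} = card {i\<in>{1..length l}. j \<le> part l i}"
        using card_image by fastforce
      then show ?thesis
        using part_conjugate[OF l(1), of j] False by simp
    qed
  qed
  show ?thesis
    by (rule that[OF l(1) shape_c shape_d v z])
qed

end

section \<open>Stabilisers of colourings\<close>

context perm_action
begin

definition colour_stab :: "(nat \<Rightarrow> nat) \<Rightarrow> (nat \<Rightarrow> nat) set" where
  "colour_stab c = {g. g permutes {1..n} \<and> (\<forall>x. c (g x) = c x)}"

text \<open>The transposition of \<open>x\<close> and \<open>g x\<close> stays inside one class, and
  composing with it leaves fewer moved points. Statements about the whole stabiliser thus reduce to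
  the transpositions occurring in \<open>sym_vec\<close> and \<open>alt_vec\<close>.\<close>

lemma colour_stab_induct [consumes 1, case_names id swap]:
  assumes "g \<in> colour_stab c" and id: "P id"
    and swap: "\<And>x y h. x \<in> {1..n} \<Longrightarrow> y \<in> {1..n} \<Longrightarrow> x \<noteq> y \<Longrightarrow> c x = c y \<Longrightarrow> h permutes {1..n} \<Longrightarrow> P h
      \<Longrightarrow> P (swap x y \<circ> h)"
  shows "P g"
  using assms(1)
proof (induction "card {x. g x \<noteq> x}" arbitrary: g rule: less_induct)
  case less
  have g: "g permutes {1..n}" and cg: "\<And>x. c (g x) = c x"
    using less.prems by (auto simp: colour_stab_def)
  show ?case
  proof (cases "g = id")
    case False
    then obtain x where x: "g x \<noteq> x"
      by (auto simp: fun_eq_iff)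
    then have x_in: "x \<in> {1..n}"
      using permutes_not_in[OF g] by blast
    then have gx_in: "g x \<in> {1..n}"
      using permutes_in_image[OF g] by blast
    define h where "h = swap x (g x) \<circ> g"
    have h: "h permutes {1..n}"
      unfolding h_def by (intro permutes_compose[OF g] swap_permutes x_in gx_in)
    have "c (h y) = c y" for y
      using cg[of y] cg[of x] by (auto simp: h_def Transposition.transpose_def)
    then have hc: "h \<in> colour_stab c"
      using h by (simp add: colour_stab_def)
    have "h y = y" if "g y = y" for y
    proof -
      have "y \<noteq> x" "y \<noteq> g x"
        using that x permutes_inj[OF g] by (auto dest: injD)
      then show ?thesis
        using that by (simp add: h_def)
    qed
    moreover have "h x = x"
      by (simp add: h_def)
    ultimately have "{y. h y \<noteq> y} \<subset> {y. g y \<noteq> y}"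
      using x by blast
    moreover have "finite {y. g y \<noteq> y}"
      by (rule finite_subset[of _ "{1..n}"]) (use permutes_not_in[OF g] in blast, simp)
    ultimately have "P h"
      using less.hyps[OF _ hc] psubset_card_mono by blast
    moreover have "g = swap x (g x) \<circ> h"
      by (auto simp: h_def fun_eq_iff)
    ultimately show ?thesis
      using swap[OF x_in gx_in x[symmetric] cg[of x, symmetric] h] by metis
  qed (use id in simp)
qed

lemma sym_vec_stab: "sym_vec c v \<Longrightarrow> g \<in> colour_stab c \<Longrightarrow> act g v = v"
proof (rotate_tac, induction rule: colour_stab_induct)
  case (swap x y h)
  then show ?case
    by (simp only: act_comp[OF swap_permutes swap.hyps(5)] sym_vecD)
qed (rule act_id)

lemma alt_vec_stab: "alt_vec c v \<Longrightarrow> g \<in> colour_stab c \<Longrightarrow> act g v = fscale (of_int (sign g)) v"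
proof (rotate_tac, induction rule: colour_stab_induct)
  case (swap x y h)
  have "permutation h"
    using swap.hyps(5) permutation_permutes finite_atLeastAtMost by blast
  then have "sign (Transposition.transpose x y \<circ> h) = - sign h"
    using swap.hyps(3) by (simp add: sign_compose permutation_swap_id sign_swap_id)
  moreover have "act (Transposition.transpose x y \<circ> h) v = fscale (of_int (sign h)) (swp x y v)"
    by (simp only: act_comp[OF swap_permutes[OF swap.hyps(1,2)] swap.hyps(5)] swap.IH[OF swap.prems]
        act_scale)
  ultimately show ?case
    using alt_vecD[OF swap.prems swap.hyps(1-4)]
    by (simp only: of_int_minus cfun.scale_minus_left cfun.scale_minus_right)
qed (simp only: act_id sign_id of_int_1 cfun.scale_one)

lemma finite_colour_stab: "finite (colour_stab c)"
  by (rule finite_subset[OF _ finite_permutations[of "{1..n}"]]) (auto simp: colour_stab_def)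

lemma sym_vec_sum_stab: "sym_vec c (\<Sum>g\<in>colour_stab c. act g v)"
  unfolding sym_vec_def
proof (intro ballI impI)
  fix x y assume xy: "x \<in> {1..n}" "y \<in> {1..n}" "c x = c y"
  let ?t = "swap x y"
  have t: "?t permutes {1..n}"
    by (rule swap_permutes[OF xy(1,2)])
  have ct: "c (?t z) = c z" for z
    using xy(3) by (simp add: Transposition.transpose_def)
  have comp_in: "?t \<circ> g \<in> colour_stab c" if "g \<in> colour_stab c" for g
    using that t permutes_compose ct by (auto simp: colour_stab_def)
  have tt: "?t \<circ> (?t \<circ> g) = g" for g
    by (simp add: fun_eq_iff)
  have "bij_betw ((\<circ>) ?t) (colour_stab c) (colour_stab c)"
    by (rule bij_betwI[where g = "(\<circ>) ?t"]) (use comp_in tt in auto)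
  then have "(\<Sum>g\<in>colour_stab c. act g v) = (\<Sum>g\<in>colour_stab c. act (?t \<circ> g) v)"
    by (rule sum.reindex_bij_betw[symmetric])
  also have "\<dots> = swp x y (\<Sum>g\<in>colour_stab c. act g v)"
    unfolding act_sum by (intro sum.cong refl act_comp[OF t]) (simp add: colour_stab_def)
  finally show "swp x y (\<Sum>g\<in>colour_stab c. act g v) = (\<Sum>g\<in>colour_stab c. act g v)"
    by (rule HOL.sym)
qed

end

section \<open>The sign cocycle on matchings\<close>

definition osign :: "nat \<Rightarrow> nat \<Rightarrow> int" where
  "osign x y = sgn (int y - int x)"

lemma osign_swap: "osign y x = - osign x y"
  by (simp add: osign_def sgn_if)

lemma osign_less: "x < y \<Longrightarrow> osign x y = 1" "y < x \<Longrightarrow> osign x y = - 1"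
  by (auto simp: osign_def)

lemma osign_sq: "x \<noteq> y \<Longrightarrow> osign x y * osign x y = 1"
  by (auto simp: osign_def sgn_if)

text \<open>A product over the two-element subsets of \<open>S\<close>. For symmetric
  \<open>t\<close> the condition \<open>i < k\<close> merely selects a representative, which is what
  permits reindexing along maps that do not preserve the order.\<close>

definition pair_prod :: "(nat \<Rightarrow> nat \<Rightarrow> int) \<Rightarrow> nat set \<Rightarrow> int" where
  "pair_prod t S = (\<Prod>(i, k)\<in>{(i, k). i \<in> S \<and> k \<in> S \<and> i < k}. t i k)"

lemma finite_pairs: "finite S \<Longrightarrow> finite {(i, k). i \<in> S \<and> k \<in> S \<and> i < (k::nat)}"
  by (rule finite_subset[of _ "S \<times> S"]) auto

lemma pair_prod_cong:
  "(\<And>i k. i \<in> S \<Longrightarrow> k \<in> S \<Longrightarrow> i < k \<Longrightarrow> t i k = t' i k) \<Longrightarrow> pair_prod t S = pair_prod t' S"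
  unfolding pair_prod_def by (intro prod.cong) auto

lemma pair_prod_mult: "pair_prod (\<lambda>i k. s i k * t i k) S = pair_prod s S * pair_prod t S"
  unfolding pair_prod_def by (simp add: case_prod_beta prod.distrib)

lemma pair_prod_insert:
  assumes sym: "\<And>i k. t i k = t k i" and "finite S" "x \<notin> S"
  shows "pair_prod t (insert x S) = pair_prod t S * (\<Prod>h\<in>S. t x h)"
proof -
  let ?f = "\<lambda>h. (min x h, max x h)"
  let ?P = "\<lambda>S. {(i, k). i \<in> S \<and> k \<in> S \<and> i < (k::nat)}"
  have split: "?P (insert x S) = ?P S \<union> ?f ` S"
  proof (rule equalityI; rule subsetI)
    fix z assume "z \<in> ?P (insert x S)"
    then obtain i k where z: "z = (i, k)" "i \<in> insert x S" "k \<in> insert x S" "i < k"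
      by auto
    show "z \<in> ?P S \<union> ?f ` S"
    proof (cases "i = x")
      case True
      then have "z = ?f k" "k \<in> S"
        using z by auto
      then show ?thesis
        by blast
    next
      case ix: False
      show ?thesis
      proof (cases "k = x")
        case True
        then have "z = ?f i" "i \<in> S"
          using z ix by auto
        then show ?thesis
          by blast
      qed (use z ix in auto)
    qed
  next
    fix z assume "z \<in> ?P S \<union> ?f ` S"
    then show "z \<in> ?P (insert x S)"
    proof
      assume "z \<in> ?f ` S"
      then obtain h where h: "h \<in> S" "z = ?f h"
        by blast
      then have "h \<noteq> x"
        using assms(3) by blast
      then show ?thesis
        using h by (auto simp: min_def max_def)
    qed auto
  qed
  have fst_snd: "fst (?f h) = x \<or> snd (?f h) = x" for h
    by (auto simp: min_def max_def)
  have disj: "?P S \<inter> ?f ` S = {}"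
  proof (rule equals0I)
    fix z assume "z \<in> ?P S \<inter> ?f ` S"
    then obtain h where "z = ?f h" "fst z \<in> S" "snd z \<in> S"
      by auto
    then show False
      using fst_snd[of h] assms(3) by metis
  qed
  have inj: "inj_on ?f S"
    by (rule inj_onI) (auto simp: min_def max_def split: if_splits)
  have "pair_prod t (insert x S) = pair_prod t S * (\<Prod>(i, k)\<in>?f ` S. t i k)"
    unfolding pair_prod_def split
    by (rule prod.union_disjoint) (use finite_pairs[OF assms(2)] assms(2) disj in auto)
  also have "(\<Prod>(i, k)\<in>?f ` S. t i k) = (\<Prod>h\<in>S. t x h)"
    unfolding prod.reindex[OF inj]
  proof (intro prod.cong refl)
    fix h
    show "((\<lambda>(i, k). t i k) \<circ> ?f) h = t x h"
      using sym[of h x] by (cases "x \<le> h") (simp_all add: min_def max_def)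
  qed
  finally show ?thesis .
qed

lemma pair_prod_reindex:
  assumes sym: "\<And>i k. t i k = t k i" and "finite S" "inj_on f S"
  shows "pair_prod (\<lambda>i k. t (f i) (f k)) S = pair_prod t (f ` S)"
  using assms(2,3)
proof (induction S)
  case empty
  then show ?case
    by (simp add: pair_prod_def)
next
  case (insert x S)
  have inj: "inj_on f S" and fx: "f x \<notin> f ` S"
    using insert.prems insert.hyps(2) by auto
  have "pair_prod (\<lambda>i k. t (f i) (f k)) (insert x S) = pair_prod t (f ` S) * (\<Prod>h\<in>S. t (f x) (f h))"
    unfolding insert.IH[OF inj, symmetric]
    by (rule pair_prod_insert[OF sym insert.hyps])
  also have "(\<Prod>h\<in>S. t (f x) (f h)) = (\<Prod>h\<in>f ` S. t (f x) h)"
    by (simp add: prod.reindex[OF inj])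
  also have "pair_prod t (f ` S) * \<dots> = pair_prod t (f ` insert x S)"
    unfolding image_insert using insert.hyps(1) fx
    by (intro pair_prod_insert[OF sym, symmetric]) simp_all
  finally show ?case .
qed

text \<open>The parity of the number of inversions of \<open>f\<close> on \<open>S\<close>. The
  factor \<open>osign i k\<close>, equal to 1 on the pairs in question, makes the expression
  symmetric in \<open>i\<close> and \<open>k\<close>.\<close>

definition inversion_sign :: "(nat \<Rightarrow> nat) \<Rightarrow> nat set \<Rightarrow> int" where
  "inversion_sign f S = pair_prod (\<lambda>i k. osign i k * osign (f i) (f k)) S"

lemma inversion_sign_cong: "(\<And>i. i \<in> S \<Longrightarrow> f i = g i) \<Longrightarrow> inversion_sign f S = inversion_sign g S"
  unfolding inversion_sign_def by (intro pair_prod_cong) simp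

lemma osign_pair_sym: "osign i k * osign (f i) (f k) = osign k i * osign (f k) (f i)"
  using osign_swap[of i k] osign_swap[of "f i" "f k"] by simp

text \<open>After reindexing the second product along \<open>f\<close>, the intermediate factor
  \<open>osign (f i) (f k)\<close> occurs twice and cancels.\<close>

lemma inversion_sign_comp:
  assumes "finite S" "inj_on f S"
  shows "inversion_sign (f' \<circ> f) S = inversion_sign f S * inversion_sign f' (f ` S)"
proof -
  have "inversion_sign f' (f ` S)
      = pair_prod (\<lambda>i k. osign (f i) (f k) * osign (f' (f i)) (f' (f k))) S"
    unfolding inversion_sign_def
    by (rule pair_prod_reindex[OF osign_pair_sym assms, symmetric])
  moreover have "osign i k * osign (f i) (f k) * (osign (f i) (f k) * osign (f' (f i)) (f' (f k)))
      = osign i k * osign (f' (f i)) (f' (f k))" if "i \<in> S" "k \<in> S" "i < k" for i k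
  proof -
    have "f i \<noteq> f k"
      using that inj_onD[OF assms(2), of i k] by auto
    then have "osign (f i) (f k) * osign (f i) (f k) = 1"
      by (rule osign_sq)
    then show ?thesis
      by (simp only: mult.assoc[symmetric] mult_1_right) (simp only: mult.assoc mult_1_right)
  qed
  ultimately show ?thesis
    unfolding inversion_sign_def comp_def by (simp only: pair_prod_mult[symmetric] cong: pair_prod_cong)
qed

lemma inversion_sign_fixed: "(\<And>i. i \<in> S \<Longrightarrow> f i = i) \<Longrightarrow> inversion_sign f S = 1"
proof -
  assume "\<And>i. i \<in> S \<Longrightarrow> f i = i"
  then have "inversion_sign f S = pair_prod (\<lambda>_ _. 1) S"
    unfolding inversion_sign_def by (intro pair_prod_cong) (simp add: osign_less)
  then show ?thesis
    by (simp add: pair_prod_def)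
qed

lemma inversion_sign_swap:
  assumes "finite S" "a \<in> S" "b \<in> S" "a \<noteq> b" and f: "\<And>i. i \<in> S \<Longrightarrow> f i = swap a b i"
  shows "inversion_sign f S = - 1"
proof -
  let ?t = "\<lambda>i k. osign i k * osign (f i) (f k)"
  define S' where "S' = S - {a, b}"
  have S: "S = insert a (insert b S')" "a \<notin> insert b S'" "b \<notin> S'" "finite S'"
    using assms by (auto simp: S'_def)
  have f': "f a = b" "f b = a" "\<And>h. h \<in> S' \<Longrightarrow> f h = h"
    using f assms by (auto simp: S'_def)
  have "inversion_sign f S = pair_prod ?t S' * (\<Prod>h\<in>S'. ?t b h) * (?t a b * (\<Prod>h\<in>S'. ?t a h))"
  proof -
    have sym: "?t i k = ?t k i" for i k
      by (rule osign_pair_sym)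
    show ?thesis
      unfolding inversion_sign_def S(1)
      using S(2-4) pair_prod_insert[of ?t, OF sym S(4,3)] pair_prod_insert[of ?t "insert b S'" a, OF sym]
      by simp
  qed
  also have "pair_prod ?t S' = 1"
    using inversion_sign_fixed[of S' f] f'(3) by (simp add: inversion_sign_def)
  also have "?t a b = - 1"
    using f' osign_swap[of a b] osign_sq[OF assms(4)] by simp
  also have "1 * (\<Prod>h\<in>S'. ?t b h) * (- 1 * (\<Prod>h\<in>S'. ?t a h)) = - (\<Prod>h\<in>S'. ?t b h * ?t a h)"
    by (simp add: prod.distrib)
  also have "(\<Prod>h\<in>S'. ?t b h * ?t a h) = (\<Prod>h\<in>S'. 1)"
  proof (intro prod.cong refl)
    fix h assume h: "h \<in> S'"
    then have "h \<noteq> a" "h \<noteq> b"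
      by (auto simp: S'_def)
    then have "osign b h * osign b h = 1" "osign a h * osign a h = 1"
      by (auto intro: osign_sq)
    then show "?t b h * ?t a h = 1"
      using f' h by (simp add: algebra_simps)
  qed
  finally show ?thesis
    by simp
qed

section \<open>Perfect matchings and the sign of a permutation on a matching\<close>

definition is_matching :: "nat \<Rightarrow> (nat \<Rightarrow> nat) \<Rightarrow> bool" where
  "is_matching n w \<longleftrightarrow> w permutes {1..n} \<and> (\<forall>x. w (w x) = x) \<and> (\<forall>x\<in>{1..n}. w x \<noteq> x)"

lemma fpf_involutions_iff: "w \<in> fpf_involutions n \<longleftrightarrow> is_matching n w"
proof -
  have "w = inv' w \<longleftrightarrow> (\<forall>x. w (w x) = x)" if "w permutes {1..n}"
    using permutes_inverses[OF that] by (metis ext)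
  then show ?thesis
    by (auto simp: fpf_involutions_def is_matching_def sym_group_carrier)
qed

lemma is_matchingD:
  assumes "is_matching n w"
  shows "w permutes {1..n}" "w (w x) = x" "x \<in> {1..n} \<Longrightarrow> w x \<noteq> x" "w x \<in> {1..n} \<longleftrightarrow> x \<in> {1..n}"
    "w x = w y \<longleftrightarrow> x = y"
  using assms permutes_in_image[of w "{1..n}"] by (auto simp: is_matching_def) metis

lemma is_matching_conj:
  assumes "is_matching n w" "g permutes {1..n}"
  shows "is_matching n (g \<circ> w \<circ> inv' g)"
  unfolding is_matching_def
proof (intro conjI allI ballI)
  show "g \<circ> w \<circ> inv' g permutes {1..n}"
    by (intro permutes_compose permutes_inv assms(2) is_matchingD(1)[OF assms(1)])
  show "(g \<circ> w \<circ> inv' g) ((g \<circ> w \<circ> inv' g) x) = x" for x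
    by (simp add: permutes_inverses[OF assms(2)] is_matchingD(2)[OF assms(1)])
  fix x assume "x \<in> {1..n}"
  then have "inv' g x \<in> {1..n}"
    using permutes_in_image[OF permutes_inv[OF assms(2)]] by blast
  then have "w (inv' g x) \<noteq> inv' g x"
    by (rule is_matchingD(3)[OF assms(1)])
  then show "(g \<circ> w \<circ> inv' g) x \<noteq> x"
    using permutes_inverses[OF assms(2)] by (metis comp_apply)
qed

definition lower_ends :: "nat \<Rightarrow> (nat \<Rightarrow> nat) \<Rightarrow> nat set" where
  "lower_ends n w = {i\<in>{1..n}. i < w i}"

text \<open>The smaller end of the image of the edge at \<open>i\<close>. Disjoint edges are ordered
  lexicographically by their smaller ends alone, so this number decides the comparisons in
  \<open>i2\<close>.\<close>

definition lower_image :: "(nat \<Rightarrow> nat) \<Rightarrow> (nat \<Rightarrow> nat) \<Rightarrow> nat \<Rightarrow> nat" where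
  "lower_image g w i = min (g i) (g (w i))"

text \<open>The sign \<open>(-1)^i2\<close> in multiplicative form: the first factor records the
  reversed edges, the second the inversions among the edges.\<close>

definition match_sign :: "nat \<Rightarrow> (nat \<Rightarrow> nat) \<Rightarrow> (nat \<Rightarrow> nat) \<Rightarrow> int" where
  "match_sign n g w = (\<Prod>i\<in>lower_ends n w. osign (g i) (g (w i)))
     * inversion_sign (lower_image g w) (lower_ends n w)"

lemma finite_lower_ends [simp]: "finite (lower_ends n w)"
  by (simp add: lower_ends_def)

lemma lower_image_cases:
  assumes "is_matching n w" "i \<in> lower_ends n w" "g permutes {1..n}"
  obtains "g i < g (w i)" "lower_image g w i = g i"
    | "g (w i) < g i" "lower_image g w i = g (w i)"
proof -
  have "g i \<noteq> g (w i)"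
    using assms(2) injD[OF permutes_inj[OF assms(3)], of i "w i"] by (auto simp: lower_ends_def)
  then show ?thesis
    using that by (cases "g i < g (w i)") (auto simp: lower_image_def)
qed

lemma lower_ends_disjoint:
  "is_matching n w \<Longrightarrow> i \<in> lower_ends n w \<Longrightarrow> k \<in> lower_ends n w \<Longrightarrow> w i \<noteq> k"
  by (metis (no_types, lifting) is_matchingD(2) lower_ends_def mem_Collect_eq not_less_iff_gr_or_eq)

lemma lower_image_eq_iff:
  assumes w: "is_matching n w" and i: "i \<in> lower_ends n w" and k: "k \<in> lower_ends n w"
    and g: "g permutes {1..n}"
  shows "lower_image g w i = lower_image g w k \<longleftrightarrow> i = k"
proof
  assume eq: "lower_image g w i = lower_image g w k"
  have inj: "x = y" if "g x = g y" for x y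
    using that injD[OF permutes_inj[OF g]] by blast
  show "i = k"
    by (rule lower_image_cases[OF w i g]; rule lower_image_cases[OF w k g])
      (use eq inj lower_ends_disjoint[OF w i k] lower_ends_disjoint[OF w k i] is_matchingD(5)[OF w]
        in metis)+
qed simp

lemma inj_on_lower_image:
  "is_matching n w \<Longrightarrow> g permutes {1..n} \<Longrightarrow> inj_on (lower_image g w) (lower_ends n w)"
  by (intro inj_onI) (simp add: lower_image_eq_iff)

lemma lower_ends_conj:
  assumes w: "is_matching n w" and g: "g permutes {1..n}"
  shows "lower_ends n (g \<circ> w \<circ> inv' g) = lower_image g w ` lower_ends n w"
proof (rule equalityI; rule subsetI)
  let ?w = "g \<circ> w \<circ> inv' g"
  have w': "?w (g x) = g (w x)" for x
    by (simp add: permutes_inverses[OF g])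
  fix y assume y: "y \<in> lower_ends n ?w"
  define x where "x = inv' g y"
  have gx: "g x = y"
    by (simp add: x_def permutes_inverses[OF g])
  have x: "x \<in> {1..n}" "g x < g (w x)"
    using y w'[of x] permutes_in_image[OF g, of x] by (auto simp: lower_ends_def gx)
  show "y \<in> lower_image g w ` lower_ends n w"
  proof (cases "x < w x")
    case True
    then show ?thesis
      using x gx by (intro image_eqI[of _ _ x]) (auto simp: lower_ends_def lower_image_def)
  next
    case False
    then have "w x < x"
      using is_matchingD(3)[OF w x(1)] by simp
    then show ?thesis
      using x gx is_matchingD(2,4)[OF w, of x]
      by (intro image_eqI[of _ _ "w x"]) (auto simp: lower_ends_def lower_image_def)
  qed
next
  let ?w = "g \<circ> w \<circ> inv' g"
  have w': "?w (g x) = g (w x)" for x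
    by (simp add: permutes_inverses[OF g])
  fix y assume "y \<in> lower_image g w ` lower_ends n w"
  then obtain i where i: "i \<in> lower_ends n w" "y = lower_image g w i"
    by blast
  have i_in: "i \<in> {1..n}" "w i \<in> {1..n}"
    using i(1) is_matchingD(4)[OF w] by (auto simp: lower_ends_def)
  then have g_in: "g i \<in> {1..n}" "g (w i) \<in> {1..n}"
    using permutes_in_image[OF g] by blast+
  show "y \<in> lower_ends n ?w"
  proof (rule lower_image_cases[OF w i(1) g])
    assume "g i < g (w i)" "lower_image g w i = g i"
    then show ?thesis
      using i(2) g_in w'[of i] by (simp add: lower_ends_def)
  next
    assume "g (w i) < g i" "lower_image g w i = g (w i)"
    then show ?thesis
      using i(2) g_in w'[of "w i"] is_matchingD(2)[OF w] by (simp add: lower_ends_def)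
  qed
qed

text \<open>The cocycle identity behind the homomorphism property of \<open>rho2\<close>.
  Orientation and inversion part each satisfy it separately, once the lower ends of the conjugated
  matching are recognised as the lower images.\<close>

lemma match_sign_comp:
  assumes w: "is_matching n w" and a: "a permutes {1..n}" and b: "b permutes {1..n}"
  shows "match_sign n (b \<circ> a) w = match_sign n a w * match_sign n b (a \<circ> w \<circ> inv' a)"
proof -
  let ?w = "a \<circ> w \<circ> inv' a"
  let ?L = "lower_ends n w"
  have w': "?w (a x) = a (w x)" for x
    by (simp add: permutes_inverses[OF a])
  have inj: "inj_on (lower_image a w) ?L"
    by (rule inj_on_lower_image[OF w a])
  have "(\<Prod>i\<in>lower_ends n ?w. osign (b i) (b (?w i)))
      = (\<Prod>i\<in>?L. osign (b (lower_image a w i)) (b (?w (lower_image a w i))))"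
    unfolding lower_ends_conj[OF w a] by (subst prod.reindex[OF inj]) simp
  \<comment> \<open>If \<open>a\<close> reverses the edge, its image has lower end
    \<open>a (w i)\<close>, and the sign of this reversal makes up for reading the image edge
    backwards.\<close>
  moreover have "osign (a i) (a (w i)) * osign (b (lower_image a w i)) (b (?w (lower_image a w i)))
      = osign (b (a i)) (b (a (w i)))" if i: "i \<in> ?L" for i
  proof (rule lower_image_cases[OF w i a])
    assume "a i < a (w i)" "lower_image a w i = a i"
    then show ?thesis
      using w'[of i] by (simp add: osign_less)
  next
    assume "a (w i) < a i" "lower_image a w i = a (w i)"
    then show ?thesis
      using w'[of "w i"] is_matchingD(2)[OF w] osign_swap[of "b (a i)"] by (simp add: osign_less)
  qed
  ultimately have orient: "(\<Prod>i\<in>?L. osign ((b \<circ> a) i) ((b \<circ> a) (w i)))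
      = (\<Prod>i\<in>?L. osign (a i) (a (w i))) * (\<Prod>i\<in>lower_ends n ?w. osign (b i) (b (?w i)))"
    by (simp add: prod.distrib[symmetric] cong: prod.cong)
  have "lower_image (b \<circ> a) w i = (lower_image b ?w \<circ> lower_image a w) i" if i: "i \<in> ?L" for i
  proof (rule lower_image_cases[OF w i a])
    assume "a i < a (w i)" "lower_image a w i = a i"
    then show ?thesis
      using w'[of i] by (simp add: lower_image_def)
  next
    assume "a (w i) < a i" "lower_image a w i = a (w i)"
    then show ?thesis
      using w'[of "w i"] is_matchingD(2)[OF w] by (simp add: lower_image_def min.commute)
  qed
  then have "inversion_sign (lower_image (b \<circ> a) w) ?L
      = inversion_sign (lower_image b ?w \<circ> lower_image a w) ?L"
    by (rule inversion_sign_cong)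
  also have "\<dots> = inversion_sign (lower_image a w) ?L * inversion_sign (lower_image b ?w) (lower_ends n ?w)"
    unfolding lower_ends_conj[OF w a] by (rule inversion_sign_comp[OF finite_lower_ends inj])
  finally show ?thesis
    unfolding match_sign_def orient by (simp only: ac_simps)
qed

lemma match_sign_fixed:
  assumes "\<And>i. i \<in> {1..n} \<Longrightarrow> g i = i" "is_matching n w"
  shows "match_sign n g w = 1"
proof -
  have "g i = i" "g (w i) = w i" "i < w i" if "i \<in> lower_ends n w" for i
    using that assms(1)[of i] assms(1)[of "w i"] is_matchingD(4)[OF assms(2)]
    by (auto simp: lower_ends_def)
  then show ?thesis
    unfolding match_sign_def by (simp add: inversion_sign_fixed lower_image_def osign_less)
qed

lemma lower_end_of:
  assumes "is_matching n w" "x \<in> {1..n}"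
  obtains a where "a \<in> lower_ends n w" "a = x \<and> w a = w x \<or> a = w x \<and> w a = x"
proof (cases "x < w x")
  case True
  then show ?thesis
    using that[of x] assms by (simp add: lower_ends_def)
next
  case False
  then show ?thesis
    using that[of "w x"] assms is_matchingD(2,3,4)[OF assms(1), of x] by (simp add: lower_ends_def)
qed

text \<open>Only this edge is reversed; the lower images are the lower ends themselves, so no
  inversion arises.\<close>

lemma match_sign_edge:
  assumes w: "is_matching n w" and x: "x \<in> {1..n}"
  shows "match_sign n (swap x (w x)) w = - 1"
proof -
  let ?g = "swap x (w x)"
  let ?L = "lower_ends n w"
  obtain a where a: "a \<in> ?L" "a = x \<and> w a = w x \<or> a = w x \<and> w a = x"
    using lower_end_of[OF w x] by blast
  have ga: "?g a = w a" "?g (w a) = a"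
    using a(2) by auto
  have other: "?g i = i" "?g (w i) = w i" if i: "i \<in> ?L" "i \<noteq> a" for i
  proof -
    have "w i \<noteq> a" "w a \<noteq> i" "w i \<noteq> w a"
      using lower_ends_disjoint[OF w] is_matchingD(5)[OF w] i a(1) by auto
    then show "?g i = i" "?g (w i) = w i"
      using a(2) i(2) by auto
  qed
  have lt: "i < w i" if "i \<in> ?L" for i
    using that by (simp add: lower_ends_def)
  have "lower_image ?g w i = i" if "i \<in> ?L" for i
    using lt[OF that] ga other[OF that] by (cases "i = a") (auto simp: lower_image_def)
  then have "inversion_sign (lower_image ?g w) ?L = 1"
    by (rule inversion_sign_fixed)
  moreover have "(\<Prod>i\<in>?L. osign (?g i) (?g (w i))) = (\<Prod>i\<in>?L. if i = a then - 1 else 1)"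
    using lt lt[OF a(1)] ga other by (intro prod.cong refl) (simp add: osign_less)
  ultimately show ?thesis
    using a(1) by (simp add: match_sign_def)
qed

text \<open>On lower ends the permutation acts as one transposition, while the two edges are either
  both kept in orientation or both reversed.\<close>

lemma match_sign_two_edges:
  assumes w: "is_matching n w" and x: "x \<in> {1..n}" and y: "y \<in> {1..n}" "y \<noteq> x" "y \<noteq> w x"
  shows "match_sign n (swap x y \<circ> swap (w x) (w y)) w = - 1"
proof -
  let ?g = "swap x y \<circ> swap (w x) (w y)"
  let ?L = "lower_ends n w"
  obtain a where a: "a \<in> ?L" "a = x \<and> w a = w x \<or> a = w x \<and> w a = x"
    using lower_end_of[OF w x] by blast
  obtain b where b: "b \<in> ?L" "b = y \<and> w b = w y \<or> b = w y \<and> w b = y"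
    using lower_end_of[OF w y(1)] by blast
  have ne: "x \<noteq> y" "x \<noteq> w x" "x \<noteq> w y" "y \<noteq> w x" "y \<noteq> w y" "w x \<noteq> w y"
    using y is_matchingD(3)[OF w x] is_matchingD(3)[OF w y(1)] is_matchingD(2,5)[OF w] by metis+
  have g: "?g x = y" "?g y = x" "?g (w x) = w y" "?g (w y) = w x"
    using ne by (auto simp: Transposition.transpose_def)
  have ab: "a \<noteq> b"
    using a(2) b(2) ne by auto
  \<comment> \<open>Lower ends go to lower ends, or each goes to the upper end of the other edge; in
    either case the two orientation signs agree.\<close>
  have gab: "?g a = b \<and> ?g (w a) = w b \<and> ?g b = a \<and> ?g (w b) = w a
      \<or> ?g a = w b \<and> ?g (w a) = b \<and> ?g b = w a \<and> ?g (w b) = a"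
    using a(2) b(2) g by metis
  have lt: "i < w i" if "i \<in> ?L" for i
    using that by (simp add: lower_ends_def)
  have other: "?g i = i" "?g (w i) = w i" if i: "i \<in> ?L" "i \<noteq> a" "i \<noteq> b" for i
  proof -
    have "i \<notin> {a, b, w a, w b}" "w i \<notin> {a, b, w a, w b}"
      using lower_ends_disjoint[OF w i(1) a(1)] lower_ends_disjoint[OF w a(1) i(1)]
        lower_ends_disjoint[OF w i(1) b(1)] lower_ends_disjoint[OF w b(1) i(1)]
        is_matchingD(5)[OF w, of i a] is_matchingD(5)[OF w, of i b] i(2,3) by simp_all
    moreover have "{a, b, w a, w b} = {x, y, w x, w y}"
      using a(2) b(2) by (elim disjE conjE) auto
    ultimately have "i \<notin> {x, y, w x, w y}" "w i \<notin> {x, y, w x, w y}"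
      by simp_all
    then show "?g i = i" "?g (w i) = w i"
      by (auto simp: Transposition.transpose_def)
  qed
  have "lower_image ?g w i = swap a b i" if i: "i \<in> ?L" for i
  proof -
    consider "i = a" | "i = b" | "i \<noteq> a" "i \<noteq> b"
      by blast
    then show ?thesis
    proof cases
      case 3
      then show ?thesis
        using other[OF i 3] lt[OF i] by (simp add: lower_image_def)
    qed (use gab lt[OF a(1)] lt[OF b(1)] in \<open>auto simp: lower_image_def\<close>)
  qed
  then have inv: "inversion_sign (lower_image ?g w) ?L = - 1"
    by (rule inversion_sign_swap[OF finite_lower_ends a(1) b(1) ab])
  define L' where "L' = ?L - {a, b}"
  have L: "?L = insert a (insert b L')" "a \<notin> insert b L'" "b \<notin> L'" "finite L'"
    using a(1) b(1) ab by (auto simp: L'_def)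
  have "(\<Prod>i\<in>L'. osign (?g i) (?g (w i))) = (\<Prod>i\<in>L'. 1)"
  proof (intro prod.cong refl)
    fix i assume "i \<in> L'"
    then have i: "i \<in> ?L" "i \<noteq> a" "i \<noteq> b"
      by (auto simp: L'_def)
    show "osign (?g i) (?g (w i)) = 1"
      unfolding other[OF i] by (rule osign_less(1)[OF lt[OF i(1)]])
  qed
  moreover have "osign (?g a) (?g (w a)) * osign (?g b) (?g (w b)) = 1"
    using gab lt[OF a(1)] lt[OF b(1)] by (auto simp: osign_less)
  ultimately have "(\<Prod>i\<in>?L. osign (?g i) (?g (w i))) = 1"
    unfolding L(1) using L(2-4) by (simp add: mult.assoc[symmetric] del: comp_apply)
  then show ?thesis
    by (simp add: match_sign_def inv)
qed

section \<open>The representation on matchings\<close>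

lemma prod_if_neg_one:
  "finite A \<Longrightarrow> (\<Prod>x\<in>A. if P x then - 1 else 1) = (- 1 :: int) ^ card {x\<in>A. P x}"
  by (simp add: prod.inter_filter[symmetric])

lemma pair_less_lower_ends:
  assumes i: "i \<in> lower_ends n w" and k: "k \<in> lower_ends n w"
  shows "pair_less (i, w i) (k, w k) \<longleftrightarrow> i < k"
  using i k by (auto simp: pair_less_def sort_pair_def lower_ends_def)

lemma pair_less_lower_image:
  assumes w: "is_matching n w" and i: "i \<in> lower_ends n w" and k: "k \<in> lower_ends n w"
    and g: "g permutes {1..n}"
  shows "pair_less (g i, g (w i)) (g k, g (w k)) \<longleftrightarrow> lower_image g w i < lower_image g w k"
  using lower_image_eq_iff[OF assms] by (auto simp: pair_less_def sort_pair_def lower_image_def)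

lemma i1_sign:
  assumes w: "is_matching n w" and g: "g permutes {1..n}"
  shows "(\<Prod>i\<in>lower_ends n w. osign (g i) (g (w i))) = (- 1) ^ i1 n g w"
proof -
  have "osign (g i) (g (w i)) = (if g (w i) < g i then - 1 else 1)" if "i \<in> lower_ends n w" for i
    by (rule lower_image_cases[OF w that g]) (auto simp: osign_less)
  then have "(\<Prod>i\<in>lower_ends n w. osign (g i) (g (w i)))
      = (- 1) ^ card {i\<in>lower_ends n w. g (w i) < g i}"
    by (simp add: prod_if_neg_one cong: prod.cong)
  also have "card {i\<in>lower_ends n w. g (w i) < g i}
      = card {(i, j). i \<in> {1..n} \<and> j \<in> {1..n} \<and> i < j \<and> w i = j \<and> g i > g j}"
  proof (rule bij_betw_same_card)
    show "bij_betw (\<lambda>i. (i, w i)) {i\<in>lower_ends n w. g (w i) < g i}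
        {(i, j). i \<in> {1..n} \<and> j \<in> {1..n} \<and> i < j \<and> w i = j \<and> g i > g j}"
    proof (rule bij_betwI[where g = fst])
      show "(\<lambda>i. (i, w i)) \<in> {i\<in>lower_ends n w. g (w i) < g i}
          \<rightarrow> {(i, j). i \<in> {1..n} \<and> j \<in> {1..n} \<and> i < j \<and> w i = j \<and> g i > g j}"
      proof
        fix i assume "i \<in> {i\<in>lower_ends n w. g (w i) < g i}"
        then show "(i, w i) \<in> {(i, j). i \<in> {1..n} \<and> j \<in> {1..n} \<and> i < j \<and> w i = j \<and> g i > g j}"
          using is_matchingD(4)[OF w, of i] by (simp add: lower_ends_def)
      qed
    qed (auto simp: lower_ends_def)
  qed
  finally show ?thesis
    by (simp add: i1_def)
qed

text \<open>Pairs of edges correspond to pairs of lower ends, which links the counting form of the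
  sign in \<open>rho2\<close> with the form for which the cocycle identity is proved.\<close>

lemma i2_sign:
  assumes w: "is_matching n w" and g: "g permutes {1..n}"
  shows "(- 1) ^ i2 n g w = match_sign n g w"
proof -
  let ?L = "lower_ends n w" and ?m = "lower_image g w"
  let ?A = "{(i, k). i \<in> ?L \<and> k \<in> ?L \<and> i < k}"
  have pair: "osign i k * osign (?m i) (?m k) = (if ?m k < ?m i then - 1 else 1)"
    if "i \<in> ?L" "k \<in> ?L" "i < k" for i k
    using that lower_image_eq_iff[OF w that(1,2) g] by (auto simp: osign_less not_less_iff_gr_or_eq)
  have "inversion_sign ?m ?L = (\<Prod>z\<in>?A. if ?m (snd z) < ?m (fst z) then - 1 else 1)"
    unfolding inversion_sign_def pair_prod_def by (rule prod.cong) (auto simp: pair)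
  also have "\<dots> = (- 1) ^ card {z\<in>?A. ?m (snd z) < ?m (fst z)}"
    by (rule prod_if_neg_one[OF finite_pairs[OF finite_lower_ends]])
  also have "card {z\<in>?A. ?m (snd z) < ?m (fst z)} = card {((i, j), (k, l)).
      i \<in> {1..n} \<and> j \<in> {1..n} \<and> k \<in> {1..n} \<and> l \<in> {1..n} \<and>
      pair_less (i, j) (k, l) \<and> i < j \<and> k < l \<and> w i = j \<and> w k = l \<and>
      pair_less (g k, g l) (g i, g j)}" (is "_ = card ?B")
  proof (rule bij_betw_same_card)
    show "bij_betw (\<lambda>(i, k). ((i, w i), (k, w k))) {z\<in>?A. ?m (snd z) < ?m (fst z)} ?B"
    proof (rule bij_betwI[where g = "\<lambda>((i, j), (k, l)). (i, k)"])
      show "(\<lambda>(i, k). ((i, w i), (k, w k))) \<in> {z\<in>?A. ?m (snd z) < ?m (fst z)} \<rightarrow> ?B"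
      proof
        fix z assume "z \<in> {z\<in>?A. ?m (snd z) < ?m (fst z)}"
        then obtain i k where z: "z = (i, k)" "i \<in> ?L" "k \<in> ?L" "i < k" "?m k < ?m i"
          by auto
        then show "(case z of (i, k) \<Rightarrow> ((i, w i), (k, w k))) \<in> ?B"
          using pair_less_lower_ends[OF z(2,3)] pair_less_lower_image[OF w z(3,2) g]
            is_matchingD(4)[OF w, of i] is_matchingD(4)[OF w, of k] by (simp add: lower_ends_def)
      qed
      show "(\<lambda>((i, j), (k, l)). (i, k)) \<in> ?B \<rightarrow> {z\<in>?A. ?m (snd z) < ?m (fst z)}"
      proof
        fix z assume "z \<in> ?B"
        then obtain i k where z: "z = ((i, w i), (k, w k))" "i \<in> ?L" "k \<in> ?L"
          "pair_less (i, w i) (k, w k)" "pair_less (g k, g (w k)) (g i, g (w i))"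
          by (auto simp: lower_ends_def)
        then show "(\<lambda>((i, j), (k, l)). (i, k)) z \<in> {z\<in>?A. ?m (snd z) < ?m (fst z)}"
          using pair_less_lower_ends[OF z(2,3)] pair_less_lower_image[OF w z(3,2) g] by simp
      qed
    qed auto
  qed
  finally show ?thesis
    unfolding match_sign_def i1_sign[OF w g] i2_def power_add by simp
qed

lemma match_sign_sq:
  assumes w: "is_matching n w" and g: "g permutes {1..n}"
  shows "match_sign n g w * match_sign n g w = 1"
  unfolding i2_sign[OF assms, symmetric] by (simp flip: power_mult_distrib)

text \<open>
  The action of \<open>rho2\<close>, extended to all functions by the identity outside the matchings.
\<close>

definition match_act :: "nat \<Rightarrow> (nat \<Rightarrow> nat) \<Rightarrow> ((nat \<Rightarrow> nat) \<Rightarrow> complex) \<Rightarrow> ((nat \<Rightarrow> nat) \<Rightarrow> complex)" where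
  "match_act n g f w =
     (if is_matching n w then of_int (match_sign n (inv' g) w) * f (inv' g \<circ> w \<circ> g) else f w)"

locale matching_rep =
  fixes n :: nat

sublocale matching_rep \<subseteq> perm_action n "match_act n"
proof
  fix g h :: "nat \<Rightarrow> nat" and v :: "(nat \<Rightarrow> nat) \<Rightarrow> complex"
  show "match_act n id v = v"
    by (simp add: fun_eq_iff match_act_def match_sign_fixed flip: id_def)
  assume g: "g permutes {1..n}" and h: "h permutes {1..n}"
  note gi = permutes_inv[OF g]
  note hi = permutes_inv[OF h]
  show "match_act n (g \<circ> h) v = match_act n g (match_act n h v)"
  proof
    fix w
    show "match_act n (g \<circ> h) v w = match_act n g (match_act n h v) w"
    proof (cases "is_matching n w")
      case True
      have inv: "inv' (g \<circ> h) = inv' h \<circ> inv' g"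
        by (rule o_inv_distrib[OF permutes_bij[OF g] permutes_bij[OF h]])
      \<comment> \<open>The cocycle identity for \<open>inv' g\<close> followed by
        \<open>inv' h\<close>: the second factor is taken at the conjugated matching, exactly where
        \<open>match_act n h\<close> is evaluated.\<close>
      have "match_sign n (inv' h \<circ> inv' g) w
          = match_sign n (inv' g) w * match_sign n (inv' h) (inv' g \<circ> w \<circ> g)"
        using match_sign_comp[OF True gi hi] by (simp only: permutes_inv_inv[OF g])
      moreover have "is_matching n (inv' g \<circ> w \<circ> g)"
        using is_matching_conj[OF True gi] by (simp only: permutes_inv_inv[OF g])
      ultimately show ?thesis
        using True unfolding match_act_def inv by (simp add: o_assoc)
    qed (simp add: match_act_def)
  qed
qed (auto simp: fun_eq_iff match_act_def fscale_def algebra_simps)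

context matching_rep
begin

abbreviation act where "act \<equiv> match_act n"

definition F :: "((nat \<Rightarrow> nat) \<Rightarrow> complex) set" where
  "F = functions_on (fpf_involutions n)"

lemma F_iff: "f \<in> F \<longleftrightarrow> (\<forall>w. \<not> is_matching n w \<longrightarrow> f w = 0)"
  by (simp add: F_def functions_on_def fpf_involutions_iff)

lemma invariant_F: "invariant F"
  unfolding invariant_def
proof (intro conjI allI impI)
  show "cfun.subspace F"
    by (rule cfun.subspaceI) (auto simp: F_iff fscale_def)
  show "act g u \<in> F" if "u \<in> F" for g u
    using that by (auto simp: F_iff match_act_def)
qed

lemma rho2_act:
  assumes "g permutes {1..n}" "f \<in> F"
  shows "rep_act (rho2 n) g f = act g f"
proof
  fix w
  have g: "g \<in> carrier (sym_group n)"
    using assms(1) by (simp add: sym_group_carrier)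
  show "rep_act (rho2 n) g f w = act g f w"
  proof (cases "is_matching n w")
    case True
    have "of_int (match_sign n (inv' g) w) = (- 1 :: complex) ^ i2 n (inv' g) w"
      unfolding i2_sign[OF True permutes_inv[OF assms(1)], symmetric] by simp
    then show ?thesis
      using True by (simp add: rho2_def match_act_def fpf_involutions_iff sym_group_inv_equality[OF g])
  qed (use assms(2) in \<open>simp add: rho2_def match_act_def fpf_involutions_iff F_iff\<close>)
qed

section \<open>Values at a single matching and the resulting graphs\<close>

lemma finite_matchings: "finite {w. is_matching n w}"
  by (rule finite_subset[OF _ finite_permutations[of "{1..n}"]]) (auto simp: is_matching_def)

lemma act_fixed_matching:
  assumes w: "is_matching n w" and g: "\<And>x. g (g x) = x" "\<And>x. g (w x) = w (g x)"
  shows "act g f w = of_int (match_sign n g w) * f w"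
proof -
  have "inv' g = g"
    by (rule inv_equality) (use g in auto)
  moreover have "g \<circ> w \<circ> g = w"
    by (auto simp: fun_eq_iff g)
  ultimately show ?thesis
    using w unfolding match_act_def by simp
qed

lemma swp_edge:
  assumes w: "is_matching n w" and x: "x \<in> {1..n}"
  shows "swp x (w x) f w = - f w"
proof -
  have "swap x (w x) (w y) = w (swap x (w x) y)" for y
    using is_matchingD(2)[OF w, of y] is_matchingD(2)[OF w, of x]
    by (cases "y = x"; cases "y = w x") (auto simp: Transposition.transpose_def)
  then show ?thesis
    using act_fixed_matching[OF w, of "swap x (w x)" f] match_sign_edge[OF assms] by simp
qed

lemma swp_two_edges:
  assumes w: "is_matching n w" and x: "x \<in> {1..n}" and y: "y \<in> {1..n}" "y \<noteq> x" "y \<noteq> w x"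
  shows "swp x y (swp (w x) (w y) f) w = - f w"
proof -
  let ?g = "swap x y \<circ> swap (w x) (w y)"
  have ne: "x \<noteq> y" "x \<noteq> w x" "x \<noteq> w y" "y \<noteq> w x" "y \<noteq> w y" "w x \<noteq> w y"
    using y is_matchingD(3)[OF w x] is_matchingD(3)[OF w y(1)] is_matchingD(2,5)[OF w] by metis+
  have g: "?g x = y" "?g y = x" "?g (w x) = w y" "?g (w y) = w x"
    using ne by (auto simp: Transposition.transpose_def)
  have other: "?g z = z" if "z \<notin> {x, y, w x, w y}" for z
    using that by (auto simp: Transposition.transpose_def)
  have gg: "?g (?g z) = z" for z
    using g other[of z] by (cases "z \<in> {x, y, w x, w y}") (auto simp del: comp_apply)
  have gw: "?g (w z) = w (?g z)" for z
  proof (cases "z \<in> {x, y, w x, w y}")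
    case True
    then show ?thesis
      using g is_matchingD(2)[OF w] by (auto simp del: comp_apply)
  next
    case False
    then have "w z \<notin> {x, y, w x, w y}"
      using is_matchingD(2)[OF w] by (metis insert_iff singletonD)
    then show ?thesis
      using other False by metis
  qed
  have wxy: "w x \<in> {1..n}" "w y \<in> {1..n}"
    using is_matchingD(4)[OF w] x y by blast+
  have eq1: "swp x y (swp (w x) (w y) f) = act ?g f"
    by (rule act_comp[OF swap_permutes[OF x y(1)] swap_permutes[OF wxy], symmetric])
  have eq2: "act ?g f w = of_int (match_sign n ?g w) * f w"
    by (rule act_fixed_matching[OF w gg gw])
  show ?thesis
    unfolding eq1 eq2 match_sign_two_edges[OF assms] by simp
qed

lemma sym_vec_simple_matching:
  assumes f: "sym_vec c f" and w: "is_matching n w" and nz: "f w \<noteq> 0"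
  shows "simple_matching n c w"
proof -
  have w_in: "w x \<in> {1..n}" if "x \<in> {1..n}" for x
    using that is_matchingD(4)[OF w] by blast
  have no_loop: "c (w x) \<noteq> c x" if x: "x \<in> {1..n}" for x
  proof
    assume "c (w x) = c x"
    then have "swp x (w x) f = f"
      using sym_vecD[OF f x w_in[OF x]] by simp
    then show False
      using swp_edge[OF w x, of f] nz by simp
  qed
  have "inj_on (\<lambda>x. (c x, c (w x))) {1..n}"
  proof (rule inj_onI, rule ccontr)
    fix x y assume x: "x \<in> {1..n}" and y: "y \<in> {1..n}" and eq: "(c x, c (w x)) = (c y, c (w y))"
      and ne: "x \<noteq> y"
    \<comment> \<open>If \<open>x\<close> and \<open>y\<close> were partners, their edge would lie
      inside a class, which is already excluded.\<close>
    have "y \<noteq> w x"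
      using eq no_loop[OF x] by auto
    moreover have "swp x y (swp (w x) (w y) f) = f"
      using sym_vecD[OF f x y] sym_vecD[OF f w_in[OF x] w_in[OF y]] eq by simp
    ultimately show False
      using swp_two_edges[OF w x y, of f] nz ne by simp
  qed
  then show ?thesis
    using no_loop by (simp add: simple_matching_def)
qed

text \<open>Exchanging two edges with equal colours costs two minus signs from the stabiliser but
  only one from the cocycle. A single edge inside a class gives -1 on both sides and is no
  contradiction.\<close>

lemma alt_vec_loop_matching:
  assumes f: "alt_vec c f" and w: "is_matching n w" and nz: "f w \<noteq> 0"
  shows "loop_matching n c w"
  unfolding loop_matching_def
proof (intro ballI impI, rule ccontr)
  fix x y assume x: "x \<in> {1..n}" and y: "y \<in> {1..n}" and eq: "c x = c y \<and> c (w x) = c (w y)"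
    and ne: "\<not> (y = x \<or> y = w x)"
  have w_in: "w x \<in> {1..n}" "w y \<in> {1..n}"
    using x y is_matchingD(4)[OF w] by blast+
  have wne: "w x \<noteq> w y"
    using ne is_matchingD(5)[OF w] by metis
  have "swp x y (swp (w x) (w y) f) = swp x y (- f)"
    using alt_vecD[OF f w_in wne] eq by simp
  also have "\<dots> = f"
    using alt_vecD[OF f x y] eq ne by (simp only: act_neg minus_minus) auto
  finally show False
    using swp_two_edges[OF w x y, of f] nz ne by simp
qed

lemma nonzero_in_F:
  assumes "f \<in> F" "f \<noteq> 0"
  obtains w where "is_matching n w" "f w \<noteq> 0"
proof -
  obtain w where "f w \<noteq> 0"
    using assms(2) by (auto simp: fun_eq_iff)
  then show ?thesis
    using assms(1) that by (auto simp: F_iff)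
qed

text \<open>Any two matchings in the supports have the same set of colour pairs, so an element of
  the colour stabiliser carries one to the other. A fixed vector is thus determined by its value at
  \<open>w0\<close>.\<close>

lemma sym_vec_unique:
  assumes f: "f \<in> F" "sym_vec c f" and f': "f' \<in> F" "sym_vec c f'" "f' \<noteq> 0"
    and c: "shape n c p" and t: "threshold_pair p q"
  obtains a where "f = fscale a f'"
proof -
  obtain w0 where w0: "is_matching n w0" "f' w0 \<noteq> 0"
    using nonzero_in_F[OF f'(1,3)] by blast
  have s0: "simple_matching n c w0"
    by (rule sym_vec_simple_matching[OF f'(2) w0])
  \<comment> \<open>The factor is a sign depending only on the permutation from \<open>w0\<close> to
    \<open>w\<close>, hence the same for \<open>f\<close> and \<open>f'\<close>.\<close>
  have "\<exists>\<sigma>. f w = \<sigma> * f w0 \<and> f' w = \<sigma> * f' w0" for w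
  proof (cases "is_matching n w \<and> (f w \<noteq> 0 \<or> f' w \<noteq> 0)")
    case True
    then have w: "is_matching n w" and s: "simple_matching n c w"
      using sym_vec_simple_matching[OF f(2), of w] sym_vec_simple_matching[OF f'(2), of w] by auto
    note bij = simple_matching_half_edges[OF is_matchingD(1,2) _ t c]
    obtain h where h: "h permutes {1..n}"
      and hx: "\<And>x. x \<in> {1..n} \<Longrightarrow> (c (h x), c (w (h x))) = (c x, c (w0 x))"
      using relabelling_permutation[OF bij[OF w0(1) w0(1) s0] bij[OF w w s]] by metis
    have h_in: "h x \<in> {1..n}" if "x \<in> {1..n}" for x
      using that permutes_in_image[OF h] by blast
    have "c (h x) = c x" for x
      using hx[of x] permutes_not_in[OF h, of x] by (cases "x \<in> {1..n}") auto
    then have stab: "h \<in> colour_stab c"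
      using h by (simp add: colour_stab_def)
    \<comment> \<open>Both points carry the same colour pair, and colour pairs separate the points
      of a simple matching.\<close>
    have hw: "h (w0 x) = w (h x)" for x
    proof (cases "x \<in> {1..n}")
      case True
      have in_n: "w0 x \<in> {1..n}" "h (w0 x) \<in> {1..n}" "w (h x) \<in> {1..n}"
        using True h_in is_matchingD(4)[OF w0(1)] is_matchingD(4)[OF w] by metis+
      have "(c (h (w0 x)), c (w (h (w0 x)))) = (c (w (h x)), c (w (w (h x))))"
        using hx[OF True] hx[OF in_n(1)] is_matchingD(2)[OF w0(1)] is_matchingD(2)[OF w] by simp
      then show ?thesis
        using s inj_onD[of "\<lambda>x. (c x, c (w x))" "{1..n}", OF _ _ in_n(2,3)]
        unfolding simple_matching_def by blast
    next
      case False
      then show ?thesis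
        using permutes_not_in[OF h False] permutes_not_in[OF is_matchingD(1)[OF w] False]
          permutes_not_in[OF is_matchingD(1)[OF w0(1)] False] by simp
    qed
    have conj: "inv' h \<circ> w \<circ> h = w0"
      by (auto simp: fun_eq_iff hw[symmetric] permutes_inverses[OF h])
    have "e w = of_int (match_sign n (inv' h) w) * e w0" if "sym_vec c e" for e
    proof -
      have "e w = act h e w"
        using sym_vec_stab[OF that stab] by simp
      then show ?thesis
        using w conj by (simp add: match_act_def)
    qed
    then show ?thesis
      using f(2) f'(2) by blast
  next
    case False
    then have "f w = 0" "f' w = 0"
      using f(1) f'(1) by (auto simp: F_iff)
    then show ?thesis
      by (intro exI[of _ 0]) simp
  qed
  then have "f w = f w0 / f' w0 * f' w" for w
    using w0(2) by (metis mult.assoc mult.commute nonzero_eq_divide_eq times_divide_eq_left)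
  then have "f = fscale (f w0 / f' w0) f'"
    unfolding fscale_def by (rule ext)
  then show ?thesis
    by (rule that)
qed

text \<open>Averaging the indicator function of a simple matching over the colour stabiliser cannot
  cancel at that matching: only the identity preserves both colours and matching, since the
  half-edges have distinct colour pairs.\<close>

lemma sym_vec_exists:
  assumes t: "threshold_pair p q" and s: "shape n c' p"
  obtains c v where "shape n c p" "v \<in> F" "v \<noteq> 0" "sym_vec c v"
proof -
  obtain c w where c: "shape n c p" and w: "w permutes {1..n}" "\<And>x. w (w x) = x"
    and simple: "simple_matching n c w"
    using simple_matching_exists[OF t s] by metis
  have m: "is_matching n w"
    using w simple by (auto simp: is_matching_def simple_matching_def)
  define \<delta> :: "(nat \<Rightarrow> nat) \<Rightarrow> complex" where "\<delta> = (\<lambda>w'. if w' = w then 1 else 0)"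
  define v where "v = (\<Sum>g\<in>colour_stab c. act g \<delta>)"
  have delta: "\<delta> \<in> F"
    using m by (auto simp: F_iff \<delta>_def)
  have vF: "v \<in> F"
    unfolding v_def using delta
    by (intro cfun.subspace_sum invariantD[OF invariant_F]) (auto simp: colour_stab_def)
  have id: "id \<in> colour_stab c"
    by (simp add: colour_stab_def permutes_id)
  have zero: "act g \<delta> w = 0" if g: "g \<in> colour_stab c - {id}" for g
  proof -
    have gp: "g permutes {1..n}" and cg: "\<And>x. c (g x) = c x"
      using g by (auto simp: colour_stab_def)
    have "inv' g \<circ> w \<circ> g \<noteq> w"
    proof
      assume eq: "inv' g \<circ> w \<circ> g = w"
      have wg: "w (g x) = g (w x)" for x
        using fun_cong[OF eq, of x] permutes_inverses(1)[OF gp, of "w (g x)"] by simp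
      have "g x = x" for x
      proof (cases "x \<in> {1..n}")
        case True
        have "g x \<in> {1..n}"
          using True permutes_in_image[OF gp] by blast
        moreover have "(c (g x), c (w (g x))) = (c x, c (w x))"
          by (simp add: wg cg)
        ultimately show ?thesis
          using simple True inj_onD[of "\<lambda>x. (c x, c (w x))" "{1..n}" "g x" x]
          unfolding simple_matching_def by blast
      qed (use permutes_not_in[OF gp] in blast)
      then show False
        using g by auto
    qed
    then show ?thesis
      using m by (simp add: match_act_def \<delta>_def)
  qed
  have "v w = act id \<delta> w + (\<Sum>g\<in>colour_stab c - {id}. act g \<delta> w)"
    unfolding v_def sum_fun_apply by (rule sum.remove[OF finite_colour_stab id])
  also have "\<dots> = 1"
    using zero by (simp only: act_id sum.neutral_const cong: sum.cong) (simp add: \<delta>_def)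
  finally have "v \<noteq> 0"
    by auto
  then show ?thesis
    using that[OF c vF] sym_vec_sum_stab unfolding v_def by blast
qed

end

lemma shape_exists:
  assumes l: "is_partition n l"
  obtains c where "shape n c (part l)"
proof -
  let ?D = "Sigma {1..length l} (\<lambda>i. {1..part l i})"
  have "card ?D = (\<Sum>i=1..length l. part l i)"
    by (subst card_SigmaI) auto
  also have "\<dots> = card {1..n}"
    using l unfolding sum_part is_partition_def by simp
  finally obtain h where h: "bij_betw h {1..n} ?D"
    using finite_same_card_bij[of "{1..n}" ?D] by auto
  have "shape n (\<lambda>x. fst (h x)) (part l)"
    unfolding shape_def
  proof
    fix i
    have "h ` {x\<in>{1..n}. fst (h x) = i} = {e\<in>h ` {1..n}. fst e = i}"
      by auto
    then have "bij_betw h {x\<in>{1..n}. fst (h x) = i} {e\<in>?D. fst e = i}"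
      unfolding bij_betw_imp_surj_on[OF h] by (intro bij_betw_subset[OF h]) auto
    then have "card {x\<in>{1..n}. fst (h x) = i} = card {e\<in>?D. fst e = i}"
      by (rule bij_betw_same_card)
    also have "{e\<in>?D. fst e = i} = Pair i ` {1..part l i}"
      by (auto simp: part_def split: if_splits)
    also have "card \<dots> = part l i"
      by (simp add: card_image inj_on_def)
    finally show "card {x\<in>{1..n}. fst (h x) = i} = part l i" .
  qed
  then show ?thesis
    by (rule that)
qed

section \<open>Translates of vectors and the subspaces they generate\<close>

context perm_action
begin

lemma sym_vec_act:
  assumes g: "g permutes {1..n}" and v: "sym_vec c v"
  shows "sym_vec (c \<circ> inv' g) (act g v)"
  unfolding sym_vec_def
proof (intro ballI impI)
  fix x y assume xy: "x \<in> {1..n}" "y \<in> {1..n}" "(c \<circ> inv' g) x = (c \<circ> inv' g) y"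
  have in_n: "inv' g x \<in> {1..n}" "inv' g y \<in> {1..n}"
    using xy permutes_in_image[OF permutes_inv[OF g]] by blast+
  have "act g (swp (inv' g x) (inv' g y) v) = swp (g (inv' g x)) (g (inv' g y)) (act g v)"
    by (rule act_swp[OF g in_n])
  then show "swp x y (act g v) = act g v"
    using sym_vecD[OF v in_n] xy(3) by (simp add: permutes_inverses[OF g])
qed

lemma sym_vec_cong: "(\<And>x. x \<in> {1..n} \<Longrightarrow> c x = c' x) \<Longrightarrow> sym_vec c v \<Longrightarrow> sym_vec c' v"
  by (simp add: sym_vec_def)

definition orbit_span :: "('x \<Rightarrow> complex) \<Rightarrow> ('x \<Rightarrow> complex) set" where
  "orbit_span v = cfun.span ((\<lambda>g. act g v) ` {g. g permutes {1..n}})"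

lemma orbit_span_base: "g permutes {1..n} \<Longrightarrow> act g v \<in> orbit_span v"
  unfolding orbit_span_def by (rule cfun.span_base) blast

lemma orbit_span_self: "v \<in> orbit_span v"
  using orbit_span_base[OF permutes_id, of v] by (simp only: act_id)

lemma orbit_span_least:
  assumes "invariant W" "v \<in> W"
  shows "orbit_span v \<subseteq> W"
  unfolding orbit_span_def
  by (rule cfun.span_minimal) (use assms invariantD[OF assms(1)] in auto)

lemma invariant_orbit_span: "invariant (orbit_span v)"
  unfolding invariant_def
proof (intro conjI allI impI)
  show sub: "cfun.subspace (orbit_span v)"
    unfolding orbit_span_def by simp
  fix g u assume g: "g permutes {1..n}" and u: "u \<in> orbit_span v"
  have "cfun.span ((\<lambda>g. act g v) ` {g. g permutes {1..n}}) \<subseteq> {u. act g u \<in> orbit_span v}"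
  proof (rule cfun.span_minimal)
    show "(\<lambda>g. act g v) ` {g. g permutes {1..n}} \<subseteq> {u. act g u \<in> orbit_span v}"
    proof (rule image_subsetI)
      fix h assume "h \<in> {g. g permutes {1..n}}"
      then show "act h v \<in> {u. act g u \<in> orbit_span v}"
        using orbit_span_base[OF permutes_compose[OF _ g]] by (simp only: mem_Collect_eq act_comp[OF g])
    qed
    show "cfun.subspace {u. act g u \<in> orbit_span v}"
      using sub by (auto intro!: cfun.subspaceI
        simp: act_add act_scale cfun.subspace_add cfun.subspace_scale cfun.subspace_0)
  qed
  then show "act g u \<in> orbit_span v"
    using u unfolding orbit_span_def[of v] by blast
qed

end

section \<open>Decomposition into irreducible subrepresentations\<close>

context matching_rep
begin

section \<open>The invariant inner product and frame operators\<close>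

definition ip :: "((nat \<Rightarrow> nat) \<Rightarrow> complex) \<Rightarrow> ((nat \<Rightarrow> nat) \<Rightarrow> complex) \<Rightarrow> complex" where
  "ip u v = (\<Sum>w | is_matching n w. u w * cnj (v w))"

lemma ip_add: "ip (u + u') v = ip u v + ip u' v"
  by (simp add: ip_def algebra_simps sum.distrib)

lemma ip_scale: "ip (fscale a u) v = a * ip u v"
  by (simp add: ip_def fscale_def sum_distrib_left mult.assoc)

lemma ip_zero [simp]: "ip 0 v = 0"
  by (simp add: ip_def)

lemma ip_neg: "ip (- u) v = - ip u v"
  by (simp add: ip_def sum_negf)

lemma ip_sum: "ip (\<Sum>i\<in>I. f i) v = (\<Sum>i\<in>I. ip (f i) v)"
proof (induction I rule: infinite_finite_induct)
  case (insert x I)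
  then show ?case
    by (simp only: sum.insert ip_add not_False_eq_True)
qed (simp_all only: sum.infinite sum.empty ip_zero not_False_eq_True)

lemma ip_cnj: "ip u v = cnj (ip v u)"
  by (simp add: ip_def mult.commute)

lemma ip_self_pos:
  assumes "v \<in> F" "v \<noteq> 0"
  shows "ip v v \<noteq> 0"
proof -
  obtain w where w: "is_matching n w" "v w \<noteq> 0"
    using nonzero_in_F[OF assms] by blast
  have "ip v v = of_real (\<Sum>w | is_matching n w. (cmod (v w))\<^sup>2)"
    by (simp only: ip_def of_real_sum complex_norm_square)
  moreover have "(\<Sum>w | is_matching n w. (cmod (v w))\<^sup>2) > 0"
    by (rule sum_pos2[OF finite_matchings, of w]) (use w in auto)
  ultimately show ?thesis
    by (metis less_irrefl of_real_eq_0_iff)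
qed

lemma ip_act:
  assumes g: "g permutes {1..n}"
  shows "ip (act g u) (act g v) = ip u v"
proof -
  let ?M = "{w. is_matching n w}"
  have gi: "inv' g permutes {1..n}"
    by (rule permutes_inv[OF g])
  have conj: "is_matching n (inv' g \<circ> w \<circ> g)" "is_matching n (g \<circ> w \<circ> inv' g)"
    if "is_matching n w" for w
    using is_matching_conj[OF that gi] is_matching_conj[OF that g] by (simp_all only: permutes_inv_inv[OF g])
  have bij: "bij_betw (\<lambda>w. inv' g \<circ> w \<circ> g) ?M ?M"
    by (rule bij_betwI[where g = "\<lambda>w. g \<circ> w \<circ> inv' g"])
      (use conj in \<open>auto simp: fun_eq_iff permutes_inverses[OF g]\<close>)
  have "ip (act g u) (act g v) = (\<Sum>w\<in>?M. u (inv' g \<circ> w \<circ> g) * cnj (v (inv' g \<circ> w \<circ> g)))"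
    unfolding ip_def
  proof (intro sum.cong refl)
    fix w assume "w \<in> ?M"
    then have w: "is_matching n w"
      by simp
    have sq: "of_int (match_sign n (inv' g) w) * of_int (match_sign n (inv' g) w) = (1 :: complex)"
      unfolding of_int_mult[symmetric] match_sign_sq[OF w gi] by simp
    have "s * a * cnj (s * b) = a * cnj b" if "s * s = 1" "cnj s = s" for s a b :: complex
    proof -
      have "s * a * cnj (s * b) = (s * s) * (a * cnj b)"
        by (simp only: complex_cnj_mult that(2) ac_simps)
      then show ?thesis
        by (simp only: that(1) mult_1_left)
    qed
    from this[OF sq] show "act g u w * cnj (act g v w) = u (inv' g \<circ> w \<circ> g) * cnj (v (inv' g \<circ> w \<circ> g))"
      using w by (simp add: match_act_def)
  qed
  also have "\<dots> = ip u v"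
    unfolding ip_def by (rule sum.reindex_bij_betw[OF bij, of "\<lambda>w. u w * cnj (v w)"])
  finally show ?thesis .
qed

lemma ip_act_left: "g permutes {1..n} \<Longrightarrow> ip (act g u) v = ip u (act (inv' g) v)"
  using ip_act[of g u "act (inv' g) v"] by (simp only: act_inv)

text \<open>The frame operator of the orbit of \<open>v\<close>. It is equivariant, takes values in
  the span of the orbit and kills exactly the vectors orthogonal to the orbit; up to a scalar it
  will be the orthogonal projection onto \<open>U l\<close>.\<close>

definition frame :: "((nat \<Rightarrow> nat) \<Rightarrow> complex) \<Rightarrow> ((nat \<Rightarrow> nat) \<Rightarrow> complex) \<Rightarrow> ((nat \<Rightarrow> nat) \<Rightarrow> complex)" where
  "frame v f = (\<Sum>g | g permutes {1..n}. fscale (ip f (act g v)) (act g v))"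

lemma frame_in: "frame v f \<in> orbit_span v"
  unfolding frame_def using invariantD(1)[OF invariant_orbit_span]
  by (intro cfun.subspace_sum cfun.subspace_scale orbit_span_base) auto

lemma frame_add: "frame v (f + f') = frame v f + frame v f'"
  by (simp only: frame_def ip_add cfun.scale_left_distrib sum.distrib)

lemma frame_scale: "frame v (fscale a f) = fscale a (frame v f)"
  by (simp only: frame_def ip_scale cfun.scale_scale[symmetric] cfun.scale_sum_right)

lemma frame_zero: "frame v 0 = 0"
  using frame_scale[of v 0 0] by simp

lemma frame_diff: "frame v (f - f') = frame v f - frame v f'"
  using frame_add[of v "f - f'" f'] by (simp only: diff_add_cancel eq_diff_eq)

lemma frame_sum: "frame v (\<Sum>i\<in>I. f i) = (\<Sum>i\<in>I. frame v (f i))"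
proof (induction I rule: infinite_finite_induct)
  case (insert x I)
  then show ?case
    by (simp only: sum.insert frame_add not_False_eq_True)
qed (simp_all only: sum.infinite sum.empty frame_zero not_False_eq_True)

lemma frame_act:
  assumes h: "h permutes {1..n}"
  shows "frame v (act h f) = act h (frame v f)"
proof -
  have "frame v (act h f) = (\<Sum>g | g permutes {1..n}. fscale (ip (act h f) (act (h \<circ> g) v)) (act (h \<circ> g) v))"
    unfolding frame_def by (rule setum_permutations_compose_left[OF h])
  also have "\<dots> = (\<Sum>g | g permutes {1..n}. fscale (ip f (act g v)) (act h (act g v)))"
    by (intro sum.cong refl) (simp only: mem_Collect_eq act_comp[OF h] ip_act[OF h])
  also have "\<dots> = act h (frame v f)"
    by (simp only: frame_def act_sum act_scale)
  finally show ?thesis .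
qed

lemma frame_eq_0I: "(\<And>g. g permutes {1..n} \<Longrightarrow> ip f (act g v) = 0) \<Longrightarrow> frame v f = 0"
  unfolding frame_def by (rule sum.neutral) simp

text \<open>A sum of squared moduli: one translate not orthogonal to \<open>f\<close> suffices for
  \<open>frame v f\<close> to be nonzero.\<close>

lemma ip_frame: "ip (frame v f) f = of_real (\<Sum>g | g permutes {1..n}. (cmod (ip f (act g v)))\<^sup>2)"
proof -
  have "ip (frame v f) f = (\<Sum>g | g permutes {1..n}. ip f (act g v) * cnj (ip f (act g v)))"
    by (simp only: frame_def ip_sum ip_scale ip_cnj[symmetric])
  then show ?thesis
    by (simp only: of_real_sum complex_norm_square)
qed

lemma frame_nonzero:
  assumes "g permutes {1..n}" "ip f (act g v) \<noteq> 0"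
  shows "frame v f \<noteq> 0"
proof
  assume "frame v f = 0"
  then have "(\<Sum>g | g permutes {1..n}. (cmod (ip f (act g v)))\<^sup>2) = 0"
    using ip_frame[of v f] by (metis ip_zero of_real_eq_0_iff)
  then have "(cmod (ip f (act g v)))\<^sup>2 = 0"
    using assms(1) by (subst (asm) sum_nonneg_eq_0_iff) (auto simp: finite_permutations)
  then show False
    using assms(2) by simp
qed

text \<open>Colouring and vector are chosen as one pair, so that \<open>wcol\<close> and
  \<open>wvec\<close> belong together.\<close>

definition weight_pair :: "nat list \<Rightarrow> (nat \<Rightarrow> nat) \<times> ((nat \<Rightarrow> nat) \<Rightarrow> complex) \<Rightarrow> bool" where
  "weight_pair l cv \<longleftrightarrow> shape n (fst cv) (part l) \<and> snd cv \<in> F \<and> snd cv \<noteq> 0 \<and> sym_vec (fst cv) (snd cv)"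

definition wcol :: "nat list \<Rightarrow> nat \<Rightarrow> nat" where
  "wcol l = fst (SOME cv. weight_pair l cv)"

definition wvec :: "nat list \<Rightarrow> (nat \<Rightarrow> nat) \<Rightarrow> complex" where
  "wvec l = snd (SOME cv. weight_pair l cv)"

lemma weight:
  assumes "l \<in> TP n"
  shows "shape n (wcol l) (part l)" "wvec l \<in> F" "wvec l \<noteq> 0" "sym_vec (wcol l) (wvec l)"
proof -
  have l: "is_partition n l" "threshold_pair (part l) (part (conjugate l))"
    using assms by (auto simp: TP_iff)
  obtain c' where "shape n c' (part l)"
    using shape_exists[OF l(1)] .
  then obtain c v where "shape n c (part l)" "v \<in> F" "v \<noteq> 0" "sym_vec c v"
    using sym_vec_exists[OF l(2)] by metis
  then have "weight_pair l (c, v)"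
    by (simp only: weight_pair_def fst_conv snd_conv simp_thms)
  then have "weight_pair l (SOME cv. weight_pair l cv)"
    by (rule someI)
  then show "shape n (wcol l) (part l)" "wvec l \<in> F" "wvec l \<noteq> 0" "sym_vec (wcol l) (wvec l)"
    unfolding weight_pair_def wcol_def wvec_def by blast+
qed

lemma weight_unique:
  assumes "l \<in> TP n" "f \<in> F" "sym_vec (wcol l) f"
  obtains a where "f = fscale a (wvec l)"
proof -
  have "threshold_pair (part l) (part (conjugate l))"
    using assms(1) by (simp add: TP_iff)
  then show ?thesis
    using sym_vec_unique[OF assms(2,3) weight(2,4,3,1)[OF assms(1)]] that by metis
qed

definition U :: "nat list \<Rightarrow> ((nat \<Rightarrow> nat) \<Rightarrow> complex) set" where
  "U l = orbit_span (wvec l)"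

lemma invariant_U: "invariant (U l)"
  unfolding U_def by (rule invariant_orbit_span)

lemma wvec_in_U: "wvec l \<in> U l"
  unfolding U_def by (rule orbit_span_self)

lemma U_subset_F: "l \<in> TP n \<Longrightarrow> U l \<subseteq> F"
  unfolding U_def by (rule orbit_span_least[OF invariant_F weight(2)])

lemma U_least: "invariant W \<Longrightarrow> wvec l \<in> W \<Longrightarrow> U l \<subseteq> W"
  unfolding U_def by (rule orbit_span_least)

lemma weight_in_invariant:
  assumes W: "invariant W" and l: "l \<in> TP n" and y: "y \<in> W" "y \<in> F" "y \<noteq> 0" "sym_vec (wcol l) y"
  shows "wvec l \<in> W"
proof -
  obtain a where a: "y = fscale a (wvec l)"
    using weight_unique[OF l y(2,4)] .
  have "a \<noteq> 0"
    using a y(3) by (metis cfun.scale_zero_left)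
  then have "wvec l = fscale (1 / a) y"
    unfolding a by simp
  then show ?thesis
    using cfun.subspace_scale[OF invariantD(1)[OF W] y(1)] by metis
qed

text \<open>Both vectors from \<open>exists_type\<close> concern the same \<open>l\<close>, and the
  matchings in their supports make it a threshold partition. The fixed vector is then moved to the
  colouring \<open>wcol l\<close>, where uniqueness up to scalars puts \<open>wvec l\<close> into
  \<open>W\<close>.\<close>

lemma invariant_contains_weight:
  assumes W: "invariant W" "W \<subseteq> F" and w: "w \<in> W" "w \<noteq> 0"
  obtains l d z where "l \<in> TP n" "wvec l \<in> W" "shape n d (part (conjugate l))"
    "z \<in> W" "z \<noteq> 0" "alt_vec d z"
proof -
  obtain l c d u z where l: "is_partition n l" and c: "shape n c (part l)"
    and d: "shape n d (part (conjugate l))"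
    and u: "u \<in> W" "u \<noteq> 0" "sym_vec c u" and z: "z \<in> W" "z \<noteq> 0" "alt_vec d z"
    using exists_type[OF W(1) w] by metis
  obtain w1 where w1: "is_matching n w1" "u w1 \<noteq> 0"
    using nonzero_in_F[of u] u W(2) by blast
  obtain w2 where w2: "is_matching n w2" "z w2 \<noteq> 0"
    using nonzero_in_F[of z] z W(2) by blast
  have "threshold_pair (part l) (part (conjugate l))"
    by (rule matchings_imp_threshold[OF is_matchingD(1)[OF w1(1)] is_matchingD(2)[OF w1(1)]
          sym_vec_simple_matching[OF u(3) w1] c is_matchingD(1)[OF w2(1)] is_matchingD(2)[OF w2(1)]
          alt_vec_loop_matching[OF z(3) w2] d conj_pair_part[OF l]])
  then have lT: "l \<in> TP n"
    using l by (simp add: TP_iff)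
  obtain h where h: "h permutes {1..n}" "\<And>x. x \<in> {1..n} \<Longrightarrow> wcol l (h x) = c x"
    using same_shape_conjugate[OF c weight(1)[OF lT]] by metis
  have hi: "inv' h x \<in> {1..n}" if "x \<in> {1..n}" for x
    using that permutes_in_image[OF permutes_inv[OF h(1)]] by blast
  have "(c \<circ> inv' h) x = wcol l x" if "x \<in> {1..n}" for x
    using h(2)[OF hi[OF that]] by (simp add: permutes_inverses[OF h(1)])
  then have sym: "sym_vec (wcol l) (act h u)"
    using sym_vec_cong[OF _ sym_vec_act[OF h(1) u(3)], of "wcol l"] by blast
  have in_W: "act h u \<in> W"
    by (rule invariantD(2)[OF W(1) h(1) u(1)])
  have "act h u \<noteq> 0"
    using act_eq_0_iff[OF h(1)] u(2) by blast
  then have "wvec l \<in> W"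
    using weight_in_invariant[OF W(1) lT in_W _ _ sym] in_W W(2) by blast
  then show ?thesis
    using that[OF lT _ d z] by blast
qed

text \<open>A substitute for Schur's lemma. Equivariance keeps the image of \<open>wvec l\<close> on
  the line of fixed vectors, so \<open>wvec l\<close> is an eigenvector; the eigenspace is invariant
  and hence contains \<open>U l\<close>.\<close>

lemma frame_weight:
  assumes l: "l \<in> TP n"
  obtains a where "a \<noteq> 0" "\<And>u. u \<in> U l \<Longrightarrow> frame (wvec l) u = fscale a u"
proof -
  note v = weight[OF l]
  have "swp x y (frame (wvec l) (wvec l)) = frame (wvec l) (wvec l)"
    if "x \<in> {1..n}" "y \<in> {1..n}" "wcol l x = wcol l y" for x y
    using frame_act[OF swap_permutes[OF that(1,2)], of "wvec l" "wvec l"] sym_vecD[OF v(4) that] by simp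
  then have sym: "sym_vec (wcol l) (frame (wvec l) (wvec l))"
    by (simp add: sym_vec_def)
  have "frame (wvec l) (wvec l) \<in> F"
    using frame_in U_subset_F[OF l] unfolding U_def by blast
  then obtain a where a: "frame (wvec l) (wvec l) = fscale a (wvec l)"
    using weight_unique[OF l _ sym] by blast
  have "ip (wvec l) (act id (wvec l)) \<noteq> 0"
    unfolding act_id by (rule ip_self_pos[OF v(2,3)])
  then have "frame (wvec l) (wvec l) \<noteq> 0"
    using frame_nonzero[OF permutes_id] by blast
  then have "a \<noteq> 0"
    using a by (metis cfun.scale_zero_left)
  moreover have "U l \<subseteq> {u. frame (wvec l) u = fscale a u}"
  proof (rule U_least)
    show "wvec l \<in> {u. frame (wvec l) u = fscale a u}"
      using a by simp
    show "invariant {u. frame (wvec l) u = fscale a u}"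
      unfolding invariant_def
      by (auto intro!: cfun.subspaceI simp: frame_zero frame_add frame_scale frame_act act_scale
          cfun.scale_right_distrib mult.commute)
  qed
  ultimately show ?thesis
    using that by blast
qed

text \<open>A nonzero \<open>w\<close> in \<open>U l\<close> has a translate not orthogonal to
  \<open>wvec l\<close>. Averaging that translate over the stabiliser preserves the nonzero inner
  product, up to the order of the stabiliser, and gives a fixed vector in \<open>W\<close>, which is
  a multiple of \<open>wvec l\<close>.\<close>

lemma U_irreducible:
  assumes l: "l \<in> TP n" and W: "invariant W" "W \<subseteq> U l" and w: "w \<in> W" "w \<noteq> 0"
  shows "W = U l"
proof -
  obtain a where a: "a \<noteq> 0" "\<And>u. u \<in> U l \<Longrightarrow> frame (wvec l) u = fscale a u"
    using frame_weight[OF l] by blast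
  have "frame (wvec l) w \<noteq> 0"
    using a w W(2) by (metis cfun.scale_eq_0_iff subsetD)
  then obtain g where g: "g permutes {1..n}" "ip w (act g (wvec l)) \<noteq> 0"
    using frame_eq_0I by blast
  define w' where "w' = act (inv' g) w"
  have w': "w' \<in> W"
    unfolding w'_def by (rule invariantD(2)[OF W(1) permutes_inv[OF g(1)] w(1)])
  have ip_w': "ip w' (wvec l) \<noteq> 0"
    unfolding w'_def ip_act_left[OF permutes_inv[OF g(1)]] permutes_inv_inv[OF g(1)] by (rule g(2))
  let ?S = "colour_stab (wcol l)"
  define y where "y = (\<Sum>h\<in>?S. act h w')"
  have y: "y \<in> W"
    unfolding y_def
    by (rule cfun.subspace_sum[OF invariantD(1)[OF W(1)]], rule invariantD(2)[OF W(1) _ w'])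
      (simp add: colour_stab_def)
  have sym: "sym_vec (wcol l) y"
    unfolding y_def by (rule sym_vec_sum_stab)
  have "ip (act h w') (wvec l) = ip w' (wvec l)" if h: "h \<in> ?S" for h
  proof -
    have "h permutes {1..n}"
      using h by (simp add: colour_stab_def)
    then have "ip (act h w') (act h (wvec l)) = ip w' (wvec l)"
      by (rule ip_act)
    then show ?thesis
      by (simp only: sym_vec_stab[OF weight(4)[OF l] h])
  qed
  then have "ip y (wvec l) = of_nat (card ?S) * ip w' (wvec l)"
    unfolding y_def ip_sum by simp
  moreover have "id \<in> ?S"
    by (simp add: colour_stab_def permutes_id)
  ultimately have "y \<noteq> 0"
    using ip_w' finite_colour_stab by auto
  then have "wvec l \<in> W"
    using weight_in_invariant[OF W(1) l y _ _ sym] y W(2) U_subset_F[OF l] by blast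
  then show ?thesis
    using U_least[OF W(1)] W(2) by blast
qed

text \<open>The vectors of \<open>U l\<close> orthogonal to all translates of \<open>y\<close> form
  an invariant subspace that misses \<open>y\<close>, so by irreducibility it is zero.\<close>

lemma U_pairing:
  assumes l: "l \<in> TP n" and y: "y \<in> U l" "y \<noteq> 0" and z: "z \<in> U l" "z \<noteq> 0"
  obtains g where "g permutes {1..n}" "ip z (act g y) \<noteq> 0"
proof -
  define W where "W = {u\<in>U l. \<forall>g. g permutes {1..n} \<longrightarrow> ip u (act g y) = 0}"
  have sub: "cfun.subspace (U l)"
    by (rule invariantD(1)[OF invariant_U])
  have "invariant W"
    unfolding invariant_def
  proof (intro conjI allI impI)
    show "cfun.subspace W"
      by (rule cfun.subspaceI) (use sub in \<open>auto simp: W_def ip_add ip_scale cfun.subspace_0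
        cfun.subspace_add cfun.subspace_scale\<close>)
    fix h u assume h: "h permutes {1..n}" and u: "u \<in> W"
    have "ip (act h u) (act g y) = 0" if g: "g permutes {1..n}" for g
    proof -
      have "ip (act h u) (act g y) = ip u (act (inv' h) (act g y))"
        by (rule ip_act_left[OF h])
      also have "\<dots> = ip u (act (inv' h \<circ> g) y)"
        by (simp only: act_comp[OF permutes_inv[OF h] g])
      also have "\<dots> = 0"
        using u permutes_compose[OF g permutes_inv[OF h]] by (auto simp: W_def)
      finally show ?thesis .
    qed
    then show "act h u \<in> W"
      using u invariantD(2)[OF invariant_U h] by (simp add: W_def)
  qed
  moreover have "W \<subseteq> U l"
    by (auto simp: W_def)
  moreover have "y \<notin> W"
  proof
    assume "y \<in> W"
    then have "ip y (act id y) = 0"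
      using permutes_id by (auto simp: W_def)
    then show False
      using ip_self_pos[of y] y U_subset_F[OF l] by (auto simp: act_id)
  qed
  ultimately have "z \<notin> W"
    using U_irreducible[OF l] z(2) y(1) by blast
  then show ?thesis
    using z(1) that by (auto simp: W_def)
qed

text \<open>Two points sharing both colours would give a transposition under which the inner product
  changes sign. So the two colourings form a 0-1 matrix, and dominance holds for the rows in one
  direction and for the columns in the other.\<close>

lemma type_unique:
  assumes l: "l \<in> TP n" and l': "l' \<in> TP n"
    and u: "shape n c (part l)" "sym_vec c u"
    and z: "shape n d (part (conjugate l'))" "alt_vec d z"
    and nz: "ip z u \<noteq> 0"
  shows "l = l'"
proof -
  have p: "is_partition n l" "is_partition n l'"
    and t: "threshold_pair (part l) (part (conjugate l))" "threshold_pair (part l') (part (conjugate l'))"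
    using l l' by (auto simp: TP_iff)
  have cp: "conj_pair (part l) (part (conjugate l))" "conj_pair (part l') (part (conjugate l'))"
    using p conj_pair_part by auto
  have inj: "x = y" if xy: "x \<in> {1..n}" "y \<in> {1..n}" "c x = c y" "d x = d y" for x y
  proof (rule ccontr)
    assume "x \<noteq> y"
    then have "swp x y z = - z" "swp x y u = u"
      using alt_vecD[OF z(2) xy(1,2)] sym_vecD[OF u(2) xy(1-3)] xy(4) by auto
    then have "ip z u = - ip z u"
      using ip_act[OF swap_permutes[OF xy(1,2)], of z u] by (simp only: ip_neg)
    then show False
      using nz by simp
  qed
  have inj1: "inj_on (\<lambda>x. (c x, d x)) {1..n}" and inj2: "inj_on (\<lambda>x. (d x, c x)) {1..n}"
    by (rule inj_onI, rule inj, auto)+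
  have "part l = part l'"
  proof (rule threshold_dominance_eq[OF t])
    obtain c' where c': "shape n c' (part l')"
      using shape_exists[OF p(2)] .
    show "card (diagram (part l)) = card (diagram (part l'))"
      unfolding card_diagram[OF u(1) cp(1)] card_diagram[OF c' cp(2)] ..
    show "(\<Sum>i=1..k. part l i) \<le> (\<Sum>i=1..k. part l' i)" for k
      by (rule transversal_dominance[OF u(1) _ z(1) conj_pair_sym[OF cp(2)] inj1]) (simp add: part_def)
    show "(\<Sum>i=1..k. part (conjugate l') i) \<le> (\<Sum>i=1..k. part (conjugate l) i)" for k
      by (rule transversal_dominance[OF z(1) _ u(1) cp(1) inj2]) (simp add: part_def)
  qed
  then show ?thesis
    by (intro part_inject[OF p]) simp
qed

text \<open>\<open>exists_type\<close> does not say which partition it finds inside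
  \<open>U l\<close>; pairing its alternating vector with a translate of \<open>wvec l\<close>
  identifies it as \<open>l\<close>.\<close>

lemma U_alt_vec:
  assumes l: "l \<in> TP n"
  obtains d z where "shape n d (part (conjugate l))" "z \<in> U l" "z \<noteq> 0" "alt_vec d z"
proof -
  obtain l' d z where l': "l' \<in> TP n" "shape n d (part (conjugate l'))" "z \<in> U l" "z \<noteq> 0" "alt_vec d z"
    using invariant_contains_weight[OF invariant_U U_subset_F[OF l] wvec_in_U weight(3)[OF l]] by metis
  obtain g where g: "g permutes {1..n}" "ip z (act g (wvec l)) \<noteq> 0"
    using U_pairing[OF l wvec_in_U weight(3)[OF l] l'(3,4)] by blast
  have "l = l'"
    by (rule type_unique[OF l l'(1) shape_comp[OF weight(1)[OF l] permutes_inv[OF g(1)]]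
          sym_vec_act[OF g(1) weight(4)[OF l]] l'(2,5) g(2)])
  then show ?thesis
    using that l' by blast
qed

text \<open>A nonzero image of \<open>wvec l'\<close> would be a fixed vector of shape
  \<open>l'\<close> inside \<open>U l\<close>, where it pairs with a vector alternating for the
  shape conjugate to \<open>l\<close>; \<open>type_unique\<close> then forces
  \<open>l' = l\<close>.\<close>

lemma U_orthogonal:
  assumes l: "l \<in> TP n" and l': "l' \<in> TP n" "l \<noteq> l'" and u: "u \<in> U l'"
  shows "frame (wvec l) u = 0"
proof -
  have "frame (wvec l) (wvec l') = 0"
  proof (rule ccontr)
    define y where "y = frame (wvec l) (wvec l')"
    assume "frame (wvec l) (wvec l') \<noteq> 0"
    then have y: "y \<in> U l" "y \<noteq> 0"
      using frame_in by (auto simp: y_def U_def)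
    have "swp p q y = y" if pq: "p \<in> {1..n}" "q \<in> {1..n}" "wcol l' p = wcol l' q" for p q
      unfolding y_def frame_act[OF swap_permutes[OF pq(1,2)], symmetric]
      by (simp only: sym_vecD[OF weight(4)[OF l'(1)] pq])
    then have sym: "sym_vec (wcol l') y"
      by (simp add: sym_vec_def)
    obtain d z where z: "shape n d (part (conjugate l))" "z \<in> U l" "z \<noteq> 0" "alt_vec d z"
      using U_alt_vec[OF l] .
    obtain g where g: "g permutes {1..n}" "ip z (act g y) \<noteq> 0"
      using U_pairing[OF l y z(2,3)] .
    have "l' = l"
      by (rule type_unique[OF l'(1) l shape_comp[OF weight(1)[OF l'(1)] permutes_inv[OF g(1)]]
            sym_vec_act[OF g(1) sym] z(1,4) g(2)])
    then show False
      using l'(2) by simp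
  qed
  moreover have "invariant {u. frame (wvec l) u = 0}"
    unfolding invariant_def
    by (auto intro!: cfun.subspaceI simp: frame_zero frame_add frame_scale frame_act)
  ultimately have "U l' \<subseteq> {u. frame (wvec l) u = 0}"
    by (intro U_least) auto
  then show ?thesis
    using u by blast
qed

text \<open>The common kernel of the frame operators is invariant. If nonzero it would contain some
  \<open>wvec l\<close>, on which its own frame operator has a nonzero eigenvalue.\<close>

lemma frame_all_zero:
  assumes f: "f \<in> F" and zero: "\<And>l. l \<in> TP n \<Longrightarrow> frame (wvec l) f = 0"
  shows "f = 0"
proof (rule ccontr)
  assume "f \<noteq> 0"
  define W where "W = {f\<in>F. \<forall>l\<in>TP n. frame (wvec l) f = 0}"
  have W: "invariant W"
    unfolding invariant_def
  proof (intro conjI allI impI)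
    show "cfun.subspace W"
      by (rule cfun.subspaceI) (use invariantD(1)[OF invariant_F] in \<open>auto simp: W_def frame_zero
        frame_add frame_scale cfun.subspace_0 cfun.subspace_add cfun.subspace_scale\<close>)
    show "act g u \<in> W" if "g permutes {1..n}" "u \<in> W" for g u
      using that invariantD(2)[OF invariant_F that(1)] by (auto simp: W_def frame_act)
  qed
  have "f \<in> W" "W \<subseteq> F"
    using f zero by (auto simp: W_def)
  then obtain l where l: "l \<in> TP n" "wvec l \<in> W"
    using invariant_contains_weight[OF W _ _ \<open>f \<noteq> 0\<close>] by metis
  obtain a where "a \<noteq> 0" "\<And>u. u \<in> U l \<Longrightarrow> frame (wvec l) u = fscale a u"
    using frame_weight[OF l(1)] by blast
  then have "frame (wvec l) (wvec l) \<noteq> 0"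
    using wvec_in_U weight(3)[OF l(1)] by (metis cfun.scale_eq_0_iff)
  then show False
    using l by (simp add: W_def)
qed

text \<open>The chosen scalar is the eigenvalue from \<open>frame_weight\<close>; dividing by it
  normalises the frame operator to the identity on \<open>U l\<close>.\<close>

definition proj_U :: "nat list \<Rightarrow> ((nat \<Rightarrow> nat) \<Rightarrow> complex) \<Rightarrow> ((nat \<Rightarrow> nat) \<Rightarrow> complex)" where
  "proj_U l f = fscale (1 / (SOME a. a \<noteq> 0 \<and> (\<forall>u\<in>U l. frame (wvec l) u = fscale a u))) (frame (wvec l) f)"

lemma proj_U_in: "proj_U l f \<in> U l"
  unfolding proj_U_def using frame_in invariantD(1)[OF invariant_U]
  by (intro cfun.subspace_scale) (auto simp: U_def)

lemma proj_U_add: "proj_U l (f + f') = proj_U l f + proj_U l f'"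
  by (simp only: proj_U_def frame_add cfun.scale_right_distrib)

lemma proj_U_scale: "proj_U l (fscale a f) = fscale a (proj_U l f)"
  by (simp only: proj_U_def frame_scale cfun.scale_left_commute[of _ a])

lemma proj_U_act: "g permutes {1..n} \<Longrightarrow> proj_U l (act g f) = act g (proj_U l f)"
  by (simp only: proj_U_def frame_act act_scale)

lemma proj_U_scalar:
  assumes "l \<in> TP n"
  obtains a where "a \<noteq> 0" "\<And>u. u \<in> U l \<Longrightarrow> frame (wvec l) u = fscale a u"
    "\<And>f. proj_U l f = fscale (1 / a) (frame (wvec l) f)"
proof -
  let ?P = "\<lambda>a. a \<noteq> 0 \<and> (\<forall>u\<in>U l. frame (wvec l) u = fscale a u)"
  have "\<exists>a. ?P a"
    using frame_weight[OF assms] by metis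
  then have "?P (SOME a. ?P a)"
    by (rule someI_ex)
  then show ?thesis
    using that unfolding proj_U_def by blast
qed

lemma proj_U_self:
  assumes "l \<in> TP n" "u \<in> U l"
  shows "proj_U l u = u"
proof -
  obtain a where "a \<noteq> 0" "frame (wvec l) u = fscale a u" "proj_U l u = fscale (1 / a) (frame (wvec l) u)"
    using proj_U_scalar[OF assms(1)] assms(2) by metis
  then show ?thesis
    by simp
qed

lemma proj_U_other:
  assumes "l \<in> TP n" "l' \<in> TP n" "l \<noteq> l'" "u \<in> U l'"
  shows "proj_U l u = 0"
  unfolding proj_U_def U_orthogonal[OF assms] by simp

lemma proj_U_sum:
  assumes l: "l \<in> TP n" and f: "\<And>l. l \<in> TP n \<Longrightarrow> f l \<in> U l"
  shows "proj_U l (\<Sum>l\<in>TP n. f l) = f l"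
proof -
  have "proj_U l (sum f A) = (\<Sum>l'\<in>A. proj_U l (f l'))" for A
    by (simp only: proj_U_def frame_sum cfun.scale_sum_right)
  then have "proj_U l (\<Sum>l\<in>TP n. f l) = (\<Sum>l'\<in>TP n. proj_U l (f l'))" .
  also have "\<dots> = (\<Sum>l'\<in>TP n. if l' = l then f l' else 0)"
    using proj_U_self[OF l f[OF l]] proj_U_other[OF l] f by (intro sum.cong refl) auto
  also have "\<dots> = f l"
    using l finite_TP[of n] by (simp only: sum.delta' sum.delta if_True)
  finally show ?thesis .
qed

text \<open>The projections of \<open>f\<close> and of its candidate decomposition agree, so the
  remainder is killed by every frame operator.\<close>

lemma sum_proj_U:
  assumes f: "f \<in> F"
  shows "(\<Sum>l\<in>TP n. proj_U l f) = f"
proof -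
  define r where "r = f - (\<Sum>l\<in>TP n. proj_U l f)"
  have sub: "cfun.subspace F"
    by (rule invariantD(1)[OF invariant_F])
  have r: "r \<in> F"
    unfolding r_def using f proj_U_in U_subset_F
    by (intro cfun.subspace_diff[OF sub] cfun.subspace_sum[OF sub]) blast+
  have "frame (wvec l) r = 0" if l: "l \<in> TP n" for l
  proof -
    obtain a where a: "a \<noteq> 0" "\<And>f. proj_U l f = fscale (1 / a) (frame (wvec l) f)"
      using proj_U_scalar[OF l] by metis
    have "proj_U l f = proj_U l (\<Sum>l\<in>TP n. proj_U l f)"
      by (rule proj_U_sum[OF l proj_U_in, symmetric])
    then have "frame (wvec l) f = frame (wvec l) (\<Sum>l\<in>TP n. proj_U l f)"
      using a(1) by (simp add: a(2))
    then show ?thesis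
      unfolding r_def frame_diff by simp
  qed
  then have "r = 0"
    by (rule frame_all_zero[OF r])
  then show ?thesis
    unfolding r_def by simp
qed

end

section \<open>Isomorphisms and direct sums of representations\<close>

lemma is_repD:
  assumes "is_rep G R"
  shows "group G" "cfun.subspace (rep_space R)"
    "g \<in> carrier G \<Longrightarrow> linear_map_on (rep_space R) (rep_act R g)"
    "g \<in> carrier G \<Longrightarrow> v \<in> rep_space R \<Longrightarrow> rep_act R g v \<in> rep_space R"
    "v \<in> rep_space R \<Longrightarrow> rep_act R \<one>\<^bsub>G\<^esub> v = v"
    "g \<in> carrier G \<Longrightarrow> h \<in> carrier G \<Longrightarrow> v \<in> rep_space R
      \<Longrightarrow> rep_act R (g \<otimes>\<^bsub>G\<^esub> h) v = rep_act R g (rep_act R h v)"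
  using assms by (auto simp: is_rep_def)

lemma linear_map_onD:
  assumes "linear_map_on V T"
  shows "u \<in> V \<Longrightarrow> v \<in> V \<Longrightarrow> T (u + v) = T u + T v"
    "v \<in> V \<Longrightarrow> T (fscale c v) = fscale c (T v)"
  using assms by (auto simp: linear_map_on_def)

lemma linear_map_on_0: "linear_map_on V T \<Longrightarrow> v \<in> V \<Longrightarrow> T 0 = 0"
  using linear_map_onD(2)[of V T v 0] by simp

lemma is_rep_subspace:
  assumes "is_rep G R" "invariant_subspace G R W"
  shows "is_rep G (R\<lparr>rep_space := W\<rparr>)"
proof -
  have sub: "W \<subseteq> rep_space R"
    using assms(2) by (simp add: invariant_subspace_def)
  have "linear_map_on W (rep_act R g)" if "g \<in> carrier G" for g
    using is_repD(3)[OF assms(1) that] sub unfolding linear_map_on_def by blast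
  then show ?thesis
    using assms(2) is_repD(1)[OF assms(1)] is_repD(5)[OF assms(1) subsetD[OF sub]]
      is_repD(6)[OF assms(1) _ _ subsetD[OF sub]]
    by (simp add: is_rep_def invariant_subspace_def)
qed

lemma rep_isomorphicE:
  assumes "rep_isomorphic G R S"
  obtains T where "linear_map_on (rep_space R) T" "bij_betw T (rep_space R) (rep_space S)"
    "\<And>g v. g \<in> carrier G \<Longrightarrow> v \<in> rep_space R \<Longrightarrow> T (rep_act R g v) = rep_act S g (T v)"
  using assms by (auto simp: rep_isomorphic_def)

lemma rep_isomorphicI:
  assumes "is_rep G R" "is_rep G S" "linear_map_on (rep_space R) T"
    "bij_betw T (rep_space R) (rep_space S)"
    "\<And>g v. g \<in> carrier G \<Longrightarrow> v \<in> rep_space R \<Longrightarrow> T (rep_act R g v) = rep_act S g (T v)"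
  shows "rep_isomorphic G R S"
  using assms by (auto simp: rep_isomorphic_def)

lemma rep_isomorphic_sym:
  assumes "rep_isomorphic G R S"
  shows "rep_isomorphic G S R"
proof -
  obtain T where T: "linear_map_on (rep_space R) T" "bij_betw T (rep_space R) (rep_space S)"
    "\<And>g v. g \<in> carrier G \<Longrightarrow> v \<in> rep_space R \<Longrightarrow> T (rep_act R g v) = rep_act S g (T v)"
    using rep_isomorphicE[OF assms] by blast
  have R: "is_rep G R" and S: "is_rep G S"
    using assms by (auto simp: rep_isomorphic_def)
  define T' where "T' = inv_into (rep_space R) T"
  have TT': "T (T' v) = v" if "v \<in> rep_space S" for v
    unfolding T'_def by (rule bij_betw_inv_into_right[OF T(2) that])
  have T'_in: "T' v \<in> rep_space R" if "v \<in> rep_space S" for v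
    using bij_betwE[OF bij_betw_inv_into[OF T(2)]] that unfolding T'_def by blast
  have T'T: "T' (T v) = v" if "v \<in> rep_space R" for v
    unfolding T'_def by (rule bij_betw_inv_into_left[OF T(2) that])
  show ?thesis
  proof (rule rep_isomorphicI[OF S R, of T'])
    show "bij_betw T' (rep_space S) (rep_space R)"
      unfolding T'_def by (rule bij_betw_inv_into[OF T(2)])
    show "linear_map_on (rep_space S) T'"
      unfolding linear_map_on_def
    proof (intro conjI ballI allI)
      fix u v assume uv: "u \<in> rep_space S" "v \<in> rep_space S"
      have "T' u + T' v \<in> rep_space R"
        by (rule cfun.subspace_add[OF is_repD(2)[OF R] T'_in[OF uv(1)] T'_in[OF uv(2)]])
      moreover have "T (T' u + T' v) = u + v"
        using linear_map_onD(1)[OF T(1) T'_in[OF uv(1)] T'_in[OF uv(2)]] TT' uv by simp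
      ultimately show "T' (u + v) = T' u + T' v"
        using T'T by metis
    next
      fix a v assume v: "v \<in> rep_space S"
      have "fscale a (T' v) \<in> rep_space R"
        by (rule cfun.subspace_scale[OF is_repD(2)[OF R] T'_in[OF v]])
      moreover have "T (fscale a (T' v)) = fscale a v"
        using linear_map_onD(2)[OF T(1) T'_in[OF v]] TT'[OF v] by simp
      ultimately show "T' (fscale a v) = fscale a (T' v)"
        using T'T by metis
    qed
    fix g v assume g: "g \<in> carrier G" and v: "v \<in> rep_space S"
    have "T (rep_act R g (T' v)) = rep_act S g v"
      using T(3)[OF g T'_in[OF v]] TT'[OF v] by simp
    then show "T' (rep_act S g v) = rep_act R g (T' v)"
      using T'T[OF is_repD(4)[OF R g T'_in[OF v]]] by simp
  qed
qed

lemma rep_isomorphic_trans: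
  assumes "rep_isomorphic G R S" "rep_isomorphic G S Q"
  shows "rep_isomorphic G R Q"
proof -
  obtain T where T: "linear_map_on (rep_space R) T" "bij_betw T (rep_space R) (rep_space S)"
    "\<And>g v. g \<in> carrier G \<Longrightarrow> v \<in> rep_space R \<Longrightarrow> T (rep_act R g v) = rep_act S g (T v)"
    using rep_isomorphicE[OF assms(1)] by blast
  obtain T' where T': "linear_map_on (rep_space S) T'" "bij_betw T' (rep_space S) (rep_space Q)"
    "\<And>g v. g \<in> carrier G \<Longrightarrow> v \<in> rep_space S \<Longrightarrow> T' (rep_act S g v) = rep_act Q g (T' v)"
    using rep_isomorphicE[OF assms(2)] by blast
  have T_in: "T v \<in> rep_space S" if "v \<in> rep_space R" for v
    using that T(2) bij_betwE by blast
  show ?thesis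
  proof (rule rep_isomorphicI[of G R Q "T' \<circ> T"])
    show "is_rep G R" "is_rep G Q"
      using assms by (auto simp: rep_isomorphic_def)
    show "bij_betw (T' \<circ> T) (rep_space R) (rep_space Q)"
      by (rule bij_betw_trans[OF T(2) T'(2)])
    show "linear_map_on (rep_space R) (T' \<circ> T)"
      unfolding linear_map_on_def comp_def
      using linear_map_onD[OF T(1)] linear_map_onD[OF T'(1)] T_in by simp
    show "(T' \<circ> T) (rep_act R g v) = rep_act Q g ((T' \<circ> T) v)" if "g \<in> carrier G" "v \<in> rep_space R" for g v
      unfolding comp_def by (simp only: T(3)[OF that] T'(3)[OF that(1) T_in[OF that(2)]])
  qed
qed

lemma irreducible_rep_iso:
  assumes "irreducible_rep G R" "rep_isomorphic G R S"
  shows "irreducible_rep G S"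
proof -
  obtain T where T: "linear_map_on (rep_space R) T" "bij_betw T (rep_space R) (rep_space S)"
    "\<And>g v. g \<in> carrier G \<Longrightarrow> v \<in> rep_space R \<Longrightarrow> T (rep_act R g v) = rep_act S g (T v)"
    using rep_isomorphicE[OF assms(2)] by blast
  have R: "is_rep G R" and S: "is_rep G S"
    using assms(2) by (auto simp: rep_isomorphic_def)
  have R0: "0 \<in> rep_space R"
    by (rule cfun.subspace_0[OF is_repD(2)[OF R]])
  have T0: "T 0 = 0"
    by (rule linear_map_on_0[OF T(1) R0])
  show ?thesis
    unfolding irreducible_rep_def
  proof (intro conjI allI impI S)
    show "rep_space S \<noteq> {0}"
    proof
      assume "rep_space S = {0}"
      then have "T v = T 0" if "v \<in> rep_space R" for v
        using that bij_betwE[OF T(2)] T0 by auto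
      then have "rep_space R = {0}"
        using bij_betw_imp_inj_on[OF T(2)] R0 by (auto dest: inj_onD)
      then show False
        using assms(1) by (simp add: irreducible_rep_def)
    qed
    fix W assume W: "invariant_subspace G S W"
    define W' where "W' = {v\<in>rep_space R. T v \<in> W}"
    have sub: "cfun.subspace W" and WS: "W \<subseteq> rep_space S"
      and Wact: "\<And>g w. g \<in> carrier G \<Longrightarrow> w \<in> W \<Longrightarrow> rep_act S g w \<in> W"
      using W by (auto simp: invariant_subspace_def)
    have "invariant_subspace G R W'"
      unfolding invariant_subspace_def
    proof (intro conjI ballI)
      show "cfun.subspace W'"
        using is_repD(2)[OF R] sub T0
        by (intro cfun.subspaceI) (auto simp: W'_def linear_map_onD[OF T(1)] cfun.subspace_0
          cfun.subspace_add cfun.subspace_scale)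
      show "rep_act R g ` W' \<subseteq> W'" if g: "g \<in> carrier G" for g
        using is_repD(4)[OF R g] Wact[OF g] T(3)[OF g] by (auto simp: W'_def)
    qed (auto simp: W'_def)
    then have "W' = {0} \<or> W' = rep_space R"
      using assms(1) by (simp add: irreducible_rep_def)
    moreover have "W = T ` W'"
      using bij_betw_imp_surj_on[OF T(2)] WS by (auto simp: W'_def)
    ultimately show "W = {0} \<or> W = rep_space S"
      using bij_betw_imp_surj_on[OF T(2)] T0 by auto
  qed
qed

lemma occurs_in_iso: "rep_isomorphic G R R' \<Longrightarrow> occurs_in G R S \<Longrightarrow> occurs_in G R' S"
  unfolding occurs_in_def using rep_isomorphic_trans rep_isomorphic_sym by blast

lemma direct_sum_component:
  assumes "f \<in> rep_space (direct_sum I R)" "i \<in> I"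
  shows "(\<lambda>x. f (i, x)) \<in> rep_space (R i)"
  using assms by (simp add: direct_sum_def)

lemma direct_sum_act:
  "i \<in> I \<Longrightarrow> (\<lambda>x. rep_act (direct_sum I R) g f (i, x)) = rep_act (R i) g (\<lambda>x. f (i, x))"
  "i \<notin> I \<Longrightarrow> rep_act (direct_sum I R) g f (i, x) = 0"
  by (simp_all add: direct_sum_def)

lemma direct_sum_eqI:
  assumes "f \<in> rep_space (direct_sum I R)" "f' \<in> rep_space (direct_sum I R)"
    and "\<And>i. i \<in> I \<Longrightarrow> (\<lambda>x. f (i, x)) = (\<lambda>x. f' (i, x))"
  shows "f = f'"
proof
  fix z
  show "f z = f' z"
  proof (cases "fst z \<in> I")
    case True
    then show ?thesis
      using fun_cong[OF assms(3), of "fst z" "snd z"] by simp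
  next
    case False
    then show ?thesis
      using assms(1,2) by (cases z) (simp add: direct_sum_def)
  qed
qed

lemma is_rep_direct_sum:
  assumes G: "group G" and R: "\<And>i. i \<in> I \<Longrightarrow> is_rep G (R i)"
  shows "is_rep G (direct_sum I R)"
proof -
  let ?D = "direct_sum I R"
  have mem: "f \<in> rep_space ?D \<longleftrightarrow> (\<forall>i\<in>I. (\<lambda>x. f (i, x)) \<in> rep_space (R i)) \<and> (\<forall>i. i \<notin> I \<longrightarrow> (\<forall>x. f (i, x) = 0))"
    for f by (simp add: direct_sum_def)
  have comp_add: "(\<lambda>x. (f + f') (i, x)) = (\<lambda>x. f (i, x)) + (\<lambda>x. f' (i, x))"
    and comp_scale: "(\<lambda>x. fscale a f (i, x)) = fscale a (\<lambda>x. f (i, x))"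
    for f f' :: "'b \<times> 'c \<Rightarrow> complex" and i a
    by (auto simp: fun_eq_iff fscale_def)
  have sub: "cfun.subspace (rep_space ?D)"
  proof (rule cfun.subspaceI)
    show "0 \<in> rep_space ?D"
      unfolding mem using cfun.subspace_0[OF is_repD(2)[OF R]] by (simp add: zero_fun_def)
    show "f + f' \<in> rep_space ?D" if ff: "f \<in> rep_space ?D" "f' \<in> rep_space ?D" for f f'
      unfolding mem
    proof (intro conjI ballI allI impI)
      show "(\<lambda>x. (f + f') (i, x)) \<in> rep_space (R i)" if i: "i \<in> I" for i
        using ff i unfolding mem comp_add[of f f' i]
        by (intro cfun.subspace_add[OF is_repD(2)[OF R[OF i]]]) blast+
    qed (use ff in \<open>simp add: mem\<close>)
    show "fscale a f \<in> rep_space ?D" if ff: "f \<in> rep_space ?D" for f a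
      unfolding mem
    proof (intro conjI ballI allI impI)
      show "(\<lambda>x. fscale a f (i, x)) \<in> rep_space (R i)" if i: "i \<in> I" for i
        using ff i unfolding mem comp_scale[of a f i]
        by (intro cfun.subspace_scale[OF is_repD(2)[OF R[OF i]]]) blast
    qed (use ff in \<open>simp add: mem fscale_def\<close>)
  qed
  have act_in: "rep_act ?D g f \<in> rep_space ?D" if "g \<in> carrier G" "f \<in> rep_space ?D" for g f
    using that unfolding mem
    by (simp add: direct_sum_act is_repD(4)[OF R])
  show ?thesis
    unfolding is_rep_def
  proof (intro conjI ballI G sub)
    fix g assume g: "g \<in> carrier G"
    show "rep_act ?D g ` rep_space ?D \<subseteq> rep_space ?D"
      using act_in[OF g] by blast
    show "linear_map_on (rep_space ?D) (rep_act ?D g)"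
      unfolding linear_map_on_def
    proof (intro conjI ballI allI)
      fix f f' assume f: "f \<in> rep_space ?D" "f' \<in> rep_space ?D"
      show "rep_act ?D g (f + f') = rep_act ?D g f + rep_act ?D g f'"
      proof (rule direct_sum_eqI[of _ I R])
        show "rep_act ?D g (f + f') \<in> rep_space ?D" "rep_act ?D g f + rep_act ?D g f' \<in> rep_space ?D"
          using f act_in[OF g] cfun.subspace_add[OF sub] by blast+
        show "(\<lambda>x. rep_act ?D g (f + f') (i, x)) = (\<lambda>x. (rep_act ?D g f + rep_act ?D g f') (i, x))"
          if i: "i \<in> I" for i
          unfolding comp_add direct_sum_act(1)[OF i]
          by (rule linear_map_onD(1)[OF is_repD(3)[OF R[OF i] g] direct_sum_component[OF f(1) i]
                direct_sum_component[OF f(2) i]])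
      qed
    next
      fix a f assume f: "f \<in> rep_space ?D"
      show "rep_act ?D g (fscale a f) = fscale a (rep_act ?D g f)"
      proof (rule direct_sum_eqI[of _ I R])
        show "rep_act ?D g (fscale a f) \<in> rep_space ?D" "fscale a (rep_act ?D g f) \<in> rep_space ?D"
          using f act_in[OF g] cfun.subspace_scale[OF sub] by blast+
        show "(\<lambda>x. rep_act ?D g (fscale a f) (i, x)) = (\<lambda>x. fscale a (rep_act ?D g f) (i, x))"
          if i: "i \<in> I" for i
          unfolding comp_scale direct_sum_act(1)[OF i]
          by (rule linear_map_onD(2)[OF is_repD(3)[OF R[OF i] g] direct_sum_component[OF f i]])
      qed
    qed
    fix h f assume h: "h \<in> carrier G" and f: "f \<in> rep_space ?D"
    show "rep_act ?D (g \<otimes>\<^bsub>G\<^esub> h) f = rep_act ?D g (rep_act ?D h f)"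
    proof (rule direct_sum_eqI[of _ I R])
      show "rep_act ?D (g \<otimes>\<^bsub>G\<^esub> h) f \<in> rep_space ?D" "rep_act ?D g (rep_act ?D h f) \<in> rep_space ?D"
        using f g h act_in monoid.m_closed[OF group.is_monoid[OF G]] by blast+
      show "(\<lambda>x. rep_act ?D (g \<otimes>\<^bsub>G\<^esub> h) f (i, x)) = (\<lambda>x. rep_act ?D g (rep_act ?D h f) (i, x))"
        if i: "i \<in> I" for i
        unfolding direct_sum_act(1)[OF i]
        by (rule is_repD(6)[OF R[OF i] g h direct_sum_component[OF f i]])
    qed
  next
    fix f assume f: "f \<in> rep_space ?D"
    show "rep_act ?D \<one>\<^bsub>G\<^esub> f = f"
    proof (rule direct_sum_eqI[of _ I R])
      show "rep_act ?D \<one>\<^bsub>G\<^esub> f \<in> rep_space ?D" "f \<in> rep_space ?D"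
        using f act_in monoid.one_closed[OF group.is_monoid[OF G]] by blast+
      show "(\<lambda>x. rep_act ?D \<one>\<^bsub>G\<^esub> f (i, x)) = (\<lambda>x. f (i, x))" if i: "i \<in> I" for i
        unfolding direct_sum_act(1)[OF i]
        by (rule is_repD(5)[OF R[OF i] direct_sum_component[OF f i]])
    qed
  qed
qed

text \<open>The projections \<open>p i\<close> are given on the whole space: \<open>sum_p\<close>
  recovers a vector from its components and yields injectivity, \<open>p_sum\<close> computes the
  components of a prescribed sum and yields surjectivity.\<close>

lemma rep_isomorphic_direct_sum:
  assumes R: "is_rep G R" and fin: "finite I"
    and iso: "\<And>i. i \<in> I \<Longrightarrow> rep_isomorphic G (R\<lparr>rep_space := U i\<rparr>) (S i)"
    and U: "\<And>i. i \<in> I \<Longrightarrow> U i \<subseteq> rep_space R"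
    and p_in: "\<And>i v. i \<in> I \<Longrightarrow> p i v \<in> U i"
    and p_lin: "\<And>i. i \<in> I \<Longrightarrow> linear_map_on (rep_space R) (p i)"
    and p_act: "\<And>i g v. i \<in> I \<Longrightarrow> g \<in> carrier G \<Longrightarrow> v \<in> rep_space R \<Longrightarrow> p i (rep_act R g v) = rep_act R g (p i v)"
    and p_sum: "\<And>i f. i \<in> I \<Longrightarrow> (\<And>j. j \<in> I \<Longrightarrow> f j \<in> U j) \<Longrightarrow> p i (\<Sum>j\<in>I. f j) = f i"
    and sum_p: "\<And>v. v \<in> rep_space R \<Longrightarrow> (\<Sum>i\<in>I. p i v) = v"
  shows "rep_isomorphic G R (direct_sum I S)"
proof -
  let ?D = "direct_sum I S"
  have "\<forall>i\<in>I. \<exists>T. linear_map_on (U i) T \<and> bij_betw T (U i) (rep_space (S i)) \<and>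
      (\<forall>g\<in>carrier G. \<forall>v\<in>U i. T (rep_act R g v) = rep_act (S i) g (T v))"
    using iso by (simp add: rep_isomorphic_def)
  then obtain T where T: "\<And>i. i \<in> I \<Longrightarrow> linear_map_on (U i) (T i)"
    "\<And>i. i \<in> I \<Longrightarrow> bij_betw (T i) (U i) (rep_space (S i))"
    "\<And>i g v. i \<in> I \<Longrightarrow> g \<in> carrier G \<Longrightarrow> v \<in> U i \<Longrightarrow> T i (rep_act R g v) = rep_act (S i) g (T i v)"
    by metis
  define \<Phi> where "\<Phi> v = (\<lambda>(i, x). if i \<in> I then T i (p i v) x else 0)" for v
  have comp: "(\<lambda>x. \<Phi> v (i, x)) = T i (p i v)" if "i \<in> I" for i v
    using that by (simp add: \<Phi>_def)
  have T_in: "T i (p i v) \<in> rep_space (S i)" if "i \<in> I" for i v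
    using bij_betwE[OF T(2)[OF that]] p_in[OF that] by blast
  have \<Phi>_in: "\<Phi> v \<in> rep_space ?D" for v
    using T_in by (auto simp: direct_sum_def \<Phi>_def)
  have D: "is_rep G ?D"
    using iso by (intro is_rep_direct_sum is_repD(1)[OF R]) (auto simp: rep_isomorphic_def)
  note sub = is_repD(2)[OF D]
  show ?thesis
  proof (rule rep_isomorphicI[OF R D, of \<Phi>])
    show "linear_map_on (rep_space R) \<Phi>"
      unfolding linear_map_on_def
    proof (intro conjI ballI allI)
      fix u v assume uv: "u \<in> rep_space R" "v \<in> rep_space R"
      show "\<Phi> (u + v) = \<Phi> u + \<Phi> v"
      proof (rule direct_sum_eqI[of _ I S])
        show "(\<lambda>x. \<Phi> (u + v) (i, x)) = (\<lambda>x. (\<Phi> u + \<Phi> v) (i, x))" if i: "i \<in> I" for i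
          using linear_map_onD(1)[OF p_lin[OF i] uv] linear_map_onD(1)[OF T(1)[OF i] p_in[OF i] p_in[OF i]] i
          by (simp add: \<Phi>_def)
      qed (use \<Phi>_in cfun.subspace_add[OF sub] in blast)+
    next
      fix a v assume v: "v \<in> rep_space R"
      show "\<Phi> (fscale a v) = fscale a (\<Phi> v)"
      proof (rule direct_sum_eqI[of _ I S])
        show "(\<lambda>x. \<Phi> (fscale a v) (i, x)) = (\<lambda>x. fscale a (\<Phi> v) (i, x))" if i: "i \<in> I" for i
          using linear_map_onD(2)[OF p_lin[OF i] v] linear_map_onD(2)[OF T(1)[OF i] p_in[OF i]] i
          by (simp add: \<Phi>_def fscale_def)
      qed (use \<Phi>_in cfun.subspace_scale[OF sub] in blast)+
    qed
    show "\<Phi> (rep_act R g v) = rep_act ?D g (\<Phi> v)" if g: "g \<in> carrier G" and v: "v \<in> rep_space R" for g v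
    proof (rule direct_sum_eqI[of _ I S])
      show "(\<lambda>x. \<Phi> (rep_act R g v) (i, x)) = (\<lambda>x. rep_act ?D g (\<Phi> v) (i, x))" if i: "i \<in> I" for i
        unfolding comp[OF i] direct_sum_act(1)[OF i] p_act[OF i g v] by (rule T(3)[OF i g p_in[OF i]])
    qed (use \<Phi>_in is_repD(4)[OF D g] in blast)+
    show "bij_betw \<Phi> (rep_space R) (rep_space ?D)"
      unfolding bij_betw_def
    proof
      show "inj_on \<Phi> (rep_space R)"
      proof (rule inj_onI)
        fix u v assume uv: "u \<in> rep_space R" "v \<in> rep_space R" "\<Phi> u = \<Phi> v"
        have "p i u = p i v" if i: "i \<in> I" for i
        proof -
          have "T i (p i u) = T i (p i v)"
            using comp[OF i, of u] comp[OF i, of v] uv(3) by simp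
          then show ?thesis
            using inj_onD[OF bij_betw_imp_inj_on[OF T(2)[OF i]]] p_in[OF i] by blast
        qed
        then show "u = v"
          using sum_p[OF uv(1)] sum_p[OF uv(2)] by (metis (no_types, lifting) sum.cong)
      qed
      show "\<Phi> ` rep_space R = rep_space ?D"
      proof (rule equalityI; rule subsetI)
        fix f assume f: "f \<in> rep_space ?D"
        have "\<forall>i\<in>I. \<exists>u. u \<in> U i \<and> T i u = (\<lambda>x. f (i, x))"
        proof
          fix i assume i: "i \<in> I"
          have "(\<lambda>x. f (i, x)) \<in> T i ` U i"
            unfolding bij_betw_imp_surj_on[OF T(2)[OF i]] by (rule direct_sum_component[OF f i])
          then show "\<exists>u. u \<in> U i \<and> T i u = (\<lambda>x. f (i, x))"
            by (metis imageE)
        qed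
        then obtain u where u: "\<And>i. i \<in> I \<Longrightarrow> u i \<in> U i" "\<And>i. i \<in> I \<Longrightarrow> T i (u i) = (\<lambda>x. f (i, x))"
          by metis
        have "\<Phi> (\<Sum>i\<in>I. u i) = f"
        proof (rule direct_sum_eqI[of _ I S])
          show "(\<lambda>x. \<Phi> (\<Sum>i\<in>I. u i) (i, x)) = (\<lambda>x. f (i, x))" if i: "i \<in> I" for i
            unfolding comp[OF i] using p_sum[of i u, OF i u(1)] u(2)[OF i] by simp
        qed (use \<Phi>_in f in blast)+
        moreover have "(\<Sum>i\<in>I. u i) \<in> rep_space R"
          using u(1) U by (intro cfun.subspace_sum[OF is_repD(2)[OF R]]) blast
        ultimately show "f \<in> \<Phi> ` rep_space R"
          by blast
      qed (use \<Phi>_in in blast)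
    qed
  qed
qed

section \<open>Permutation modules on ordered set partitions\<close>

text \<open>Encodes ordered set partitions by colourings, block \<open>i\<close> being the colour
  \<open>Suc i\<close>, so that the results on shapes apply to them. Only the values on
  \<open>{1..sum_list l}\<close> matter.\<close>

definition set_partition :: "nat list \<Rightarrow> (nat \<Rightarrow> nat) \<Rightarrow> nat set list" where
  "set_partition l c = map (\<lambda>i. {x\<in>{1..sum_list l}. c x = Suc i}) [0..<length l]"

lemma set_partition_cong:
  "(\<And>x. x \<in> {1..sum_list l} \<Longrightarrow> c x = c' x) \<Longrightarrow> set_partition l c = set_partition l c'"
  unfolding set_partition_def by (intro map_cong refl Collect_cong) auto

lemma shape_colour_bound:
  assumes "shape n c (part l)" "x \<in> {1..n}"
  obtains i where "i < length l" "c x = Suc i"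
proof -
  have "c x \<ge> 1" "part l (c x) > 0"
    using shape_colour[OF assms] by (auto simp: part_def)
  then show ?thesis
    using that[of "c x - 1"] by (auto simp: part_def split: if_splits)
qed

lemma set_partition_inject:
  assumes "shape (sum_list l) c (part l)" "set_partition l c = set_partition l c'" "x \<in> {1..sum_list l}"
  shows "c x = c' x"
proof -
  obtain i where i: "i < length l" "c x = Suc i"
    using shape_colour_bound[OF assms(1,3)] .
  have "set_partition l c ! i = set_partition l c' ! i"
    using assms(2) by simp
  then have "{y\<in>{1..sum_list l}. c y = Suc i} = {y\<in>{1..sum_list l}. c' y = Suc i}"
    using i(1) by (simp add: set_partition_def)
  then have "x \<in> {y\<in>{1..sum_list l}. c' y = Suc i}"
    using assms(3) i(2) by blast
  then show ?thesis
    using i(2) by simp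
qed

lemma set_partition_image:
  assumes g: "g permutes {1..sum_list l}"
  shows "map ((`) g) (set_partition l c) = set_partition l (c \<circ> inv' g)"
proof -
  have "g ` {x\<in>{1..sum_list l}. c x = Suc i} = {x\<in>{1..sum_list l}. (c \<circ> inv' g) x = Suc i}" for i
  proof (rule equalityI; rule subsetI)
    fix y assume "y \<in> g ` {x\<in>{1..sum_list l}. c x = Suc i}"
    then obtain x where x: "x \<in> {1..sum_list l}" "c x = Suc i" "y = g x"
      by blast
    then have "y \<in> {1..sum_list l}"
      using permutes_in_image[OF g] by blast
    then show "y \<in> {x\<in>{1..sum_list l}. (c \<circ> inv' g) x = Suc i}"
      using x by (simp add: permutes_inverses[OF g])
  next
    fix y assume y: "y \<in> {x\<in>{1..sum_list l}. (c \<circ> inv' g) x = Suc i}"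
    then have "inv' g y \<in> {1..sum_list l}"
      using permutes_in_image[OF permutes_inv[OF g]] by blast
    then show "y \<in> g ` {x\<in>{1..sum_list l}. c x = Suc i}"
      using y by (intro image_eqI[of _ _ "inv' g y"]) (auto simp: permutes_inverses[OF g])
  qed
  then show ?thesis
    unfolding set_partition_def map_map by (intro map_cong refl) (simp only: comp_apply)
qed

lemma ordered_set_partitions_iff:
  "S \<in> ordered_set_partitions l \<longleftrightarrow> (\<exists>c. shape (sum_list l) c (part l) \<and> S = set_partition l c)"
proof
  let ?n = "sum_list l"
  assume S: "S \<in> ordered_set_partitions l"
  then have len: "length S = length l" and card: "\<And>i. i < length l \<Longrightarrow> card (S ! i) = l ! i"
    and disj: "\<And>i j. i < length l \<Longrightarrow> j < length l \<Longrightarrow> i \<noteq> j \<Longrightarrow> S ! i \<inter> S ! j = {}"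
    and un: "\<Union> (set S) = {1..?n}"
    by (auto simp: ordered_set_partitions_def)
  \<comment> \<open>The colour is the index of the block containing \<open>x\<close>, unique by
    disjointness and shifted because list positions start at 0.\<close>
  define c where "c x = Suc (THE i. i < length l \<and> x \<in> S ! i)" for x
  have c: "c x = Suc i" if "i < length l" "x \<in> S ! i" for x i
    unfolding c_def using that disj by (intro arg_cong[where f = Suc] the_equality) blast+
  have ex: "\<exists>i<length l. x \<in> S ! i" if "x \<in> {1..?n}" for x
    using that un len by (metis UnionE in_set_conv_nth)
  have sub: "S ! i \<subseteq> {1..?n}" if "i < length l" for i
    using Union_upper[OF nth_mem[of i S]] that len unfolding un by simp
  have cls: "{x\<in>{1..?n}. c x = Suc i} = S ! i" if i: "i < length l" for i
  proof (rule equalityI; rule subsetI)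
    fix x assume x: "x \<in> {x\<in>{1..?n}. c x = Suc i}"
    then obtain j where "j < length l" "x \<in> S ! j"
      using ex by blast
    then show "x \<in> S ! i"
      using c[of j x] x by simp
  qed (use c[OF i] sub[OF i] in auto)
  have "shape ?n c (part l)"
    unfolding shape_def
  proof
    fix i
    show "card {x\<in>{1..?n}. c x = i} = part l i"
    proof (cases "1 \<le> i \<and> i \<le> length l")
      case True
      then have i: "i - 1 < length l" "Suc (i - 1) = i"
        by auto
      show ?thesis
        using cls[OF i(1)] card[OF i(1)] True unfolding i(2) by (simp add: part_def)
    next
      case False
      have "c x \<noteq> i" if x: "x \<in> {1..?n}" for x
      proof -
        obtain j where "j < length l" "x \<in> S ! j"
          using ex[OF x] by blast
        then show ?thesis
          using c[of j x] False by auto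
      qed
      then have "{x\<in>{1..?n}. c x = i} = {}"
        by blast
      then have "card {x\<in>{1..?n}. c x = i} = 0"
        by (simp only: card.empty)
      moreover have "part l i = 0"
        using False unfolding part_def by (rule if_not_P)
      ultimately show ?thesis
        by (rule trans[OF _ HOL.sym])
    qed
  qed
  moreover have "S = set_partition l c"
    by (rule nth_equalityI) (simp_all add: set_partition_def len cls del: atLeastAtMost_iff One_nat_def)
  ultimately show "\<exists>c. shape ?n c (part l) \<and> S = set_partition l c"
    by blast
next
  let ?n = "sum_list l"
  assume "\<exists>c. shape ?n c (part l) \<and> S = set_partition l c"
  then obtain c where c: "shape ?n c (part l)" and S: "S = set_partition l c"
    by blast
  have len: "length S = length l"
    by (simp add: S set_partition_def)
  have nth: "S ! i = {x\<in>{1..?n}. c x = Suc i}" if "i < length l" for i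
    using that by (simp add: S set_partition_def)
  show "S \<in> ordered_set_partitions l"
    unfolding ordered_set_partitions_def
  proof (intro CollectI conjI allI impI len)
    show "card (S ! i) = l ! i" if "i < length l" for i
      using c that unfolding nth[OF that] shape_def by (simp add: part_def)
    show "S ! i \<inter> S ! j = {}" if "i < length l" "j < length l" "i \<noteq> j" for i j
      using that by (auto simp: nth)
    show "\<Union> (set S) = {1..?n}"
    proof (rule equalityI; rule subsetI)
      fix x assume x: "x \<in> {1..?n}"
      obtain i where i: "i < length l" "c x = Suc i"
        using shape_colour_bound[OF c x] .
      then have "x \<in> S ! i"
        using x by (simp add: nth)
      then show "x \<in> \<Union> (set S)"
        using nth_mem[of i S] i(1) len by auto
    next
      fix x assume "x \<in> \<Union> (set S)"
      then obtain i where "i < length l" "x \<in> S ! i"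
        using len by (auto simp: in_set_conv_nth)
      then show "x \<in> {1..?n}"
        by (simp add: nth)
    qed
  qed
qed

text \<open>The permutation module of shape \<open>l\<close>, twisted by a character \<open>\<chi>\<close> with values \<open>\<plusminus>1\<close>.\<close>

locale young_rep =
  fixes n :: nat and l :: "nat list" and \<chi> :: "(nat \<Rightarrow> nat) \<Rightarrow> complex"
    and Y :: "(nat \<Rightarrow> nat, nat set list) rep"
  assumes size: "sum_list l = n"
    and space: "rep_space Y = functions_on (ordered_set_partitions l)"
    and action: "g permutes {1..n} \<Longrightarrow> rep_act Y g f S =
      (if S \<in> ordered_set_partitions l then \<chi> g * f (map ((`) (inv' g)) S) else 0)"
    and chi_comp: "g permutes {1..n} \<Longrightarrow> h permutes {1..n} \<Longrightarrow> \<chi> (g \<circ> h) = \<chi> g * \<chi> h"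
    and chi_id: "\<chi> id = 1"
    and chi_values: "\<chi> g = 1 \<or> \<chi> g = - 1"
begin

abbreviation "OSP \<equiv> ordered_set_partitions l"

lemma OSP_iff: "S \<in> OSP \<longleftrightarrow> (\<exists>c. shape n c (part l) \<and> S = set_partition l c)"
  using ordered_set_partitions_iff size by simp

lemma set_partition_in: "shape n c (part l) \<Longrightarrow> set_partition l c \<in> OSP"
  using OSP_iff by blast

text \<open>The inverse in the action on functions cancels the inverse by which a permutation acts
  on colourings, leaving precomposition with \<open>g\<close>.\<close>

lemma map_inv:
  assumes "g permutes {1..n}"
  shows "map ((`) (inv' g)) (set_partition l c) = set_partition l (c \<circ> g)"
  using set_partition_image[of "inv' g" l c] permutes_inv[OF assms] size
  by (simp only: permutes_inv_inv[OF assms])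

lemma action_set_partition:
  assumes "g permutes {1..n}" "shape n c (part l)"
  shows "rep_act Y g f (set_partition l c) = \<chi> g * f (set_partition l (c \<circ> g))"
  unfolding action[OF assms(1)] map_inv[OF assms(1)] using set_partition_in[OF assms(2)] by simp

lemma functions_eqI:
  assumes "f \<in> rep_space Y" "f' \<in> rep_space Y"
    and "\<And>c. shape n c (part l) \<Longrightarrow> f (set_partition l c) = f' (set_partition l c)"
  shows "f = f'"
proof
  fix S
  show "f S = f' S"
    using assms unfolding space functions_on_def by (cases "S \<in> OSP") (auto simp: OSP_iff)
qed

lemma action_in: "g permutes {1..n} \<Longrightarrow> rep_act Y g f \<in> rep_space Y"
  by (simp add: space functions_on_def action)

lemma action_add: "g permutes {1..n} \<Longrightarrow> rep_act Y g (f + f') = rep_act Y g f + rep_act Y g f'"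
  by (rule ext) (simp add: action algebra_simps)

lemma action_scale: "g permutes {1..n} \<Longrightarrow> rep_act Y g (fscale a f) = fscale a (rep_act Y g f)"
  by (rule ext) (simp add: action fscale_def)

lemma subspace_Y: "cfun.subspace (rep_space Y)"
  by (rule cfun.subspaceI) (auto simp: space functions_on_def fscale_def)

lemma is_rep_Y: "is_rep (sym_group n) Y"
  unfolding is_rep_def
proof (intro conjI ballI sym_group_is_group subspace_Y)
  fix v assume v: "v \<in> rep_space Y"
  show "rep_act Y \<one>\<^bsub>sym_group n\<^esub> v = v"
    unfolding sym_group_one
  proof (rule functions_eqI[OF action_in[OF permutes_id] v])
    show "rep_act Y id v (set_partition l c) = v (set_partition l c)" if "shape n c (part l)" for c
      using action_set_partition[OF permutes_id that] by (simp only: chi_id o_id mult_1_left)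
  qed
next
  fix g assume "g \<in> carrier (sym_group n)"
  then have g: "g permutes {1..n}"
    by (simp add: sym_group_carrier)
  show "linear_map_on (rep_space Y) (rep_act Y g)"
    using action_add[OF g] action_scale[OF g] by (simp add: linear_map_on_def)
  show "rep_act Y g ` rep_space Y \<subseteq> rep_space Y"
    using action_in[OF g] by blast
  fix h v assume "h \<in> carrier (sym_group n)" and v: "v \<in> rep_space Y"
  then have h: "h permutes {1..n}"
    by (simp add: sym_group_carrier)
  have gh: "g \<circ> h permutes {1..n}"
    by (rule permutes_compose[OF h g])
  show "rep_act Y (g \<otimes>\<^bsub>sym_group n\<^esub> h) v = rep_act Y g (rep_act Y h v)"
    unfolding sym_group_mult
  proof (rule functions_eqI[OF action_in[OF gh] action_in[OF g]])
    fix c assume c: "shape n c (part l)"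
    show "rep_act Y (g \<circ> h) v (set_partition l c) = rep_act Y g (rep_act Y h v) (set_partition l c)"
      by (simp only: action_set_partition[OF gh c] action_set_partition[OF g c]
        action_set_partition[OF h shape_comp[OF c g]] chi_comp[OF g h] comp_assoc mult.assoc)
  qed
qed

end

section \<open>\<open>rho2\<close> as a representation, with the subrepresentations
  \<open>U l\<close>\<close>

context matching_rep
begin

lemma rep_space_rho2: "rep_space (rho2 n) = F"
  by (simp add: rho2_def F_def)

lemma is_rep_rho2: "is_rep (sym_group n) (rho2 n)"
  unfolding is_rep_def rep_space_rho2
proof (intro conjI ballI sym_group_is_group invariantD(1)[OF invariant_F])
  fix v assume v: "v \<in> F"
  show "rep_act (rho2 n) \<one>\<^bsub>sym_group n\<^esub> v = v"
    unfolding sym_group_one rho2_act[OF permutes_id v] by (rule act_id)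
next
  fix g assume "g \<in> carrier (sym_group n)"
  then have g: "g permutes {1..n}"
    by (simp add: sym_group_carrier)
  have sub: "cfun.subspace F"
    by (rule invariantD(1)[OF invariant_F])
  show "linear_map_on F (rep_act (rho2 n) g)"
    unfolding linear_map_on_def
  proof (intro conjI ballI allI)
    show "rep_act (rho2 n) g (u + v) = rep_act (rho2 n) g u + rep_act (rho2 n) g v"
      if "u \<in> F" "v \<in> F" for u v
      by (simp only: rho2_act[OF g] that cfun.subspace_add[OF sub that] act_add)
    show "rep_act (rho2 n) g (fscale a v) = fscale a (rep_act (rho2 n) g v)" if "v \<in> F" for a v
      by (simp only: rho2_act[OF g] that cfun.subspace_scale[OF sub that] act_scale)
  qed
  show "rep_act (rho2 n) g ` F \<subseteq> F"
    using invariantD(2)[OF invariant_F g] rho2_act[OF g] by auto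
  fix h v assume "h \<in> carrier (sym_group n)" and v: "v \<in> F"
  then have h: "h permutes {1..n}"
    by (simp add: sym_group_carrier)
  show "rep_act (rho2 n) (g \<otimes>\<^bsub>sym_group n\<^esub> h) v = rep_act (rho2 n) g (rep_act (rho2 n) h v)"
    unfolding sym_group_mult
    by (simp only: rho2_act[OF permutes_compose[OF h g] v] rho2_act[OF h v]
      rho2_act[OF g invariantD(2)[OF invariant_F h v]] act_comp[OF g h])
qed

lemma invariant_subspace_rho2:
  assumes "W \<subseteq> F"
  shows "invariant_subspace (sym_group n) (rho2 n) W \<longleftrightarrow> invariant W"
proof -
  have "rep_act (rho2 n) g u = act g u" if "g permutes {1..n}" "u \<in> W" for g u
    using rho2_act[OF that(1)] that(2) assms by blast
  then show ?thesis
    using assms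
    by (auto simp: invariant_subspace_def invariant_def rep_space_rho2 sym_group_carrier image_subset_iff)
qed

lemma irreducible_rep_U:
  assumes l: "l \<in> TP n"
  shows "irreducible_rep (sym_group n) (rho2 n\<lparr>rep_space := U l\<rparr>)"
proof -
  let ?R = "rho2 n\<lparr>rep_space := U l\<rparr>"
  have "is_rep (sym_group n) ?R"
    using invariant_subspace_rho2[OF U_subset_F[OF l]] invariant_U
    by (intro is_rep_subspace is_rep_rho2) blast
  moreover have "U l \<noteq> {0}"
    using wvec_in_U weight(3)[OF l] by blast
  moreover have "W = {0} \<or> W = U l" if W: "invariant_subspace (sym_group n) ?R W" for W
  proof -
    have sub: "W \<subseteq> U l"
      using W by (simp add: invariant_subspace_def)
    then have "invariant_subspace (sym_group n) (rho2 n) W"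
      using W U_subset_F[OF l] by (auto simp: invariant_subspace_def rep_space_rho2)
    then have inv: "invariant W"
      using invariant_subspace_rho2 sub U_subset_F[OF l] by blast
    have "0 \<in> W"
      by (rule cfun.subspace_0[OF invariantD(1)[OF inv]])
    then show ?thesis
      using U_irreducible[OF l inv sub] by blast
  qed
  ultimately show ?thesis
    unfolding irreducible_rep_def by simp
qed

end

section \<open>Uniqueness of the irreducible representation of a given shape\<close>

locale young_matching = matching_rep n + young_rep n l \<chi> Y
  for n :: nat and l :: "nat list" and \<chi> and Y
begin

text \<open>The embedding sends \<open>u\<close> to its inner products with the translates of the semi-invariant \<open>v\<close>.\<close>

lemma semi_invariant_occurs:
  assumes W0: "invariant W0" "W0 \<subseteq> F"
    and irr: "\<And>W w. invariant W \<Longrightarrow> W \<subseteq> W0 \<Longrightarrow> w \<in> W \<Longrightarrow> w \<noteq> 0 \<Longrightarrow> W = W0"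
    and v: "v \<in> W0" "v \<noteq> 0" and c: "shape n c (part l)"
    and stab: "\<And>h. h \<in> colour_stab c \<Longrightarrow> act h v = fscale (\<chi> h) v"
  shows "occurs_in (sym_group n) (rho2 n\<lparr>rep_space := W0\<rparr>) Y"
proof -
  \<comment> \<open>Some permutation carrying the partition of \<open>c\<close> to \<open>S\<close>.
    The factor \<open>\<chi> (rep S)\<close> in \<open>\<Phi>\<close> makes the value independent of
    this choice, because \<open>v\<close> is semi-invariant with the same character.\<close>
  define rep where "rep S = (SOME g. g permutes {1..n} \<and> S = set_partition l (c \<circ> inv' g))" for S
  define \<Phi> where "\<Phi> u S = (if S \<in> OSP then \<chi> (rep S) * ip u (act (rep S) v) else 0)" for u S
  have cnj_chi: "\<chi> g * cnj (\<chi> g) = 1" for g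
    using chi_values[of g] by auto
  have indep: "\<chi> g * ip u (act g v) = \<chi> h * ip u (act h v)"
    if g: "g permutes {1..n}" and h: "h permutes {1..n}"
      and eq: "set_partition l (c \<circ> inv' g) = set_partition l (c \<circ> inv' h)" for g h u
  proof -
    define k where "k = inv' h \<circ> g"
    have k: "k permutes {1..n}"
      unfolding k_def by (rule permutes_compose[OF g permutes_inv[OF h]])
    have g_eq: "g = h \<circ> k"
      by (auto simp: k_def fun_eq_iff permutes_inverses[OF h])
    have "c (k x) = c x" for x
    proof (cases "x \<in> {1..n}")
      case True
      then have "g x \<in> {1..n}"
        using permutes_in_image[OF g] by blast
      then have "(c \<circ> inv' g) (g x) = (c \<circ> inv' h) (g x)"
        using set_partition_inject[OF _ eq] shape_comp[OF c permutes_inv[OF g]] size by simp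
      then show ?thesis
        by (simp add: k_def permutes_inverses[OF g])
    next
      case False
      then show ?thesis
        using permutes_not_in[OF k] by simp
    qed
    then have ks: "k \<in> colour_stab c"
      using k by (simp add: colour_stab_def)
    have "act g v = fscale (\<chi> k) (act h v)"
      unfolding g_eq act_comp[OF h k] stab[OF ks] act_scale ..
    then have "ip u (act g v) = cnj (\<chi> k) * ip u (act h v)"
      by (metis ip_cnj ip_scale complex_cnj_mult)
    moreover have "\<chi> g = \<chi> h * \<chi> k"
      unfolding g_eq by (rule chi_comp[OF h k])
    ultimately show ?thesis
      using cnj_chi[of k] by (simp add: mult.assoc mult.left_commute)
  qed
  have \<Phi>_eq: "\<Phi> u (set_partition l (c \<circ> inv' g)) = \<chi> g * ip u (act g v)" if g: "g permutes {1..n}" for u g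
  proof -
    let ?S = "set_partition l (c \<circ> inv' g)"
    have "rep ?S permutes {1..n} \<and> ?S = set_partition l (c \<circ> inv' (rep ?S))"
      unfolding rep_def by (rule someI[where x = g]) (use g in blast)
    then have "\<chi> (rep ?S) * ip u (act (rep ?S) v) = \<chi> g * ip u (act g v)"
      by (intro indep[OF _ g]) auto
    then show ?thesis
      unfolding \<Phi>_def using set_partition_in[OF shape_comp[OF c permutes_inv[OF g]]] by simp
  qed
  have orbit: "\<exists>g. g permutes {1..n} \<and> set_partition l c' = set_partition l (c \<circ> inv' g)"
    if c': "shape n c' (part l)" for c'
  proof -
    obtain h where h: "h permutes {1..n}" "\<And>x. x \<in> {1..n} \<Longrightarrow> c (h x) = c' x"
      using same_shape_conjugate[OF c' c] by metis
    have "set_partition l c' = set_partition l (c \<circ> inv' (inv' h))"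
      unfolding permutes_inv_inv[OF h(1)] using h(2) size by (intro set_partition_cong) simp
    then show ?thesis
      using permutes_inv[OF h(1)] by blast
  qed
  have \<Phi>_in: "\<Phi> u \<in> rep_space Y" for u
    by (simp add: space functions_on_def \<Phi>_def)
  have \<Phi>_add: "\<Phi> (u + u') = \<Phi> u + \<Phi> u'" for u u'
    by (rule ext) (simp add: \<Phi>_def ip_add algebra_simps)
  have \<Phi>_scale: "\<Phi> (fscale a u) = fscale a (\<Phi> u)" for a u
    by (rule ext) (simp add: \<Phi>_def ip_scale fscale_apply)
  have \<Phi>_zero: "\<Phi> 0 = 0"
    using \<Phi>_scale[of 0 0] by simp
  have \<Phi>_act: "\<Phi> (act h u) = rep_act Y h (\<Phi> u)" if h: "h permutes {1..n}" for h u
  proof (rule functions_eqI[OF \<Phi>_in action_in[OF h]])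
    fix c' assume c': "shape n c' (part l)"
    obtain g where g: "g permutes {1..n}" and S: "set_partition l c' = set_partition l (c \<circ> inv' g)"
      using orbit[OF c'] by blast
    note hi = permutes_inv[OF h]
    have hg: "inv' h \<circ> g permutes {1..n}"
      by (rule permutes_compose[OF g hi])
    have "rep_act Y h (\<Phi> u) (set_partition l c') = \<chi> h * \<Phi> u (set_partition l (c \<circ> inv' g \<circ> h))"
      unfolding S by (rule action_set_partition[OF h shape_comp[OF c permutes_inv[OF g]]])
    also have "c \<circ> inv' g \<circ> h = c \<circ> inv' (inv' h \<circ> g)"
      using o_inv_distrib[OF permutes_bij[OF hi] permutes_bij[OF g]] permutes_inv_inv[OF h]
      by (simp only: comp_assoc)
    also have "\<chi> h * \<Phi> u (set_partition l (c \<circ> inv' (inv' h \<circ> g)))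
        = \<chi> h * \<chi> (inv' h \<circ> g) * ip u (act (inv' h \<circ> g) v)"
      unfolding \<Phi>_eq[OF hg] by simp
    also have "\<chi> h * \<chi> (inv' h \<circ> g) = \<chi> (h \<circ> (inv' h \<circ> g))"
      by (rule chi_comp[OF h hg, symmetric])
    also have "h \<circ> (inv' h \<circ> g) = g"
      by (auto simp: fun_eq_iff permutes_inverses[OF h])
    also have "ip u (act (inv' h \<circ> g) v) = ip (act h u) (act g v)"
      by (simp only: act_comp[OF hi g] ip_act_left[OF h])
    finally show "\<Phi> (act h u) (set_partition l c') = rep_act Y h (\<Phi> u) (set_partition l c')"
      unfolding S \<Phi>_eq[OF g] by (rule HOL.sym)
  qed
  have sub0: "cfun.subspace W0"
    by (rule invariantD(1)[OF W0(1)])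
  \<comment> \<open>The kernel is an invariant subspace not containing \<open>v\<close>, since
    \<open>\<Phi> v\<close> takes the value \<open>ip v v\<close> at the partition of
    \<open>c\<close>; irreducibility makes it zero.\<close>
  have kernel: "u = 0" if u: "u \<in> W0" "\<Phi> u = 0" for u
  proof (rule ccontr)
    assume nz: "u \<noteq> 0"
    define K where "K = {u\<in>W0. \<Phi> u = 0}"
    have "invariant K"
      unfolding invariant_def
    proof (intro conjI allI impI)
      show "cfun.subspace K"
        by (rule cfun.subspaceI) (use sub0 in \<open>auto simp: K_def \<Phi>_zero \<Phi>_add \<Phi>_scale
          cfun.subspace_0 cfun.subspace_add cfun.subspace_scale\<close>)
      show "act g w \<in> K" if "g permutes {1..n}" "w \<in> K" for g w
        using that invariantD(2)[OF W0(1) that(1)] \<Phi>_act[OF that(1), of w] \<Phi>_act[OF that(1), of 0]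
        by (auto simp: K_def \<Phi>_zero)
    qed
    then have "K = W0"
      by (rule irr[of K u]) (use u nz in \<open>auto simp: K_def\<close>)
    then have "v \<in> K"
      using v(1) by blast
    then have "\<Phi> v (set_partition l (c \<circ> inv' id)) = 0"
      by (simp add: K_def)
    then have "ip v (act id v) = 0"
      unfolding \<Phi>_eq[OF permutes_id] chi_id by simp
    then show False
      using ip_self_pos[of v] v W0(2) unfolding act_id by blast
  qed
  define W where "W = \<Phi> ` W0"
  have W: "invariant_subspace (sym_group n) Y W"
    unfolding invariant_subspace_def
  proof (intro conjI ballI)
    show "cfun.subspace W"
    proof (rule cfun.subspaceI)
      show "0 \<in> W"
        unfolding W_def using \<Phi>_zero cfun.subspace_0[OF sub0] by (metis image_eqI)
      show "x + y \<in> W" if "x \<in> W" "y \<in> W" for x y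
        using that unfolding W_def by (auto simp: \<Phi>_add[symmetric] intro: cfun.subspace_add[OF sub0])
      show "fscale a x \<in> W" if "x \<in> W" for a x
        using that unfolding W_def by (auto simp: \<Phi>_scale[symmetric] intro: cfun.subspace_scale[OF sub0])
    qed
    show "W \<subseteq> rep_space Y"
      unfolding W_def using \<Phi>_in by blast
    fix g assume "g \<in> carrier (sym_group n)"
    then have g: "g permutes {1..n}"
      by (simp add: sym_group_carrier)
    show "rep_act Y g ` W \<subseteq> W"
      unfolding W_def using invariantD(2)[OF W0(1) g] by (auto simp: \<Phi>_act[OF g, symmetric])
  qed
  have "rep_isomorphic (sym_group n) (rho2 n\<lparr>rep_space := W0\<rparr>) (Y\<lparr>rep_space := W\<rparr>)"
  proof (rule rep_isomorphicI)
    show "is_rep (sym_group n) (rho2 n\<lparr>rep_space := W0\<rparr>)"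
      using invariant_subspace_rho2[OF W0(2)] W0(1) by (intro is_rep_subspace is_rep_rho2) blast
    show "is_rep (sym_group n) (Y\<lparr>rep_space := W\<rparr>)"
      by (rule is_rep_subspace[OF is_rep_Y W])
    show "linear_map_on (rep_space (rho2 n\<lparr>rep_space := W0\<rparr>)) \<Phi>"
      by (simp add: linear_map_on_def \<Phi>_add \<Phi>_scale)
    have "inj_on \<Phi> W0"
    proof (rule inj_onI)
      fix x y assume xy: "x \<in> W0" "y \<in> W0" "\<Phi> x = \<Phi> y"
      have "\<Phi> (x - y) + \<Phi> y = \<Phi> x"
        by (simp only: \<Phi>_add[symmetric] diff_add_cancel)
      then have "\<Phi> (x - y) = 0"
        using xy(3) by (metis add_left_imp_eq add.right_neutral add.commute)
      then show "x = y"
        using kernel[OF cfun.subspace_diff[OF sub0 xy(1,2)]] by simp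
    qed
    then show "bij_betw \<Phi> (rep_space (rho2 n\<lparr>rep_space := W0\<rparr>)) (rep_space (Y\<lparr>rep_space := W\<rparr>))"
      by (simp add: bij_betw_def W_def)
    fix g u assume "g \<in> carrier (sym_group n)" and u: "u \<in> rep_space (rho2 n\<lparr>rep_space := W0\<rparr>)"
    then have g: "g permutes {1..n}"
      by (simp add: sym_group_carrier)
    have "rep_act (rho2 n) g u = act g u"
      using rho2_act[OF g] u W0(2) by auto
    then show "\<Phi> (rep_act (rho2 n\<lparr>rep_space := W0\<rparr>) g u) = rep_act (Y\<lparr>rep_space := W\<rparr>) g (\<Phi> u)"
      using \<Phi>_act[OF g] by simp
  qed
  then show ?thesis
    unfolding occurs_in_def using W by blast
qed

end

text \<open>Some translate of a nonzero vector is nonzero at the partition of \<open>c\<close>.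
  Summing over the stabiliser multiplies this value by the order of the stabiliser, as every term
  agrees there.\<close>

lemma (in young_rep) stabiliser_vector:
  assumes W: "invariant_subspace (sym_group n) Y W" "W \<noteq> {0}" and c: "shape n c (part l)"
    and triv: "\<And>g. \<chi> g = 1"
  obtains f where "f \<in> W" "f \<noteq> 0"
    "\<And>k. k permutes {1..n} \<Longrightarrow> (\<And>x. c (k x) = c x) \<Longrightarrow> rep_act Y k f = f"
proof -
  have sub: "cfun.subspace W" and WY: "W \<subseteq> rep_space Y"
    and Wact: "\<And>g w. g permutes {1..n} \<Longrightarrow> w \<in> W \<Longrightarrow> rep_act Y g w \<in> W"
    using W(1) unfolding invariant_subspace_def sym_group_carrier[symmetric] by blast+
  obtain f0 where f0: "f0 \<in> W" "f0 \<noteq> 0"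
    using W(2) cfun.subspace_0[OF sub] by blast
  have "\<exists>c'. shape n c' (part l) \<and> f0 (set_partition l c') \<noteq> 0"
  proof (rule ccontr)
    assume none: "\<not> ?thesis"
    have "f0 = 0"
      by (rule functions_eqI) (use f0 WY none cfun.subspace_0[OF subspace_Y] in auto)
    then show False
      using f0(2) by simp
  qed
  then obtain c' where c': "shape n c' (part l)" "f0 (set_partition l c') \<noteq> 0"
    by blast
  obtain h where h: "h permutes {1..n}" "\<And>x. x \<in> {1..n} \<Longrightarrow> c (h x) = c' x"
    using same_shape_conjugate[OF c'(1) c] by metis
  define f1 where "f1 = rep_act Y h f0"
  have f1: "f1 \<in> W"
    unfolding f1_def by (rule Wact[OF h(1) f0(1)])
  have "set_partition l c' = set_partition l (c \<circ> h)"
    using h(2) size by (intro set_partition_cong) simp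
  then have f1_c: "f1 (set_partition l c) \<noteq> 0"
    unfolding f1_def action_set_partition[OF h(1) c] using c'(2) triv by simp
  define St where "St = {k. k permutes {1..n} \<and> (\<forall>x. c (k x) = c x)}"
  have fin: "finite St"
    by (rule finite_subset[OF _ finite_permutations[of "{1..n}"]]) (auto simp: St_def)
  have St_perm: "k permutes {1..n}" if "k \<in> St" for k
    using that by (simp add: St_def)
  define f2 where "f2 = (\<Sum>k\<in>St. rep_act Y k f1)"
  have f2: "f2 \<in> W"
    unfolding f2_def by (intro cfun.subspace_sum[OF sub] Wact f1 St_perm)
  have f2_eq: "f2 (set_partition l c') = (\<Sum>k\<in>St. f1 (set_partition l (c' \<circ> k)))"
    if "shape n c' (part l)" for c'
    unfolding f2_def sum_fun_apply
    by (intro sum.cong refl) (simp only: action_set_partition[OF St_perm that] triv mult_1_left)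
  have "c \<circ> k = c" if "k \<in> St" for k
    using that by (auto simp: St_def)
  then have "f2 (set_partition l c) = of_nat (card St) * f1 (set_partition l c)"
    unfolding f2_eq[OF c] by simp
  moreover have "id \<in> St"
    by (simp add: St_def permutes_id)
  ultimately have "f2 (set_partition l c) \<noteq> 0"
    using f1_c fin by auto
  then have "f2 \<noteq> 0"
    by auto
  moreover have "rep_act Y k f2 = f2" if k: "k permutes {1..n}" and ck: "\<And>x. c (k x) = c x" for k
  proof (rule functions_eqI[OF action_in[OF k]])
    show "f2 \<in> rep_space Y"
      using f2 WY by blast
    fix c' assume c': "shape n c' (part l)"
    have k_St: "k \<circ> g \<in> St" if "g \<in> St" for g
      using that k ck permutes_compose[OF _ k] by (simp add: St_def)
    have ki_St: "inv' k \<circ> g \<in> St" if "g \<in> St" for g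
    proof -
      have "c (inv' k x) = c x" for x
        using ck[of "inv' k x"] by (simp add: permutes_inverses[OF k])
      then show ?thesis
        using that permutes_compose[OF _ permutes_inv[OF k]] by (simp add: St_def)
    qed
    have bij: "bij_betw ((\<circ>) k) St St"
      by (rule bij_betwI[where g = "(\<circ>) (inv' k)"])
        (use k_St ki_St in \<open>auto simp: fun_eq_iff permutes_inverses[OF k]\<close>)
    have "rep_act Y k f2 (set_partition l c') = (\<Sum>g\<in>St. f1 (set_partition l (c' \<circ> (k \<circ> g))))"
      by (simp only: action_set_partition[OF k c'] triv mult_1_left f2_eq[OF shape_comp[OF c' k]]
        comp_assoc)
    also have "\<dots> = f2 (set_partition l c')"
      unfolding f2_eq[OF c'] by (rule sum.reindex_bij_betw[OF bij])
    finally show "rep_act Y k f2 (set_partition l c') = f2 (set_partition l c')" .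
  qed
  ultimately show ?thesis
    using that[OF f2] by blast
qed

text \<open>With an alternating character a fixed vector vanishes wherever two points share both
  colours. The remaining partitions are 0-1 matrices with conjugate margins, which form a single
  orbit of the stabiliser, so one value determines the vector.\<close>

lemma (in young_rep) stabiliser_vector_unique:
  assumes alt: "\<And>x y. x \<noteq> y \<Longrightarrow> \<chi> (swap x y) = - 1"
    and c: "shape n c p" and cp: "conj_pair p (part l)"
    and z: "z \<in> rep_space Y" "z' \<in> rep_space Y" "z' \<noteq> 0"
    and fix_z: "\<And>k. k permutes {1..n} \<Longrightarrow> (\<And>x. c (k x) = c x) \<Longrightarrow> rep_act Y k z = z"
    and fix_z': "\<And>k. k permutes {1..n} \<Longrightarrow> (\<And>x. c (k x) = c x) \<Longrightarrow> rep_act Y k z' = z'"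
  obtains a where "z = fscale a z'"
proof -
  have transversal: "inj_on (\<lambda>x. (c x, d x)) {1..n}"
    if d: "shape n d (part l)" and nz: "f (set_partition l d) \<noteq> 0"
      and fix_f: "\<And>k. k permutes {1..n} \<Longrightarrow> (\<And>x. c (k x) = c x) \<Longrightarrow> rep_act Y k f = f" for f d
  proof (rule inj_onI, rule ccontr)
    fix x y assume x: "x \<in> {1..n}" and y: "y \<in> {1..n}" and eq: "(c x, d x) = (c y, d y)" and ne: "x \<noteq> y"
    have "c (swap x y u) = c u" "d (swap x y u) = d u" for u
      using eq by (auto simp: Transposition.transpose_def)
    then have "rep_act Y (swap x y) f = f" "d \<circ> swap x y = d"
      using fix_f[OF swap_permutes[OF x y]] by (auto simp: fun_eq_iff)
    then have "f (set_partition l d) = - f (set_partition l d)"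
      using action_set_partition[OF swap_permutes[OF x y] d, of f] alt[OF ne] by simp
    then show False
      using nz by simp
  qed
  obtain d0 where d0: "shape n d0 (part l)" "z' (set_partition l d0) \<noteq> 0"
  proof (rule ccontr)
    assume none: "\<not> thesis"
    have "z' = 0"
      by (rule functions_eqI[OF z(2) cfun.subspace_0[OF subspace_Y]]) (use that none in auto)
    then show False
      using z(3) by simp
  qed
  let ?S0 = "set_partition l d0"
  have inj0: "inj_on (\<lambda>x. (c x, d0 x)) {1..n}"
    by (rule transversal[OF d0 fix_z'])
  have "\<exists>\<sigma>. z (set_partition l d) = \<sigma> * z ?S0 \<and> z' (set_partition l d) = \<sigma> * z' ?S0"
    if d: "shape n d (part l)" for d
  proof (cases "z (set_partition l d) = 0 \<and> z' (set_partition l d) = 0")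
    case False
    then have inj: "inj_on (\<lambda>x. (c x, d x)) {1..n}"
      using transversal[OF d _ fix_z] transversal[OF d _ fix_z'] by blast
    obtain h where h: "h permutes {1..n}"
      and hx: "\<And>x. x \<in> {1..n} \<Longrightarrow> (c (h x), d0 (h x)) = (c x, d x)"
      using relabelling_permutation[OF transversal_bij_diagram[OF c d cp inj]
          transversal_bij_diagram[OF c d0(1) cp inj0]] by metis
    have ch: "c (h x) = c x" for x
      using hx[of x] permutes_not_in[OF h, of x] by (cases "x \<in> {1..n}") auto
    have S: "set_partition l (d0 \<circ> h) = set_partition l d"
      using hx size by (intro set_partition_cong) simp
    have "f ?S0 = \<chi> h * f (set_partition l d)"
      if "\<And>k. k permutes {1..n} \<Longrightarrow> (\<And>x. c (k x) = c x) \<Longrightarrow> rep_act Y k f = f" for f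
      using action_set_partition[OF h d0(1), of f] that[OF h ch] S by simp
    from this[of z, OF fix_z] this[of z', OF fix_z'] show ?thesis
      using chi_values[of h] by (intro exI[of _ "\<chi> h"]) auto
  qed (use exI[of _ 0] in auto)
  then have ratio: "z (set_partition l d) = z ?S0 / z' ?S0 * z' (set_partition l d)"
    if "shape n d (part l)" for d
    using that d0(2) by (metis mult.assoc mult.commute nonzero_eq_divide_eq times_divide_eq_left)
  have "z = fscale (z ?S0 / z' ?S0) z'"
  proof (rule functions_eqI[OF z(1) cfun.subspace_scale[OF subspace_Y z(2)]])
    show "z (set_partition l d) = fscale (z ?S0 / z' ?S0) z' (set_partition l d)"
      if "shape n d (part l)" for d
      unfolding fscale_apply by (rule ratio[OF that])
  qed
  then show ?thesis
    by (rule that)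
qed

text \<open>Occurring in \<open>M\<close> provides a vector fixed by the stabiliser of
  \<open>c\<close>, which is transported into \<open>N\<close>, where such vectors form a line. The
  copies of \<open>V\<close> and \<open>V'\<close> in \<open>N\<close> therefore share a nonzero
  vector, and two irreducible subspaces that meet coincide.\<close>

lemma irreducible_same_type:
  assumes M: "young_rep n l \<chi> M" and N: "young_rep n l' \<chi>' N"
    and triv: "\<And>g. \<chi> g = 1" and alt: "\<And>x y. x \<noteq> y \<Longrightarrow> \<chi>' (swap x y) = - 1"
    and c: "shape n c (part l)" and cp: "conj_pair (part l) (part l')"
    and V: "irreducible_rep (sym_group n) V" "occurs_in (sym_group n) V M" "occurs_in (sym_group n) V N"
    and V': "irreducible_rep (sym_group n) V'" "occurs_in (sym_group n) V' M" "occurs_in (sym_group n) V' N"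
  shows "rep_isomorphic (sym_group n) V V'"
proof -
  let ?G = "sym_group n"
  let ?fixed = "\<lambda>z. \<forall>k. k permutes {1..n} \<longrightarrow> (\<forall>x. c (k x) = c x) \<longrightarrow> rep_act N k z = z"
  have ex: "\<exists>Z z. invariant_subspace ?G N Z \<and> rep_isomorphic ?G Q (N\<lparr>rep_space := Z\<rparr>)
      \<and> irreducible_rep ?G (N\<lparr>rep_space := Z\<rparr>) \<and> z \<in> Z \<and> z \<noteq> 0 \<and> ?fixed z"
    if Q: "irreducible_rep ?G Q" "occurs_in ?G Q M" "occurs_in ?G Q N" for Q :: "(nat \<Rightarrow> nat, 'z) rep"
  proof -
    obtain W where W: "invariant_subspace ?G M W" "rep_isomorphic ?G Q (M\<lparr>rep_space := W\<rparr>)"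
      using Q(2) by (auto simp: occurs_in_def)
    obtain Z where Z: "invariant_subspace ?G N Z" "rep_isomorphic ?G Q (N\<lparr>rep_space := Z\<rparr>)"
      using Q(3) by (auto simp: occurs_in_def)
    have "irreducible_rep ?G (M\<lparr>rep_space := W\<rparr>)"
      by (rule irreducible_rep_iso[OF Q(1) W(2)])
    then have "W \<noteq> {0}"
      by (simp add: irreducible_rep_def)
    then obtain f where f: "f \<in> W" "f \<noteq> 0"
      "\<And>k. k permutes {1..n} \<Longrightarrow> (\<And>x. c (k x) = c x) \<Longrightarrow> rep_act M k f = f"
      using young_rep.stabiliser_vector[OF M W(1) _ c triv] by metis
    obtain T where T: "linear_map_on W T" "bij_betw T W Z"
      "\<And>g v. g \<in> carrier ?G \<Longrightarrow> v \<in> W \<Longrightarrow> T (rep_act M g v) = rep_act N g (T v)"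
      using rep_isomorphicE[OF rep_isomorphic_trans[OF rep_isomorphic_sym[OF W(2)] Z(2)]] by auto
    have W0: "0 \<in> W"
      using W(1) by (auto simp: invariant_subspace_def intro: cfun.subspace_0)
    have "T f \<noteq> 0"
      using inj_onD[OF bij_betw_imp_inj_on[OF T(2)], of f 0] f(1,2) W0 linear_map_on_0[OF T(1) W0] by metis
    moreover have "T f \<in> Z"
      using bij_betwE[OF T(2)] f(1) by blast
    moreover have "?fixed (T f)"
      using T(3)[OF _ f(1)] f(3) by (metis sym_group_carrier)
    ultimately show ?thesis
      using Z irreducible_rep_iso[OF Q(1) Z(2)] by blast
  qed
  obtain Z z where Z: "invariant_subspace ?G N Z" "rep_isomorphic ?G V (N\<lparr>rep_space := Z\<rparr>)"
    "irreducible_rep ?G (N\<lparr>rep_space := Z\<rparr>)" "z \<in> Z" "z \<noteq> 0" "?fixed z"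
    using ex[OF V] by blast
  obtain Z' z' where Z': "invariant_subspace ?G N Z'" "rep_isomorphic ?G V' (N\<lparr>rep_space := Z'\<rparr>)"
    "irreducible_rep ?G (N\<lparr>rep_space := Z'\<rparr>)" "z' \<in> Z'" "z' \<noteq> 0" "?fixed z'"
    using ex[OF V'] by blast
  have sub: "cfun.subspace Z" "cfun.subspace Z'" "Z \<subseteq> rep_space N" "Z' \<subseteq> rep_space N"
    using Z(1) Z'(1) by (auto simp: invariant_subspace_def)
  obtain a where a: "z = fscale a z'"
    using young_rep.stabiliser_vector_unique[OF N alt c cp, of z z'] Z(4,6) Z'(4-6) sub(3,4) by blast
  have "z \<in> Z \<inter> Z'"
    using Z(4) cfun.subspace_scale[OF sub(2) Z'(4)] a by blast
  then have nz: "Z \<inter> Z' \<noteq> {0}"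
    using Z(5) by blast
  have "invariant_subspace ?G (N\<lparr>rep_space := Z\<rparr>) (Z \<inter> Z')"
    "invariant_subspace ?G (N\<lparr>rep_space := Z'\<rparr>) (Z \<inter> Z')"
    using Z(1) Z'(1) cfun.subspace_inter[OF sub(1,2)]
    by (auto simp: invariant_subspace_def image_subset_iff)
  then have "Z \<inter> Z' = Z" "Z \<inter> Z' = Z'"
    using Z(3) Z'(3) nz by (auto simp: irreducible_rep_def)
  then have "Z = Z'"
    by blast
  then show ?thesis
    using rep_isomorphic_trans[OF Z(2)] rep_isomorphic_sym[OF Z'(2)] by simp
qed

lemma young_rep_trivial:
  assumes "sum_list l = n"
  shows "young_rep n l (\<lambda>_. 1) (young_perm_rep l)"
proof
  fix g f S assume "g permutes {1..n}"
  then have "inv\<^bsub>sym_group n\<^esub> g = inv' g"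
    by (intro sym_group_inv_equality) (simp add: sym_group_carrier)
  then show "rep_act (young_perm_rep l) g f S
      = (if S \<in> ordered_set_partitions l then 1 * f (map ((`) (inv' g)) S) else 0)"
    using assms by (simp add: young_perm_rep_def perm_rep_def)
qed (use assms in \<open>simp_all add: young_perm_rep_def perm_rep_def\<close>)

lemma young_rep_sign:
  assumes "sum_list l = n"
  shows "young_rep n l (\<lambda>g. of_int (sign g)) (sign_twist (young_perm_rep l))"
proof -
  interpret M: young_rep n l "\<lambda>_. 1" "young_perm_rep l"
    by (rule young_rep_trivial[OF assms])
  show ?thesis
  proof
    show "sum_list l = n" "rep_space (sign_twist (young_perm_rep l)) = functions_on (ordered_set_partitions l)"
      by (simp_all add: assms sign_twist_def M.space)
    show "rep_act (sign_twist (young_perm_rep l)) g f S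
      = (if S \<in> ordered_set_partitions l then of_int (sign g) * f (map ((`) (inv' g)) S) else 0)"
      if "g permutes {1..n}" for g f S
      using M.action[OF that] by (simp add: sign_twist_def fscale_apply)
    show "of_int (sign (g \<circ> h)) = (of_int (sign g) * of_int (sign h) :: complex)"
      if "g permutes {1..n}" "h permutes {1..n}" for g h
    proof -
      have "permutation g" "permutation h"
        using that permutation_permutes finite_atLeastAtMost by blast+
      then show ?thesis
        by (simp add: sign_compose)
    qed
    show "of_int (sign g) = (1 :: complex) \<or> of_int (sign g) = (- 1 :: complex)" for g :: "nat \<Rightarrow> nat"
      by (cases g rule: sign_cases) simp_all
  qed simp
qed

lemma (in matching_rep) U_isomorphic_V_irr:
  assumes l: "l \<in> TP n"
  shows "rep_isomorphic (sym_group n) (rho2 n\<lparr>rep_space := U l\<rparr>) (V_irr l)"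
proof -
  let ?G = "sym_group n" and ?U = "rho2 n\<lparr>rep_space := U l\<rparr>"
  let ?M = "young_perm_rep l" and ?N = "sign_twist (young_perm_rep (conjugate l))"
  have p: "is_partition n l"
    using l by (simp add: TP_iff)
  have size: "sum_list l = n"
    using p by (simp add: is_partition_def)
  interpret M: young_matching n l "\<lambda>_. 1" ?M
    unfolding young_matching_def by (rule young_rep_trivial[OF size])
  interpret N: young_matching n "conjugate l" "\<lambda>g. of_int (sign g)" ?N
    unfolding young_matching_def by (rule young_rep_sign[OF sum_list_conjugate[OF p]])
  have irr: "irreducible_rep ?G ?U"
    by (rule irreducible_rep_U[OF l])
  have occ_M: "occurs_in ?G ?U ?M"
    by (rule M.semi_invariant_occurs[OF invariant_U U_subset_F[OF l] U_irreducible[OF l] wvec_in_U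
          weight(3)[OF l] weight(1)[OF l]])
      (simp_all only: sym_vec_stab[OF weight(4)[OF l]] cfun.scale_one)
  obtain d z where z: "shape n d (part (conjugate l))" "z \<in> U l" "z \<noteq> 0" "alt_vec d z"
    using U_alt_vec[OF l] .
  have occ_N: "occurs_in ?G ?U ?N"
    by (rule N.semi_invariant_occurs[OF invariant_U U_subset_F[OF l] U_irreducible[OF l] z(2,3,1)])
      (simp_all only: alt_vec_stab[OF z(4)])
  \<comment> \<open>The choice in \<open>V_irr\<close> ranges over representations on functions of
    \<open>nat set list\<close>, so the witness is the copy of \<open>U l\<close> inside
    \<open>young_perm_rep l\<close>, not \<open>U l\<close> itself.\<close>
  obtain W where W: "invariant_subspace ?G ?M W" "rep_isomorphic ?G ?U (?M\<lparr>rep_space := W\<rparr>)"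
    using occ_M by (auto simp: occurs_in_def)
  let ?P = "\<lambda>V :: (nat \<Rightarrow> nat, nat set list) rep. irreducible_rep ?G V \<and> occurs_in ?G V ?M \<and> occurs_in ?G V ?N"
  have "?P (?M\<lparr>rep_space := W\<rparr>)"
    using irreducible_rep_iso[OF irr W(2)] occurs_in_iso[OF W(2)] occ_M occ_N by blast
  then have "?P (SOME V. ?P V)"
    by (rule someI[of ?P])
  then have V: "?P (V_irr l)"
    unfolding V_irr_def size .
  show ?thesis
  proof (rule irreducible_same_type[OF M.young_rep_axioms N.young_rep_axioms refl _ weight(1)[OF l]
        conj_pair_part[OF p] irr occ_M occ_N])
    show "of_int (sign (swap x y)) = (- 1 :: complex)" if "x \<noteq> y" for x y
      using that by (simp add: sign_swap_id)
  qed (use V in blast)+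
qed

theorem theorem43:
  fixes n m :: nat
  assumes "n = 2 * m" and "n > 0"
  shows "rep_isomorphic (sym_group n) (rho2 n) (direct_sum (TP n) V_irr)"
proof -
  interpret matching_rep n .
  show ?thesis
  proof (rule rep_isomorphic_direct_sum[where U = U and p = proj_U])
    show "linear_map_on (rep_space (rho2 n)) (proj_U l)" for l
      by (simp add: linear_map_on_def proj_U_add proj_U_scale)
    show "proj_U l (rep_act (rho2 n) g v) = rep_act (rho2 n) g (proj_U l v)"
      if l: "l \<in> TP n" and "g \<in> carrier (sym_group n)" and v: "v \<in> rep_space (rho2 n)" for l g v
    proof -
      have g: "g permutes {1..n}"
        using that(2) by (simp add: sym_group_carrier)
      have "proj_U l v \<in> F"
        using proj_U_in U_subset_F[OF l] by blast
      then show ?thesis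
        using v by (simp only: rep_space_rho2 rho2_act[OF g] proj_U_act[OF g])
    qed
    show "proj_U l (\<Sum>j\<in>TP n. f j) = f l" if "l \<in> TP n" "\<And>j. j \<in> TP n \<Longrightarrow> f j \<in> U j" for l f
      using that by (rule proj_U_sum)
  qed (simp_all add: is_rep_rho2 finite_TP U_isomorphic_V_irr rep_space_rho2 U_subset_F proj_U_in sum_proj_U)
qed

end
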